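(* For every integer $d > 0$ there exists a compact set $\mathbb{L} \subset \mathbb{X}_d$ with the following properties: (1) if $\Omega \in \mathbb{L}$, then $\Omega$ is not biholomorphic to the unit ball of $\mathbb{C}^d$; (2) if $\Omega \subset \mathbb{C}^d$ is a bounded convex domain with $C^\infty$ boundary which is not strongly pseudoconvex, then there exist a sequence $x_n \in \Omega$ approaching the boundary and affine maps $A_n \in \mathrm{Aff}(\mathbb{C}^d)$ such that $A_n(\Omega,x_n)$ converges (in $\mathbb{X}_{d,0}$) to $(\Omega_\infty, 0)$, where $\Omega_\infty \in \mathbb{L}$.
   Context: $\mathbb{X}_d$ is the set of convex domains in $\mathbb{C}^d$ which do not contain a complex affine line, and $\mathbb{X}_{d,0}$ is the set of pairs $(\Omega,x)$ with $\Omega \in \mathbb{X}_d$, $x \in \Omega$. $\mathrm{Aff}(\mathbb{C}^d)$ is the group of complex affine automorphisms of $\mathbb{C}^d$, acting by $A(\Omega,x) = (A\Omega, Ax)$. Topology: for compact sets, $d_H$ is the Hausdorff distance (for the Euclidean distance); for $R>0$ and closed $A, B$, let $d_H^{(R)}(A,B) = d_H(A \cap B_R(0), B \cap B_R(0))$, with $B_R(0)$ the closed Euclidean ball. Open convex sets $\Omega_n$ converge to an open convex set $\Omega$ in the local Hausdorff topology if there is $R_0 \geq 0$ with $\lim_{n\to\infty} d_H^{(R)}(\overline{\Omega}_n, \overline{\Omega}) = 0$ for all $R \geq R_0$. $\mathbb{X}_d$ carries the local Hausdorff topology; $(\Omega_n,x_n) \to (\Omega,x)$ in $\mathbb{X}_{d,0}$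 means $\Omega_n \to \Omega$ in the local Hausdorff topology and $x_n \to x$. *)

theory Defs
  imports "HOL-Analysis.Analysis"
begin

text \<open>Throughout, \<open>\<complex>\<^sup>d\<close> is the type \<^typ>\<open>complex ^ 'd\<close> with \<open>d = CARD('d) > 0\<close>; its norm is the Euclidean
  norm, and \<open>*s\<close> is multiplication by complex scalars.\<close>

section \<open>Convex domains without complex affine lines\<close>

definition convex_domain :: "(complex ^ 'd) set \<Rightarrow> bool" where
  "convex_domain \<Omega> \<longleftrightarrow> open \<Omega> \<and> \<Omega> \<noteq> {} \<and> convex \<Omega>"

definition contains_complex_line :: "(complex ^ 'd) set \<Rightarrow> bool" where
  "contains_complex_line \<Omega> \<longleftrightarrow> (\<exists>a v. v \<noteq> 0 \<and> range (\<lambda>t::complex. a + t *s v) \<subseteq> \<Omega>)"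

definition X_dom :: "(complex ^ 'd) set set" where
  "X_dom = {\<Omega>. convex_domain \<Omega> \<and> \<not> contains_complex_line \<Omega>}"

definition X_dom_pt :: "((complex ^ 'd) set \<times> (complex ^ 'd)) set" where
  "X_dom_pt = {(\<Omega>, x). \<Omega> \<in> X_dom \<and> x \<in> \<Omega>}"

definition Aff :: "(complex ^ 'd \<Rightarrow> complex ^ 'd) set" where
  "Aff = {A. \<exists>(M :: complex ^ 'd ^ 'd) b. invertible M \<and> A = (\<lambda>z. M *v z + b)}"

definition aff_act :: "(complex ^ 'd \<Rightarrow> complex ^ 'd) \<Rightarrow> (complex ^ 'd) set \<times> (complex ^ 'd)
    \<Rightarrow> (complex ^ 'd) set \<times> (complex ^ 'd)" where
  "aff_act A = (\<lambda>(\<Omega>, x). (A ` \<Omega>, A x))"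

section \<open>The local Hausdorff topology\<close>

text \<open>Values are taken in \<^typ>\<open>ennreal\<close> so that the empty set is at distance \<open>\<infinity>\<close> from every nonempty
  set and at distance \<open>0\<close> from itself; this matters because the truncations below may be empty.\<close>

definition hausdorff_dist :: "'a::metric_space set \<Rightarrow> 'a set \<Rightarrow> ennreal" where
  "hausdorff_dist A B =
     max (SUP a\<in>A. INF b\<in>B. ennreal (dist a b)) (SUP b\<in>B. INF a\<in>A. ennreal (dist a b))"

definition hausdorff_dist_R :: "real \<Rightarrow> 'a::real_normed_vector set \<Rightarrow> 'a set \<Rightarrow> ennreal" where
  "hausdorff_dist_R R A B = hausdorff_dist (A \<inter> cball 0 R) (B \<inter> cball 0 R)"

definition local_hausdorff_conv :: "(nat \<Rightarrow> 'a::real_normed_vector set) \<Rightarrow> 'a set \<Rightarrow> bool" where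
  "local_hausdorff_conv S \<Omega> \<longleftrightarrow>
     (\<exists>R\<^sub>0\<ge>0. \<forall>R\<ge>R\<^sub>0. (\<lambda>n. hausdorff_dist_R R (closure (S n)) (closure \<Omega>)) \<longlonglongrightarrow> 0)"

text \<open>The topology of \<open>X_dom\<close> is prescribed through its convergent sequences; its open sets are the
  sequentially open ones. Since this mode of convergence is metrizable on \<open>X_dom\<close>, this is the metric
  topology with exactly these convergent sequences.\<close>

definition lh_open :: "(complex ^ 'd) set set \<Rightarrow> bool" where
  "lh_open \<U> \<longleftrightarrow> \<U> \<subseteq> X_dom \<and>
     (\<forall>S \<Omega>. (\<forall>n. S n \<in> X_dom) \<longrightarrow> \<Omega> \<in> \<U> \<longrightarrow> local_hausdorff_conv S \<Omega> \<longrightarrow>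
        (\<forall>\<^sub>F n in sequentially. S n \<in> \<U>))"

definition local_hausdorff_topology :: "(complex ^ 'd) set topology" where
  "local_hausdorff_topology = topology lh_open"

lemma istopology_lh_open: "istopology lh_open"
  unfolding istopology_def
proof (intro conjI allI impI)
  fix U V :: "(complex ^ 'd) set set"
  assume "lh_open U" "lh_open V"
  then show "lh_open (U \<inter> V)"
    unfolding lh_open_def by (auto simp: eventually_conj_iff)
next
  fix K :: "(complex ^ 'd) set set set"
  assume K: "\<forall>U\<in>K. lh_open U"
  show "lh_open (\<Union> K)"
    unfolding lh_open_def
  proof (intro conjI allI impI)
    show "\<Union> K \<subseteq> X_dom" using K unfolding lh_open_def by blast
  next
    fix S :: "nat \<Rightarrow> (complex ^ 'd) set" and \<Omega>
    assume S: "\<forall>n. S n \<in> X_dom" "\<Omega> \<in> \<Union> K" "local_hausdorff_conv S \<Omega>"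
    then obtain U where U: "U \<in> K" "\<Omega> \<in> U" by blast
    with K S have "\<forall>\<^sub>F n in sequentially. S n \<in> U" unfolding lh_open_def by blast
    then show "\<forall>\<^sub>F n in sequentially. S n \<in> \<Union> K"
      by (rule eventually_mono) (use U in blast)
  qed
qed

lemma openin_local_hausdorff_topology: "openin local_hausdorff_topology U \<longleftrightarrow> lh_open U"
  by (simp add: local_hausdorff_topology_def topology_inverse'[OF istopology_lh_open])

lemma topspace_local_hausdorff_topology: "topspace local_hausdorff_topology = X_dom"
proof -
  have "lh_open X_dom" by (auto simp: lh_open_def)
  then show ?thesis
    by (auto simp: topspace_def openin_local_hausdorff_topology lh_open_def)
qed

definition pointed_conv :: "(nat \<Rightarrow> (complex ^ 'd) set \<times> (complex ^ 'd))
    \<Rightarrow> (complex ^ 'd) set \<times> (complex ^ 'd) \<Rightarrow> bool" where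
  "pointed_conv P Q \<longleftrightarrow>
     local_hausdorff_conv (\<lambda>n. fst (P n)) (fst Q) \<and> (\<lambda>n. snd (P n)) \<longlonglongrightarrow> snd Q"

section \<open>Biholomorphisms\<close>

text \<open>For an open set \<open>U\<close>, a map is holomorphic iff its real Frechet derivative exists and is
  complex linear at each point (real linearity is part of \<^const>\<open>has_derivative\<close>).\<close>

definition holomorphic_map_on :: "(complex ^ 'm \<Rightarrow> complex ^ 'n) \<Rightarrow> (complex ^ 'm) set \<Rightarrow> bool" where
  "holomorphic_map_on f U \<longleftrightarrow>
     (\<forall>z\<in>U. \<exists>D. (f has_derivative D) (at z) \<and> (\<forall>c v. D (c *s v) = c *s D v))"

definition biholomorphic :: "(complex ^ 'm) set \<Rightarrow> (complex ^ 'n) set \<Rightarrow> bool" where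
  "biholomorphic U V \<longleftrightarrow>
     (\<exists>f. bij_betw f U V \<and> holomorphic_map_on f U \<and> holomorphic_map_on (inv_into U f) V)"

section \<open>Smooth boundaries and strong pseudoconvexity\<close>

text \<open>Intended for open \<open>U\<close>, where this is the usual class \<open>C\<^sup>k\<close>.\<close>

primrec Ck_on :: "nat \<Rightarrow> ('a::euclidean_space \<Rightarrow> real) \<Rightarrow> 'a set \<Rightarrow> bool" where
  "Ck_on 0 f U \<longleftrightarrow> continuous_on U f"
| "Ck_on (Suc k) f U \<longleftrightarrow>
     (\<forall>x\<in>U. f differentiable (at x)) \<and> (\<forall>v. Ck_on k (\<lambda>x. frechet_derivative f (at x) v) U)"

definition smooth_fun_on :: "('a::euclidean_space \<Rightarrow> real) \<Rightarrow> 'a set \<Rightarrow> bool" where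
  "smooth_fun_on f U \<longleftrightarrow> (\<forall>k. Ck_on k f U)"

text \<open>Since the differential of \<open>r\<close> does not vanish on \<open>U\<close>, the description of \<open>\<Omega>\<close> implies
  that \<open>frontier \<Omega> \<inter> U = {x \<in> U. r x = 0}\<close>.\<close>

definition local_defining_function ::
    "'a::euclidean_space set \<Rightarrow> 'a \<Rightarrow> 'a set \<Rightarrow> ('a \<Rightarrow> real) \<Rightarrow> bool" where
  "local_defining_function \<Omega> p U r \<longleftrightarrow>
     open U \<and> p \<in> U \<and> smooth_fun_on r U \<and> \<Omega> \<inter> U = {x \<in> U. r x < 0} \<and>
     (\<forall>x\<in>U. frechet_derivative r (at x) \<noteq> (\<lambda>v. 0))"

definition smooth_boundary :: "'a::euclidean_space set \<Rightarrow> bool" where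
  "smooth_boundary \<Omega> \<longleftrightarrow> (\<forall>p\<in>frontier \<Omega>. \<exists>U r. local_defining_function \<Omega> p U r)"

text \<open>\<open>wirt j f\<close> is \<open>\<partial>f/\<partial>z\<^sub>j\<close> and \<open>wirt_bar j f\<close> is \<open>\<partial>f/\<partial>z\<^sub>j\<close>-bar; \<open>axis j 1\<close> and \<open>axis j \<i>\<close> are the
  directions of the real coordinates \<open>x\<^sub>j\<close> and \<open>y\<^sub>j\<close>.\<close>

definition wirt :: "'d \<Rightarrow> (complex ^ 'd \<Rightarrow> complex) \<Rightarrow> complex ^ 'd \<Rightarrow> complex" where
  "wirt j f z = (frechet_derivative f (at z) (axis j 1)
                   - \<i> * frechet_derivative f (at z) (axis j \<i>)) / 2"

definition wirt_bar :: "'d \<Rightarrow> (complex ^ 'd \<Rightarrow> complex) \<Rightarrow> complex ^ 'd \<Rightarrow> complex" where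
  "wirt_bar j f z = (frechet_derivative f (at z) (axis j 1)
                   + \<i> * frechet_derivative f (at z) (axis j \<i>)) / 2"

definition complex_tangent :: "(complex ^ 'd \<Rightarrow> real) \<Rightarrow> complex ^ 'd \<Rightarrow> (complex ^ 'd) set" where
  "complex_tangent r p = {v. (\<Sum>j\<in>UNIV. wirt j (\<lambda>z. of_real (r z)) p * v $ j) = 0}"

text \<open>The sum is real for a \<open>C\<^sup>2\<close> function \<open>r\<close>, so taking the real part only changes its type.\<close>

definition levi_form :: "(complex ^ 'd \<Rightarrow> real) \<Rightarrow> complex ^ 'd \<Rightarrow> complex ^ 'd \<Rightarrow> real" where
  "levi_form r p v =
     Re (\<Sum>j\<in>UNIV. \<Sum>k\<in>UNIV. wirt j (wirt_bar k (\<lambda>z. of_real (r z))) p * v $ j * cnj (v $ k))"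

text \<open>Intended for domains with smooth boundary. Positivity of the Levi form on the complex tangent
  space does not depend on the choice of the local defining function.\<close>

definition strongly_pseudoconvex :: "(complex ^ 'd) set \<Rightarrow> bool" where
  "strongly_pseudoconvex \<Omega> \<longleftrightarrow>
     (\<forall>p\<in>frontier \<Omega>. \<exists>U r. local_defining_function \<Omega> p U r \<and>
        (\<forall>v\<in>complex_tangent r p. v \<noteq> 0 \<longrightarrow> levi_form r p v > 0))"

definition approaches_boundary :: "(nat \<Rightarrow> 'a::metric_space) \<Rightarrow> 'a set \<Rightarrow> bool" where
  "approaches_boundary x \<Omega> \<longleftrightarrow> (\<lambda>n. infdist (x n) (frontier \<Omega>)) \<longlonglongrightarrow> 0"

end

theory Submission
  imports Defs "HOL-Complex_Analysis.Great_Picard"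
begin

text \<open>
  Let \<open>\<Omega>\<close> be a bounded convex domain with smooth boundary and \<open>p\<close> a boundary point at which the Levi form is not
  positive in some complex tangent direction \<open>v\<close>. By convexity the second derivatives of a defining
  function vanish along \<open>v\<close> and \<open>\<i> v\<close>, so along these directions the boundary leaves the tangent space only to third
  order (\<open>degenerate_boundary_point\<close>). Therefore, at height \<open>h\<close> above \<open>p\<close>, the domain contains discs in
  direction \<open>v\<close> of radius at least a multiple of \<open>h powr (2/5)\<close>. At a strongly pseudoconvex point this radius has
  the order of \<open>sqrt h\<close>, and this discrepancy survives rescaling.

  The domain is rescaled at points of the inner normal at \<open>p\<close> so that both the height and the radius become 1. If
  the heights almost minimise the ratio of the radius to \<open>h powr (2/5)\<close>, then in the rescaled domains the radius
  at every height \<open>h \<le> 1\<close> is at least \<open>h powr (2/5) / 2\<close>, with no constant depending on \<open>\<Omega>\<close>. A choice of the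
  remaining coordinates by a maximal determinant (\<open>tangential_frame_exists\<close>) keeps the limits free of complex
  lines. A subsequence converges to a domain whose closure is a \<open>degenerate_body\<close> (\<open>rescaling_limit\<close>). The
  interiors of all degenerate bodies, for all pairs of distinct coordinate directions, form the compact set: the conditions
  are stable under limits, and closed convex sets through the origin always have convergent subsequences
  (\<open>wijsman_convergent_subsequence\<close>, \<open>compactin_interior_image\<close>). In dimension 1 there is no such pair, and no
  domain with smooth boundary that fails to be strongly pseudoconvex.

  The interior of a degenerate body is not biholomorphic to the ball (\<open>not_biholomorphic_ball\<close>). It contains a
  half plane in the direction \<open>e\<^sub>a\<close> and, at height \<open>h\<close> above the bounding hyperplane, discs of radius
  \<open>h powr (2/5) / 2\<close> in the direction \<open>e\<^sub>b\<close>. A biholomorphism \<open>f\<close> onto the ball takes points at height \<open>h\<close> to points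
  at distance \<open>O(h)\<close> from the sphere, where discs have size \<open>O(sqrt h)\<close>. Its derivative in the direction
  \<open>e\<^sub>b\<close> thus tends to \<open>0\<close> uniformly at the edge of the half plane, and by the maximum principle it vanishes
  identically on the half plane, which is impossible for an injective derivative.
\<close>

section \<open>Convergence of closed convex sets through their distance functions\<close>

text \<open>This convergence implies the local Hausdorff one for convex sets through the origin. It is easier to
  extract limits from, because distance functions are 1-Lipschitz and need no truncation to balls.\<close>

definition wijsman_conv :: "(nat \<Rightarrow> 'a::metric_space set) \<Rightarrow> 'a set \<Rightarrow> bool" where
  "wijsman_conv S K \<longleftrightarrow> (\<forall>x. (\<lambda>n. infdist x (S n)) \<longlonglongrightarrow> infdist x K)"

lemma tendsto_fun_iff:
  fixes f :: "'b \<Rightarrow> 'i \<Rightarrow> 'c::topological_space"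
  shows "(f \<longlongrightarrow> l) F \<longleftrightarrow> (\<forall>i. ((\<lambda>c. f c i) \<longlongrightarrow> l i) F)"
  using limitin_componentwise[of "\<lambda>_. euclidean" UNIV f l F]
  by (simp add: euclidean_product_topology)

lemma countable_dense_set:
  obtains D :: "'a::{metric_space, second_countable_topology} set" where "countable D" "closure D = UNIV"
proof -
  obtain D :: "'a set" where D: "countable D" "\<And>X. open X \<Longrightarrow> X \<noteq> {} \<Longrightarrow> \<exists>d\<in>D. d \<in> X"
    using countable_dense_setE by blast
  have "x \<in> closure D" for x
    unfolding closure_approachable
  proof (intro allI impI)
    fix e :: real assume "e > 0"
    then show "\<exists>y\<in>D. dist y x < e" using D(2)[of "ball x e"] by (auto simp: dist_commute)
  qed
  then show ?thesis using that[OF D(1)] by blast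
qed

text \<open>All the functions \<open>\<lambda>x. infdist x A\<close> are 1-Lipschitz.\<close>

lemma infdist_tendsto_dense:
  assumes D: "closure D = UNIV"
    and lim: "\<And>q. q \<in> D \<Longrightarrow> (\<lambda>n. infdist q (S n)) \<longlonglongrightarrow> \<phi> q"
  shows "\<exists>l. (\<lambda>n. infdist x (S n)) \<longlonglongrightarrow> (l::real)"
proof -
  have "Cauchy (\<lambda>n. infdist x (S n))"
  proof (rule metric_CauchyI)
    fix e :: real assume "e > 0"
    have "e/3 > 0" "x \<in> closure D" using \<open>e > 0\<close> D by auto
    then obtain q where q: "q \<in> D" "dist q x < e/3" unfolding closure_approachable by blast
    have "Cauchy (\<lambda>n. infdist q (S n))"
      using lim[OF q(1)] by (rule LIMSEQ_imp_Cauchy)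
    then obtain M where M: "\<And>m n. m \<ge> M \<Longrightarrow> n \<ge> M \<Longrightarrow> dist (infdist q (S m)) (infdist q (S n)) < e/3"
      using metric_CauchyD[of "\<lambda>n. infdist q (S n)" "e/3"] \<open>e > 0\<close> by (metis divide_pos_pos zero_less_numeral)
    have "dist (infdist x (S m)) (infdist x (S n)) < e" if "m \<ge> M" "n \<ge> M" for m n
      using M[OF that] infdist_triangle_abs[of x "S m" q] infdist_triangle_abs[of x "S n" q] q(2)
      unfolding dist_real_def dist_commute[of q x] by linarith
    then show "\<exists>M. \<forall>m\<ge>M. \<forall>n\<ge>M. dist (infdist x (S m)) (infdist x (S n)) < e" by blast
  qed
  then show ?thesis using Cauchy_convergent_iff convergent_def by blast
qed

lemma wijsman_conv_dense:
  assumes D: "closure D = UNIV"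
    and lim: "\<And>q. q \<in> D \<Longrightarrow> (\<lambda>n. infdist q (S n)) \<longlonglongrightarrow> infdist q K"
  shows "wijsman_conv S K"
  unfolding wijsman_conv_def
proof
  fix x
  obtain l where l: "(\<lambda>n. infdist x (S n)) \<longlonglongrightarrow> l"
    using infdist_tendsto_dense[OF D lim] by blast
  have "\<bar>l - infdist x K\<bar> \<le> e" if "e > 0" for e
  proof -
    have "e/2 > 0" "x \<in> closure D" using that D by auto
    then obtain q where q: "q \<in> D" "dist q x < e/2" unfolding closure_approachable by blast
    have "(\<lambda>n. \<bar>infdist x (S n) - infdist q (S n)\<bar>) \<longlonglongrightarrow> \<bar>l - infdist q K\<bar>"
      by (intro tendsto_intros l lim q)
    then have "\<bar>l - infdist q K\<bar> \<le> dist x q"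
      by (rule LIMSEQ_le_const2) (auto intro: infdist_triangle_abs)
    then show ?thesis
      using q(2) infdist_triangle_abs[of x K q] by (simp add: dist_commute)
  qed
  then have "\<bar>l - infdist x K\<bar> \<le> 0" by (rule field_le_epsilon) simp
  then show "(\<lambda>n. infdist x (S n)) \<longlonglongrightarrow> infdist x K" using l by simp
qed

text \<open>Distance functions to sets through the origin are pointwise bounded, so a diagonal argument
  makes them converge on a countable dense set, hence everywhere; the limit function is the
  distance to its own zero set because nearest points stay bounded.\<close>

lemma wijsman_convergent_subsequence:
  fixes S :: "nat \<Rightarrow> 'a::euclidean_space set"
  assumes cl: "\<And>n. closed (S n)" and cv: "\<And>n. convex (S n)" and z: "\<And>n. 0 \<in> S n"
  obtains k K where "strict_mono (k::nat\<Rightarrow>nat)" "closed K" "convex K" "0 \<in> K"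
    "wijsman_conv (\<lambda>n. S (k n)) K"
proof -
  obtain D :: "'a set" where D: "countable D" and clD: "closure D = UNIV" by (rule countable_dense_set)
  have "norm (infdist x (S n) / (1 + norm x)) \<le> 1" for n x
    using infdist_le[OF z[of n], of x] infdist_nonneg[of x "S n"]
    by (simp add: divide_le_eq_1 add_pos_nonneg)
  then obtain k where k: "strict_mono (k::nat\<Rightarrow>nat)"
      "\<And>x. x \<in> D \<Longrightarrow> \<exists>l. (\<lambda>n. infdist x (S (k n)) / (1 + norm x)) \<longlonglongrightarrow> l"
    using function_convergent_subsequence[OF D, of "\<lambda>n x. infdist x (S n) / (1 + norm x)" 1]
    by blast
  have "\<exists>l. (\<lambda>n. infdist x (S (k n))) \<longlonglongrightarrow> l" if x: "x \<in> D" for x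
  proof -
    obtain l where "(\<lambda>n. infdist x (S (k n)) / (1 + norm x)) \<longlonglongrightarrow> l" using k(2)[OF x] by blast
    then have "(\<lambda>n. infdist x (S (k n)) / (1 + norm x) * (1 + norm x)) \<longlonglongrightarrow> l * (1 + norm x)"
      by (intro tendsto_intros)
    moreover have "1 + norm x \<noteq> 0" using norm_ge_zero[of x] by linarith
    ultimately show ?thesis by auto
  qed
  then obtain \<psi> where \<psi>: "\<And>x. x \<in> D \<Longrightarrow> (\<lambda>n. infdist x (S (k n))) \<longlonglongrightarrow> \<psi> x" by metis
  have "\<forall>x. \<exists>l. (\<lambda>n. infdist x (S (k n))) \<longlonglongrightarrow> l"
    using infdist_tendsto_dense[where S = "\<lambda>n. S (k n)", OF clD \<psi>] by blast
  then obtain \<phi> where \<phi>: "\<And>x. (\<lambda>n. infdist x (S (k n))) \<longlonglongrightarrow> \<phi> x"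
    unfolding choice_iff by blast
  define K where "K = {x. \<phi> x = 0}"
  have pos: "\<phi> x \<ge> 0" for x
    by (rule LIMSEQ_le_const[OF \<phi>]) (auto intro: infdist_nonneg)
  have lip: "\<phi> x \<le> \<phi> y + dist x y" for x y
    by (rule LIMSEQ_le[OF \<phi> tendsto_add[OF \<phi> tendsto_const]]) (auto intro: infdist_triangle)
  have "0 \<in> K" unfolding K_def using \<phi>[of 0] z by (simp add: LIMSEQ_const_iff)
  have "closed K"
    unfolding closed_sequential_limits
  proof (intro allI impI, elim conjE)
    fix x l assume x: "\<forall>n. x n \<in> K" "x \<longlonglongrightarrow> l"
    have "\<phi> l \<le> dist l (x n)" for n using lip[of l "x n"] x(1) by (simp add: K_def)
    moreover have "(\<lambda>n. dist l (x n)) \<longlonglongrightarrow> dist l l" by (intro tendsto_intros x)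
    ultimately have "\<phi> l \<le> 0" using LIMSEQ_le_const[of "\<lambda>n. dist l (x n)"] by simp
    then show "l \<in> K" using pos[of l] by (simp add: K_def)
  qed
  have "convex K"
    unfolding convex_alt
  proof (intro ballI allI impI)
    fix x y and u :: real assume xy: "x \<in> K" "y \<in> K" and u: "0 \<le> u \<and> u \<le> 1"
    have "infdist ((1-u) *\<^sub>R x + u *\<^sub>R y) (S n) \<le> (1-u) * infdist x (S n) + u * infdist y (S n)" for n
    proof -
      obtain a where a: "a \<in> S n" "infdist x (S n) = dist x a"
        using infdist_attains_inf[OF cl, of n x] z by blast
      obtain b where b: "b \<in> S n" "infdist y (S n) = dist y b"
        using infdist_attains_inf[OF cl, of n y] z by blast
      have "(1-u) *\<^sub>R a + u *\<^sub>R b \<in> S n" using cv[of n] a b u unfolding convex_alt by blast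
      then have "infdist ((1-u) *\<^sub>R x + u *\<^sub>R y) (S n) \<le> dist ((1-u) *\<^sub>R x + u *\<^sub>R y) ((1-u) *\<^sub>R a + u *\<^sub>R b)"
        by (rule infdist_le)
      also have "\<dots> = norm ((1-u) *\<^sub>R (x - a) + u *\<^sub>R (y - b))"
        by (simp add: dist_norm algebra_simps)
      also have "\<dots> \<le> (1-u) * norm (x-a) + u * norm (y-b)"
        by (rule norm_triangle_le) (use u in simp)
      finally show ?thesis by (simp add: a b dist_norm)
    qed
    then have "\<phi> ((1-u) *\<^sub>R x + u *\<^sub>R y) \<le> (1-u) * \<phi> x + u * \<phi> y"
      by (intro LIMSEQ_le[OF \<phi>[of "(1-u) *\<^sub>R x + u *\<^sub>R y"]
          tendsto_add[OF tendsto_mult[OF tendsto_const \<phi>[of x]] tendsto_mult[OF tendsto_const \<phi>[of y]]]]) auto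
    then show "(1-u) *\<^sub>R x + u *\<^sub>R y \<in> K" using xy pos[of "(1-u) *\<^sub>R x + u *\<^sub>R y"] by (simp add: K_def)
  qed
  have "infdist x K = \<phi> x" for x
  proof (rule antisym)
    have "\<exists>a. a \<in> S (k n) \<and> infdist x (S (k n)) = dist x a" for n
      using infdist_attains_inf[OF cl, of "k n" x] z by blast
    then obtain a where a: "\<And>n. a n \<in> S (k n)" "\<And>n. infdist x (S (k n)) = dist x (a n)" by metis
    have "a n \<in> cball x (norm x)" for n
      using infdist_le[OF z[of "k n"], of x] a(2)[of n] by simp
    then obtain l r where lr: "strict_mono (r::nat\<Rightarrow>nat)" "(a \<circ> r) \<longlonglongrightarrow> l"
      using compact_cball[of x "norm x"] unfolding compact_def by metis
    have "(\<lambda>n. infdist l (S (k (r n)))) \<longlonglongrightarrow> 0"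
    proof (rule tendsto_sandwich[of "\<lambda>_. 0" _ _ "\<lambda>n. dist l ((a \<circ> r) n)"])
      show "(\<lambda>n. dist l ((a \<circ> r) n)) \<longlonglongrightarrow> 0" using tendsto_dist[OF tendsto_const lr(2), of l] by simp
      show "\<forall>\<^sub>F n in sequentially. infdist l (S (k (r n))) \<le> dist l ((a \<circ> r) n)"
        using a(1) by (intro always_eventually allI infdist_le) (simp add: o_def)
    qed (simp_all add: infdist_nonneg)
    moreover have "(\<lambda>n. infdist l (S (k (r n)))) \<longlonglongrightarrow> \<phi> l"
      using LIMSEQ_subseq_LIMSEQ[OF \<phi> lr(1), of l] by (simp add: o_def)
    ultimately have "\<phi> l = 0" by (metis LIMSEQ_unique)
    then have "l \<in> K" by (simp add: K_def)
    then have "infdist x K \<le> dist x l" by (rule infdist_le)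
    also have "dist x l = \<phi> x"
    proof (rule LIMSEQ_unique)
      show "(\<lambda>n. dist x ((a \<circ> r) n)) \<longlonglongrightarrow> dist x l" by (intro tendsto_intros lr)
      show "(\<lambda>n. dist x ((a \<circ> r) n)) \<longlonglongrightarrow> \<phi> x"
        using LIMSEQ_subseq_LIMSEQ[OF \<phi> lr(1), of x] by (simp add: o_def a(2))
    qed
    finally show "infdist x K \<le> \<phi> x" .
    obtain y where y: "y \<in> K" "infdist x K = dist x y"
      using infdist_attains_inf[OF \<open>closed K\<close>, of x] \<open>0 \<in> K\<close> by blast
    then show "\<phi> x \<le> infdist x K" using lip[of x y] by (simp add: K_def)
  qed
  then have "wijsman_conv (\<lambda>n. S (k n)) K" unfolding wijsman_conv_def using \<phi> by simp
  then show ?thesis using that[OF k(1) \<open>closed K\<close> \<open>convex K\<close> \<open>0 \<in> K\<close>] by blast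
qed

lemma wijsman_conv_uniform_on_compact:
  assumes w: "wijsman_conv S K" and C: "compact C" and e: "e > 0"
  shows "\<forall>\<^sub>F n in sequentially. \<forall>x\<in>C. \<bar>infdist x (S n) - infdist x K\<bar> < e"
proof -
  obtain F where F: "finite F" "C \<subseteq> (\<Union>q\<in>F. ball q (e/3))"
    using compactE_image[OF C, of C "\<lambda>q. ball q (e/3)"] e
    by (metis UN_I centre_in_ball divide_pos_pos open_ball subsetI zero_less_numeral)
  have "\<forall>\<^sub>F n in sequentially. \<bar>infdist q (S n) - infdist q K\<bar> < e/3" for q
    using w divide_pos_pos[OF e, of 3] unfolding wijsman_conv_def tendsto_iff dist_real_def by fastforce
  then have "\<forall>\<^sub>F n in sequentially. \<forall>q\<in>F. \<bar>infdist q (S n) - infdist q K\<bar> < e/3"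
    using F(1) by (simp add: eventually_ball_finite_distrib)
  then show ?thesis
  proof eventually_elim
    case (elim n)
    show ?case
    proof
      fix x assume "x \<in> C"
      then obtain q where q: "q \<in> F" "dist q x < e/3" using F(2) by auto
      then have "\<bar>infdist q (S n) - infdist q K\<bar> < e/3" using elim by blast
      then show "\<bar>infdist x (S n) - infdist x K\<bar> < e"
        using infdist_triangle_abs[of x "S n" q] infdist_triangle_abs[of x K q] q(2)
        unfolding dist_commute[of q x] by linarith
    qed
  qed
qed

text \<open>A point of \<open>A\<close> in the ball of radius \<open>R\<close> has a nearest point in \<open>B\<close> which may leave that ball;
  since \<open>B\<close> is convex and contains the centre, shrinking towards the centre brings it back at the cost
  of a factor 2.\<close>

lemma truncated_infdist_le:
  fixes A B :: "'a::euclidean_space set"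
  assumes "closed B" "convex B" "0 \<in> B" "R > 0" "norm a \<le> R" "infdist a B \<le> e"
  shows "\<exists>b\<in>B \<inter> cball 0 R. dist a b \<le> 2 * e"
proof -
  obtain c where c: "c \<in> B" "infdist a B = dist a c"
    using infdist_attains_inf[OF assms(1), of a] assms(3) by blast
  have e: "dist a c \<le> e" "e \<ge> 0" using c assms(6) infdist_nonneg[of a B] by linarith+
  have nc: "norm c \<le> R + e" using e(1) assms(5) norm_triangle_ineq2[of c a] by (simp add: dist_norm norm_minus_commute)
  define t where "t = R / (R + e)"
  have t: "0 \<le> t" "t \<le> 1" using assms(4) e(2) by (auto simp: t_def)
  have "t *\<^sub>R c \<in> B"
    using convexD_alt[OF assms(2,3) c(1) t] by simp
  moreover have "norm (t *\<^sub>R c) \<le> R"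
  proof -
    have "norm (t *\<^sub>R c) = t * norm c" using t by simp
    also have "\<dots> \<le> t * (R + e)" using nc t by (intro mult_left_mono)
    also have "\<dots> = R" using assms(4) e(2) by (simp add: t_def)
    finally show ?thesis .
  qed
  moreover have "dist c (t *\<^sub>R c) \<le> e"
  proof -
    have "c - t *\<^sub>R c = (1 - t) *\<^sub>R c" by (simp add: algebra_simps)
    then have "dist c (t *\<^sub>R c) = (1 - t) * norm c" using t by (simp add: dist_norm)
    also have "\<dots> \<le> (1 - t) * (R + e)" using nc t by (intro mult_left_mono) auto
    also have "\<dots> = e" using assms(4) e(2) by (simp add: t_def field_simps)
    finally show ?thesis .
  qed
  ultimately show ?thesis using dist_triangle[of a "t *\<^sub>R c" c] e by (intro bexI[of _ "t *\<^sub>R c"]) auto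
qed

lemma hausdorff_dist_le:
  assumes "e \<ge> 0" "\<And>a. a \<in> A \<Longrightarrow> \<exists>b\<in>B. dist a b \<le> e" "\<And>b. b \<in> B \<Longrightarrow> \<exists>a\<in>A. dist a b \<le> e"
  shows "hausdorff_dist A B \<le> ennreal e"
  unfolding hausdorff_dist_def max.bounded_iff
proof (intro conjI SUP_least)
  fix a assume "a \<in> A"
  then obtain b where "b \<in> B" "dist a b \<le> e" using assms(2) by blast
  then show "(INF b\<in>B. ennreal (dist a b)) \<le> ennreal e" by (intro INF_lower2[of b]) (auto intro: ennreal_leI)
next
  fix b assume "b \<in> B"
  then obtain a where "a \<in> A" "dist a b \<le> e" using assms(3) by blast
  then show "(INF a\<in>A. ennreal (dist a b)) \<le> ennreal e" by (intro INF_lower2[of a]) (auto intro: ennreal_leI)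
qed

lemma wijsman_conv_imp_hausdorff_dist_R:
  fixes S :: "nat \<Rightarrow> 'a::euclidean_space set"
  assumes w: "wijsman_conv S K"
    and S: "\<And>n. closed (S n)" "\<And>n. convex (S n)" "\<And>n. 0 \<in> S n"
    and K: "closed K" "convex K" "0 \<in> K" and R: "R > 0"
  shows "(\<lambda>n. hausdorff_dist_R R (S n) K) \<longlonglongrightarrow> 0"
proof (rule order_tendstoI)
  fix y :: ennreal assume "y < 0" then show "\<forall>\<^sub>F n in sequentially. y < hausdorff_dist_R R (S n) K" by simp
next
  fix y :: ennreal assume "0 < y"
  then obtain c where c: "0 < c" "c < y" using dense by blast
  then have "c < top" using less_top_ennreal order_less_le_trans top_greatest by blast
  define e where "e = enn2real c"
  have e: "e > 0" "ennreal e < y" using c \<open>c < top\<close> by (auto simp: e_def enn2real_positive_iff)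
  have "\<forall>\<^sub>F n in sequentially. \<forall>x\<in>cball 0 R. \<bar>infdist x (S n) - infdist x K\<bar> < e/2"
    by (rule wijsman_conv_uniform_on_compact[OF w]) (use e in auto)
  then show "\<forall>\<^sub>F n in sequentially. hausdorff_dist_R R (S n) K < y"
  proof eventually_elim
    case (elim n)
    have "hausdorff_dist_R R (S n) K \<le> ennreal e"
      unfolding hausdorff_dist_R_def
    proof (rule hausdorff_dist_le)
      fix a assume a: "a \<in> S n \<inter> cball 0 R"
      then have "infdist a K \<le> e/2" using elim by (force)
      then show "\<exists>b\<in>K \<inter> cball 0 R. dist a b \<le> e"
        using truncated_infdist_le[OF K R, of a "e/2"] a by auto
    next
      fix b assume b: "b \<in> K \<inter> cball 0 R"
      then have "infdist b (S n) \<le> e/2" using elim by (force)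
      then show "\<exists>a\<in>S n \<inter> cball 0 R. dist a b \<le> e"
        using truncated_infdist_le[OF S[of n] R, of b "e/2"] b by (auto simp: dist_commute)
    qed (use e in simp)
    then show ?case using e by simp
  qed
qed

section \<open>Compactness in the local Hausdorff topology\<close>

text \<open>A point missing from \<open>S n\<close> is separated from it by a hyperplane; moving it by \<open>r\<close> away from
  \<open>S n\<close> gives a point of \<open>K\<close> whose distance to \<open>S n\<close> is at least \<open>r\<close>.\<close>

lemma wijsman_conv_eventually_subset:
  fixes S :: "nat \<Rightarrow> 'a::euclidean_space set"
  assumes w: "wijsman_conv S K"
    and S: "\<And>n. closed (S n)" "\<And>n. convex (S n)" "\<And>n. S n \<noteq> {}"
    and C: "compact C" and r: "r > 0" "\<And>x. x \<in> C \<Longrightarrow> cball x r \<subseteq> K"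
  shows "\<forall>\<^sub>F n in sequentially. C \<subseteq> S n"
proof -
  define C' where "C' = {x + y | x y. x \<in> C \<and> y \<in> cball 0 r}"
  have "compact C'" unfolding C'_def by (rule compact_sums[OF C compact_cball])
  have C'K: "C' \<subseteq> K"
  proof
    fix z assume "z \<in> C'"
    then obtain x y where "z = x + y" "x \<in> C" "norm y \<le> r" by (auto simp: C'_def)
    then have "z \<in> cball x r" by (simp add: dist_norm)
    then show "z \<in> K" using r(2)[OF \<open>x \<in> C\<close>] by blast
  qed
  have "\<forall>\<^sub>F n in sequentially. \<forall>x\<in>C'. \<bar>infdist x (S n) - infdist x K\<bar> < r"
    by (rule wijsman_conv_uniform_on_compact[OF w \<open>compact C'\<close> r(1)])
  then show ?thesis
  proof eventually_elim
    case (elim n)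
    show ?case
    proof
      fix y assume y: "y \<in> C"
      show "y \<in> S n"
      proof (rule ccontr)
        assume "y \<notin> S n"
        then obtain a b where ab: "inner a y < b" "\<And>x. x \<in> S n \<Longrightarrow> inner a x > b"
          using separating_hyperplane_closed_point[OF S(2,1)] by metis
        obtain s where "s \<in> S n" using S(3)[of n] by blast
        then have "a \<noteq> 0" using ab(1) ab(2)[of s] by auto
        define z where "z = y - (r / norm a) *\<^sub>R a"
        have "z = y + - ((r / norm a) *\<^sub>R a)" "norm (- ((r / norm a) *\<^sub>R a)) \<le> r"
          using \<open>a \<noteq> 0\<close> r(1) by (auto simp: z_def)
        then have "z \<in> C'" using y unfolding C'_def mem_cball_0 by blast
        then have "infdist z (S n) < r" using elim C'K by force
        obtain x where x: "x \<in> S n" "infdist z (S n) = dist z x"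
          using infdist_attains_inf[OF S(1) S(3)] by blast
        have "r * norm a + inner a y = inner a (y - z) + inner a y"
          using \<open>a \<noteq> 0\<close> by (simp add: z_def power2_norm_eq_inner[symmetric] power2_eq_square)
        also have "\<dots> < inner a (y - z) + inner a x" using ab(1) ab(2)[OF x(1)] by linarith
        also have "\<dots> = inner a (x - z) + inner a y" by (simp add: inner_diff_right)
        also have "\<dots> \<le> norm a * norm (x - z) + inner a y" using norm_cauchy_schwarz by simp
        finally have "r < norm (x - z)" using \<open>a \<noteq> 0\<close> by simp
        then show False using x \<open>infdist z (S n) < r\<close> by (simp add: dist_norm norm_minus_commute)
      qed
    qed
  qed
qed

lemma wijsman_conv_imp_local_hausdorff_conv:
  fixes \<Omega> :: "nat \<Rightarrow> 'a::euclidean_space set"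
  assumes "wijsman_conv (\<lambda>n. closure (\<Omega> n)) (closure \<Omega>')"
    and "\<And>n. convex (\<Omega> n)" "\<And>n. 0 \<in> \<Omega> n" "convex \<Omega>'" "0 \<in> \<Omega>'"
  shows "local_hausdorff_conv \<Omega> \<Omega>'"
  unfolding local_hausdorff_conv_def
proof (intro exI[of _ 1] conjI allI impI)
  fix R :: real assume "1 \<le> R"
  then show "(\<lambda>n. hausdorff_dist_R R (closure (\<Omega> n)) (closure \<Omega>')) \<longlonglongrightarrow> 0"
    using assms by (intro wijsman_conv_imp_hausdorff_dist_R) (auto intro: convex_closure closure_subset[THEN subsetD])
qed simp

text \<open>The topology is only known through its convergent sequences, so sequential compactness does not
  immediately give compactness. Recording the distances to a countable dense set embeds the family
  into the metrizable space of real sequences, with compact image; the inverse of this embedding is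
  continuous for the local Hausdorff topology.\<close>

lemma compactin_interior_image:
  fixes \<K> :: "(complex ^ 'd) set set"
  assumes body: "\<And>K. K \<in> \<K> \<Longrightarrow> closed K" "\<And>K. K \<in> \<K> \<Longrightarrow> convex K" "\<And>K. K \<in> \<K> \<Longrightarrow> 0 \<in> interior K"
    and dom: "\<And>K. K \<in> \<K> \<Longrightarrow> interior K \<in> X_dom"
    and lim: "\<And>S K. (\<And>n. S n \<in> \<K>) \<Longrightarrow> closed K \<Longrightarrow> convex K \<Longrightarrow> 0 \<in> K \<Longrightarrow> wijsman_conv S K \<Longrightarrow> K \<in> \<K>"
  shows "compactin local_hausdorff_topology (interior ` \<K>)"
proof -
  have z: "0 \<in> K" if "K \<in> \<K>" for K using body(3)[OF that] interior_subset by blast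
  obtain D :: "(complex ^ 'd) set" where D: "countable D" and clD: "closure D = UNIV" by (rule countable_dense_set)
  then have "D \<noteq> {}" by auto
  define q where "q = from_nat_into D"
  have q: "range q = D" unfolding q_def by (rule range_from_nat_into[OF \<open>D \<noteq> {}\<close> D])
  define F :: "(complex ^ 'd) set \<Rightarrow> nat \<Rightarrow> real" where "F K = (\<lambda>k. infdist (q k) K)" for K
  have conv: "wijsman_conv S K" if "(\<lambda>n. F (S n)) \<longlonglongrightarrow> F K" for S K
  proof (rule wijsman_conv_dense[OF clD])
    fix p assume "p \<in> D"
    then obtain k where "p = q k" using q by blast
    then show "(\<lambda>n. infdist p (S n)) \<longlonglongrightarrow> infdist p K"
      using that[unfolded tendsto_fun_iff F_def, rule_format, of k] by simp
  qed
  have inj: "inj_on F \<K>"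
  proof (rule inj_onI)
    fix K K' assume K: "K \<in> \<K>" "K' \<in> \<K>" "F K = F K'"
    then have "wijsman_conv (\<lambda>n::nat. K) K'" by (intro conv) simp
    then have "infdist x K = infdist x K'" for x unfolding wijsman_conv_def by (simp add: LIMSEQ_const_iff)
    moreover have "K \<noteq> {}" "K' \<noteq> {}" using z K(1,2) by blast+
    ultimately have "x \<in> K \<longleftrightarrow> x \<in> K'" for x
      using in_closed_iff_infdist_zero[OF body(1)[OF K(1)], of x] in_closed_iff_infdist_zero[OF body(1)[OF K(2)], of x]
      by simp
    then show "K = K'" by blast
  qed
  define G where "G y = interior (inv_into \<K> F y)" for y
  have GF: "G (F K) = interior K" if "K \<in> \<K>" for K using inj that by (simp add: G_def)
  have subseq: "\<exists>K\<in>\<K>. \<exists>k. strict_mono (k::nat\<Rightarrow>nat) \<and> (\<lambda>n. F (S (k n))) \<longlonglongrightarrow> F K"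
    if S: "\<And>n. S n \<in> \<K>" for S
  proof -
    obtain k K where k: "strict_mono (k::nat\<Rightarrow>nat)" "closed K" "convex K" "0 \<in> K" "wijsman_conv (\<lambda>n. S (k n)) K"
      by (rule wijsman_convergent_subsequence[of S]) (use body(1,2) z S in blast)+
    have "K \<in> \<K>" by (rule lim[of "\<lambda>n. S (k n)", OF S k(2-5)])
    moreover have "(\<lambda>n. F (S (k n))) \<longlonglongrightarrow> F K"
      unfolding tendsto_fun_iff F_def using k(5) unfolding wijsman_conv_def by simp
    ultimately show ?thesis using k(1) by (intro bexI[of _ K] exI[of _ k] conjI)
  qed
  have "compact (F ` \<K>)"
    unfolding compact_def
  proof (intro allI impI)
    fix y :: "nat \<Rightarrow> nat \<Rightarrow> real" assume y: "\<forall>n. y n \<in> F ` \<K>"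
    define S where "S n = inv_into \<K> F (y n)" for n
    have "y n \<in> F ` \<K>" for n using y by blast
    then have S: "S n \<in> \<K>" "y n = F (S n)" for n
      unfolding S_def by (rule inv_into_into, rule f_inv_into_f[symmetric])
    obtain K k where K: "K \<in> \<K>" "strict_mono (k::nat\<Rightarrow>nat)" "(\<lambda>n. F (S (k n))) \<longlonglongrightarrow> F K"
      using subseq[of S, OF S(1)] by blast
    have "y \<circ> k = (\<lambda>n. F (S (k n)))" using S(2) by (simp add: o_def)
    then show "\<exists>l\<in>F ` \<K>. \<exists>r. strict_mono r \<and> (y \<circ> r) \<longlonglongrightarrow> l"
      using K by (intro bexI[of _ "F K"] exI[of _ k]) auto
  qed
  have cont: "continuous_map (top_of_set (F ` \<K>)) local_hausdorff_topology G"
    unfolding continuous_map_def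
  proof (intro conjI allI impI)
    show "G \<in> topspace (top_of_set (F ` \<K>)) \<rightarrow> topspace local_hausdorff_topology"
      using dom GF by (auto simp: topspace_local_hausdorff_topology)
  next
    fix U assume "openin local_hausdorff_topology (U :: (complex ^ 'd) set set)"
    then have U: "lh_open U" by (simp add: openin_local_hausdorff_topology)
    have "closed {y \<in> F ` \<K>. G y \<notin> U}"
      unfolding closed_sequential_limits
    proof (intro allI impI, elim conjE)
      fix y l assume y: "\<forall>n. y n \<in> {y \<in> F ` \<K>. G y \<notin> U}" "y \<longlonglongrightarrow> l"
      then have "l \<in> F ` \<K>"
        by (intro closed_sequentially[OF compact_imp_closed[OF \<open>compact (F ` \<K>)\<close>], of y l]) auto
      then obtain K where K: "K \<in> \<K>" "l = F K" by blast
      define S where "S n = inv_into \<K> F (y n)" for n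
      have "y n \<in> F ` \<K>" for n using y(1) by blast
      then have S: "S n \<in> \<K>" "y n = F (S n)" for n
        unfolding S_def by (rule inv_into_into, rule f_inv_into_f[symmetric])
      have "G l \<notin> U"
      proof
        assume "G l \<in> U"
        then have "interior K \<in> U" using GF K by simp
        moreover have "local_hausdorff_conv (\<lambda>n. interior (S n)) (interior K)"
        proof (rule wijsman_conv_imp_local_hausdorff_conv)
          have "closure (interior K) = K" if "K \<in> \<K>" for K
            using convex_closure_interior[OF body(2)[OF that]] body(3)[OF that] closure_closed[OF body(1)[OF that]] by auto
          moreover have "y = (\<lambda>n. F (S n))" using S(2) by (rule ext)
          ultimately show "wijsman_conv (\<lambda>n. closure (interior (S n))) (closure (interior K))"
            using conv[of S K] y(2) S(1) K by simp
        qed (use body S K in \<open>auto intro: convex_interior\<close>)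
        ultimately have "\<forall>\<^sub>F n in sequentially. interior (S n) \<in> U"
          using dom[OF S(1)]
          by (intro U[unfolded lh_open_def, THEN conjunct2, rule_format, of "\<lambda>n. interior (S n)" "interior K"])
        then obtain n where "interior (S n) \<in> U" using eventually_happens'[OF sequentially_bot] by blast
        then show False using y(1) S GF by auto
      qed
      then show "l \<in> {y \<in> F ` \<K>. G y \<notin> U}" using \<open>l \<in> F ` \<K>\<close> by blast
    qed
    then have "closedin (top_of_set (F ` \<K>)) {y \<in> F ` \<K>. G y \<notin> U}"
      by (intro closed_subset) auto
    then have "openin (top_of_set (F ` \<K>)) (F ` \<K> - {y \<in> F ` \<K>. G y \<notin> U})"
      by (rule openin_diff[OF openin_subtopology_self])
    moreover have "F ` \<K> - {y \<in> F ` \<K>. G y \<notin> U} = {y \<in> F ` \<K>. G y \<in> U}" by blast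
    ultimately show "openin (top_of_set (F ` \<K>)) {x \<in> topspace (top_of_set (F ` \<K>)). G x \<in> U}"
      by simp
  qed
  have "compactin (top_of_set (F ` \<K>)) (F ` \<K>)"
    using \<open>compact (F ` \<K>)\<close> by (simp add: compactin_subtopology)
  from image_compactin[OF this cont] have "compactin local_hausdorff_topology (G ` F ` \<K>)" .
  moreover have "G ` F ` \<K> = interior ` \<K>" using GF by (simp add: image_image)
  ultimately show ?thesis by simp
qed

section \<open>Large discs obstruct biholomorphisms onto the ball\<close>

lemma bounded_linear_scalar_mult_vec: "bounded_linear (\<lambda>t. t *s (y :: complex ^ 'd))"
  by (intro linear_conv_bounded_linear[THEN iffD1] linearI) (simp_all add: vec_eq_iff algebra_simps)

lemma has_field_derivative_along_line:
  fixes f :: "complex ^ 'm \<Rightarrow> complex ^ 'n"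
  assumes f: "(f has_derivative D) (at (x + t *s y))" and D: "\<And>c v. D (c *s v) = c *s D v"
  shows "((\<lambda>s. f (x + s *s y) $ c) has_field_derivative D y $ c) (at t)"
proof -
  have "((\<lambda>s. x + s *s y) has_derivative (\<lambda>h. h *s y)) (at t)"
    using has_derivative_add[OF has_derivative_const[where c=x]
        bounded_linear.has_derivative[OF bounded_linear_scalar_mult_vec has_derivative_ident]] by simp
  from diff_chain_at[OF this f]
  have "((\<lambda>s. f (x + s *s y)) has_derivative (\<lambda>h. h *s D y)) (at t)"
    by (simp add: o_def D)
  from bounded_linear.has_derivative[OF bounded_linear_vec_nth this, of c]
  show ?thesis unfolding has_field_derivative_def by (simp add: mult.commute[of _ "D y $ c"])
qed

lemma holomorphic_on_line:
  assumes f: "holomorphic_map_on f U" and sub: "\<And>t. t \<in> S \<Longrightarrow> x + t *s y \<in> U"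
  shows "(\<lambda>t. f (x + t *s y) $ c) holomorphic_on S"
  unfolding holomorphic_on_def
proof
  fix t assume "t \<in> S"
  then obtain D where D: "(f has_derivative D) (at (x + t *s y))" "\<forall>c v. D (c *s v) = c *s D v"
    using f sub unfolding holomorphic_map_on_def by meson
  have "((\<lambda>s. f (x + s *s y) $ c) has_field_derivative D y $ c) (at t)"
    by (rule has_field_derivative_along_line[OF D(1)]) (use D(2) in simp)
  then show "(\<lambda>t. f (x + t *s y) $ c) field_differentiable at t within S"
    unfolding field_differentiable_def using has_field_derivative_at_within by blast
qed

text \<open>Harnack's inequality for the positive harmonic function \<open>Re q\<close>: the Schwarz lemma applies to the
  Cayley transform of \<open>q\<close> that sends \<open>q 0\<close> to \<open>0\<close>.\<close>

lemma harnack_disc: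
  assumes q: "q holomorphic_on ball 0 1" and pos: "\<And>t. cmod t < 1 \<Longrightarrow> Re (q t) > 0" and t: "cmod t < 1"
  shows "(1 - cmod t) * Re (q t) \<le> (1 + cmod t) * Re (q 0)"
    and "(1 - cmod t) * Re (q 0) \<le> (1 + cmod t) * Re (q t)"
proof -
  define m where "m s = (q s - q 0) / (q s + cnj (q 0))" for s
  have p0: "Re (q 0) > 0" using pos by simp
  have nz: "q s + cnj (q 0) \<noteq> 0" if "cmod s < 1" for s
  proof
    assume "q s + cnj (q 0) = 0"
    from arg_cong[OF this, of Re] have "Re (q s) + Re (q 0) = 0" by simp
    then show False using pos[OF that] p0 by linarith
  qed
  have sq: "(cmod (q s + cnj (q 0)))\<^sup>2 - (cmod (q s - q 0))\<^sup>2 = 4 * Re (q s) * Re (q 0)" for s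
    unfolding cmod_power2 by (simp add: power2_eq_square algebra_simps)
  have lt: "cmod (m s) < 1" if "cmod s < 1" for s
  proof -
    have "(cmod (q s - q 0))\<^sup>2 < (cmod (q s + cnj (q 0)))\<^sup>2" using sq[of s] pos[OF that] p0 by (smt (verit) mult_pos_pos)
    then have "cmod (q s - q 0) < cmod (q s + cnj (q 0))" by (rule power_less_imp_less_base) simp
    then show ?thesis using nz[OF that] by (simp add: m_def norm_divide)
  qed
  have "m holomorphic_on ball 0 1" unfolding m_def using q nz by (auto intro!: holomorphic_intros)
  then have "cmod (m t) \<le> cmod t" by (rule Schwarz_Lemma(1)[OF _ _ lt t]) (simp_all add: m_def)
  then have "cmod (q t - q 0) \<le> cmod t * cmod (q t + cnj (q 0))"
    using nz[OF t] by (simp add: m_def norm_divide divide_le_eq)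
  then have "(cmod (q t - q 0))\<^sup>2 \<le> (cmod t * cmod (q t + cnj (q 0)))\<^sup>2" by (rule power_mono) simp
  then have "(Re (q t) - Re (q 0))\<^sup>2 + (Im (q t) - Im (q 0))\<^sup>2
      \<le> (cmod t)\<^sup>2 * ((Re (q t) + Re (q 0))\<^sup>2 + (Im (q t) - Im (q 0))\<^sup>2)"
    unfolding power_mult_distrib cmod_power2 by simp
  moreover have "(cmod t)\<^sup>2 * (Im (q t) - Im (q 0))\<^sup>2 \<le> 1 * (Im (q t) - Im (q 0))\<^sup>2"
    by (rule mult_right_mono) (use t in \<open>auto simp: power_le_one\<close>)
  ultimately have "(Re (q t) - Re (q 0))\<^sup>2 \<le> (cmod t)\<^sup>2 * (Re (q t) + Re (q 0))\<^sup>2"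
    unfolding distrib_left by linarith
  then have "(Re (q t) - Re (q 0))\<^sup>2 \<le> (cmod t * (Re (q t) + Re (q 0)))\<^sup>2"
    unfolding power_mult_distrib .
  then have "\<bar>Re (q t) - Re (q 0)\<bar> \<le> cmod t * (Re (q t) + Re (q 0))"
    unfolding abs_le_square_iff[symmetric] using pos[OF t] p0 by (simp add: abs_mult)
  then show "(1 - cmod t) * Re (q t) \<le> (1 + cmod t) * Re (q 0)"
    and "(1 - cmod t) * Re (q 0) \<le> (1 + cmod t) * Re (q t)"
    by (auto simp: algebra_simps abs_le_iff)
qed

lemma holomorphic_on_dilation:
  assumes "g holomorphic_on ball 0 \<rho>" and "cmod \<kappa> \<le> \<rho>" "\<rho> > 0"
  shows "(\<lambda>s. g (\<kappa> * s)) holomorphic_on ball 0 1"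
proof -
  have "(*) \<kappa> ` ball 0 1 \<subseteq> ball 0 \<rho>"
  proof clarsimp
    fix s :: complex assume "cmod s < 1"
    then have "cmod \<kappa> * cmod s \<le> \<rho> * cmod s" "\<rho> * cmod s < \<rho>" using assms by (auto intro: mult_right_mono)
    then show "cmod (\<kappa> * s) < \<rho>" by (simp add: norm_mult)
  qed
  moreover have "(*) \<kappa> holomorphic_on ball 0 1" by (intro holomorphic_intros)
  ultimately show ?thesis using holomorphic_on_compose_gen[OF _ assms(1)] by (simp add: o_def)
qed

lemma inner_vec_eq_Re_sum: "inner x y = Re (\<Sum>c\<in>UNIV. x $ c * cnj (y $ c))" for x y :: "complex ^ 'd"
  by (simp add: inner_vec_def inner_complex_def)

text \<open>A disc of radius \<open>\<rho>\<close> in the unit ball whose centre is close to the sphere must be small in all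
  directions: Harnack's inequality for \<open>1 - \<langle>g, g 0\<rangle>\<close> bounds \<open>norm (g t - g 0)\<close> on half the disc by a
  multiple of the square root of \<open>1 - norm (g 0)^2\<close>, and the Schwarz lemma makes the bound linear.\<close>

lemma ball_disc_estimate:
  fixes g :: "complex \<Rightarrow> complex ^ 'd"
  assumes g: "\<And>c. (\<lambda>t. g t $ c) holomorphic_on ball 0 \<rho>" and b: "\<And>t. cmod t < \<rho> \<Longrightarrow> norm (g t) < 1"
    and \<rho>: "\<rho> > 0" and t: "cmod t < \<rho> / 2"
  shows "cmod (g t $ c - g 0 $ c) \<le> sqrt (28 * (1 - (norm (g 0))\<^sup>2)) * cmod t / \<rho>"
proof -
  define \<sigma> where "\<sigma> = 1 - (norm (g 0))\<^sup>2"
  have n0: "norm (g 0) < 1" using b[of 0] \<rho> by simp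
  then have "\<sigma> > 0" by (simp add: \<sigma>_def power_less_one_iff)
  \<comment> \<open>\<open>q s = 1 - \<langle>g (\<rho> s), g 0\<rangle>\<close> has positive real part and equals \<open>\<sigma>\<close> at \<open>0\<close>.\<close>
  define q where "q s = 1 - (\<Sum>c\<in>UNIV. g (of_real \<rho> * s) $ c * cnj (g 0 $ c))" for s
  have Req: "Re (q s) = 1 - inner (g (of_real \<rho> * s)) (g 0)" for s
    by (simp add: q_def inner_vec_eq_Re_sum)
  have sm: "cmod (of_real \<rho> * s) < \<rho>" if "cmod s < 1" for s using that \<rho> by (simp add: norm_mult)
  have "(\<lambda>s. g (of_real \<rho> * s) $ c) holomorphic_on ball 0 1" for c
    by (rule holomorphic_on_dilation[OF g]) (use \<rho> in auto)
  then have hq: "q holomorphic_on ball 0 1" unfolding q_def by (intro holomorphic_intros)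
  have inn: "inner (g (of_real \<rho> * s)) (g 0) < 1" if "cmod s < 1" for s
  proof -
    have "inner (g (of_real \<rho> * s)) (g 0) \<le> norm (g (of_real \<rho> * s)) * norm (g 0)" by (rule norm_cauchy_schwarz)
    also have "\<dots> \<le> 1 * norm (g 0)" using b[OF sm[OF that]] by (intro mult_right_mono) auto
    finally show ?thesis using n0 by simp
  qed
  have half: "(norm (g s - g 0))\<^sup>2 \<le> 6 * \<sigma>" if s: "cmod s \<le> \<rho> / 2" for s
  proof -
    define s' where "s' = s / of_real \<rho>"
    have s': "of_real \<rho> * s' = s" "cmod s' \<le> 1/2" using \<rho> s by (auto simp: s'_def norm_divide divide_le_eq)
    have "(1 - cmod s') * Re (q s') \<le> (1 + cmod s') * Re (q 0)"
      by (rule harnack_disc(1)[OF hq]) (use inn Req s' in auto)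
    also have "Re (q 0) = \<sigma>" by (simp add: Req \<sigma>_def power2_norm_eq_inner)
    also have "(1 + cmod s') * \<sigma> \<le> (3/2) * \<sigma>" using s' \<open>\<sigma> > 0\<close> by (intro mult_right_mono) auto
    finally have "(1 - cmod s') * Re (q s') \<le> (3/2) * \<sigma>" .
    moreover have "(1/2) * Re (q s') \<le> (1 - cmod s') * Re (q s')"
      using inn[of s'] s' Req[of s'] by (intro mult_right_mono) auto
    ultimately have "Re (q s') \<le> 3 * \<sigma>" by linarith
    then have i: "1 - inner (g s) (g 0) \<le> 3 * \<sigma>" using Req[of s'] s' by simp
    have "norm (g s) < 1" using b[of s] s \<rho> by simp
    then have "(norm (g s))\<^sup>2 \<le> 1" "(norm (g 0))\<^sup>2 \<le> 1" using n0 by (simp_all add: power_le_one)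
    moreover have "(norm (g s - g 0))\<^sup>2 = (norm (g s))\<^sup>2 + (norm (g 0))\<^sup>2 - 2 * inner (g s) (g 0)"
      by (simp add: power2_norm_eq_inner inner_diff_left inner_diff_right inner_commute)
    ultimately show ?thesis using i by linarith
  qed
  \<comment> \<open>The factor 7 exceeds the 6 of the previous bound, so that the rescaled map stays strictly inside the disc.\<close>
  define M where "M = sqrt (7 * \<sigma>)"
  have M: "M > 0" "M\<^sup>2 = 7 * \<sigma>" using \<open>\<sigma> > 0\<close> by (auto simp: M_def)
  define \<phi> where "\<phi> s = (g (of_real (\<rho>/2) * s) $ c - g 0 $ c) / of_real M" for s
  have sm2: "cmod (of_real (\<rho>/2) * s) \<le> \<rho>/2" "cmod (of_real (\<rho>/2) * s) < \<rho>" if "cmod s < 1" for s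
    using that \<rho> by (simp_all add: norm_mult)
  have "(\<lambda>s. g (of_real (\<rho>/2) * s) $ c) holomorphic_on ball 0 1"
    by (rule holomorphic_on_dilation[OF g]) (use \<rho> in auto)
  then have h\<phi>: "\<phi> holomorphic_on ball 0 1" unfolding \<phi>_def using M by (intro holomorphic_intros) auto
  have \<phi>1: "cmod (\<phi> s) < 1" if "cmod s < 1" for s
  proof -
    have "cmod (g (of_real (\<rho>/2) * s) $ c - g 0 $ c) \<le> norm (g (of_real (\<rho>/2) * s) - g 0)"
      using Finite_Cartesian_Product.norm_nth_le[of "g (of_real (\<rho>/2) * s) - g 0" c] by simp
    moreover have "norm (g (of_real (\<rho>/2) * s) - g 0) < M"
      by (rule power_less_imp_less_base[of _ 2]) (use half[OF sm2(1)[OF that]] M \<open>\<sigma> > 0\<close> in auto)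
    ultimately show ?thesis using M by (simp add: \<phi>_def norm_divide)
  qed
  define t' where "t' = t / of_real (\<rho>/2)"
  have t': "of_real (\<rho>/2) * t' = t" "cmod t' < 1" using \<rho> t by (auto simp: t'_def norm_divide divide_less_eq)
  have "cmod (\<phi> t') \<le> cmod t'" by (rule Schwarz_Lemma(1)[OF h\<phi> _ \<phi>1 t'(2)]) (simp_all add: \<phi>_def)
  then have "cmod (g t $ c - g 0 $ c) \<le> M * cmod t'"
    using M unfolding \<phi>_def t'(1) by (simp add: norm_divide divide_le_eq mult.commute)
  also have "\<dots> = sqrt (4 * (7 * \<sigma>)) * cmod t / \<rho>"
    using \<rho> unfolding real_sqrt_mult[of 4] by (simp add: M_def t'_def norm_divide)
  finally show ?thesis by (simp add: \<sigma>_def)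
qed

text \<open>The maximum principle on the unbounded half plane: the factor \<open>\<i> R / (w - \<i> s + \<i> R)\<close> has modulus
  at most 1, makes the function small at infinity, and tends to 1 as \<open>R\<close> grows.\<close>

lemma halfplane_maximum_principle:
  assumes g: "g holomorphic_on {w. Im w > s'}" and s: "s' < s"
    and C: "\<And>w. Im w \<ge> s \<Longrightarrow> cmod (g w) \<le> C" and e: "\<And>w. Im w = s \<Longrightarrow> cmod (g w) \<le> e" "e > 0"
    and w0: "Im w\<^sub>0 \<ge> s"
  shows "cmod (g w\<^sub>0) \<le> e"
proof -
  define p where "p = Complex 0 s"
  have C0: "C \<ge> 0" using C[OF w0] norm_ge_zero[of "g w\<^sub>0"] by linarith
  have main: "cmod (g w\<^sub>0) \<le> e * (1 + cmod (w\<^sub>0 - p) / R)" if R: "R > 0" for R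
  proof -
    define k where "k w = w - p + \<i> * of_real R" for w
    have kR: "R \<le> cmod (k w)" if "Im w \<ge> s" for w
    proof -
      have "R \<le> Im (k w)" using that by (simp add: k_def p_def)
      also have "\<dots> \<le> cmod (k w)" using abs_Im_le_cmod[of "k w"] by linarith
      finally show ?thesis .
    qed
    have knz: "k w \<noteq> 0" if "Im w \<ge> s" for w using kR[OF that] R by auto
    define h where "h w = g w * (\<i> * of_real R / k w)" for w
    have nh: "cmod (h w) = cmod (g w) * (R / cmod (k w))" for w
      using R by (simp add: h_def norm_mult norm_divide)
    \<comment> \<open>The radius \<open>T\<close> is so large that the damping factor is below \<open>e / C\<close> on the arc.\<close>
    define T where "T = max (cmod (w\<^sub>0 - p) + 1) (R + C * R / e + 1)"
    define S where "S = {w. Im w \<ge> s} \<inter> cball p T"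
    have "closed S" unfolding S_def by (intro closed_Int closed_halfspace_Im_ge closed_cball)
    have hol: "h holomorphic_on S"
    proof -
      have "g holomorphic_on S" by (rule holomorphic_on_subset[OF g]) (use s in \<open>auto simp: S_def\<close>)
      then show ?thesis unfolding h_def k_def using knz by (intro holomorphic_intros) (auto simp: k_def S_def)
    qed
    have "cmod (h w\<^sub>0) \<le> e"
    proof (rule maximum_modulus_frontier[of h S])
      show "h holomorphic_on interior S" using hol by (rule holomorphic_on_subset) (rule interior_subset)
      show "continuous_on (closure S) h" using hol \<open>closed S\<close> by (simp add: holomorphic_on_imp_continuous_on)
      show "bounded S" unfolding S_def by (simp add: bounded_Int)
      show "w\<^sub>0 \<in> S" using w0 by (simp add: S_def T_def dist_norm norm_minus_commute)
      fix w assume w: "w \<in> frontier S"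
      then have wS: "w \<in> S" using \<open>closed S\<close> by (simp add: frontier_def)
      then have Imw: "Im w \<ge> s" by (simp add: S_def)
      have "{w. Im w > s} \<inter> ball p T \<subseteq> interior S"
        by (rule interior_maximal) (auto simp: S_def intro!: open_Int open_halfspace_Im_gt)
      then consider "Im w = s" | "dist p w = T"
        using w wS by (force simp: frontier_def S_def)
      then show "cmod (h w) \<le> e"
      proof cases
        case 1
        have "R / cmod (k w) \<le> 1" using kR[OF Imw] R by (auto simp: divide_le_eq)
        then have "cmod (g w) * (R / cmod (k w)) \<le> cmod (g w) * 1" by (intro mult_left_mono) auto
        then show ?thesis using e(1)[OF 1] nh[of w] by simp
      next
        case 2
        have "T \<ge> R + C * R / e + 1" "C * R / e \<ge> 0" using R e(2) C0 by (auto simp: T_def)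
        then have TR: "T - R > C * R / e" "T - R > 0" by linarith+
        have "cmod (w - p) = T" using 2 by (simp add: dist_norm norm_minus_commute)
        then have "T - R \<le> cmod (k w)"
          using norm_diff_ineq[of "w - p" "\<i> * of_real R"] R by (simp add: k_def norm_mult)
        then have "C * R / cmod (k w) \<le> C * R / (T - R)"
          using TR C0 R by (intro divide_left_mono mult_nonneg_nonneg mult_pos_pos) auto
        also have "\<dots> \<le> e" using TR e(2) by (simp add: divide_le_eq divide_less_eq mult.commute)
        finally have "C * R / cmod (k w) \<le> e" .
        moreover have "cmod (g w) * (R / cmod (k w)) \<le> C * (R / cmod (k w))"
          using C[OF Imw] R by (intro mult_right_mono) auto
        ultimately show ?thesis using nh[of w] by simp
      qed
    qed
    then have "cmod (g w\<^sub>0) * R / cmod (k w\<^sub>0) \<le> e" using nh[of w\<^sub>0] by simp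
    moreover have "cmod (k w\<^sub>0) > 0" using kR[OF w0] R by linarith
    ultimately have "cmod (g w\<^sub>0) * R \<le> e * cmod (k w\<^sub>0)" by (simp only: pos_divide_le_eq)
    also have "cmod (k w\<^sub>0) \<le> cmod (w\<^sub>0 - p) + R"
      using norm_triangle_ineq[of "w\<^sub>0 - p" "\<i> * of_real R"] R by (simp add: k_def norm_mult)
    finally have "cmod (g w\<^sub>0) \<le> e * (cmod (w\<^sub>0 - p) + R) / R" using e(2) R by (simp add: pos_le_divide_eq)
    also have "\<dots> = e * (1 + cmod (w\<^sub>0 - p) / R)" using R by (simp add: field_simps)
    finally show ?thesis .
  qed
  have "(\<lambda>n. e * (1 + cmod (w\<^sub>0 - p) / real (Suc n))) \<longlonglongrightarrow> e * (1 + 0)"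
    by (intro tendsto_intros LIMSEQ_Suc[OF lim_const_over_n])
  then show ?thesis using main by (intro LIMSEQ_le_const[of _ e]) auto
qed

lemma axis_eq_scalar_mult: "axis i (t :: complex) = t *s axis i 1"
  by (simp add: vec_eq_iff axis_def)

lemma axis_zero: "axis i (0 :: complex) = 0"
  by (simp add: vec_eq_iff axis_def)

lemma norm_scalar_mult_vec: "norm (t *s v) = cmod t * norm v" for v :: "complex ^ 'd"
  by (simp add: norm_vec_def norm_mult L2_set_right_distrib)

lemma norm_deriv_le_of_lipschitz_at:
  fixes \<phi> :: "complex \<Rightarrow> complex"
  assumes "(\<phi> has_field_derivative d) (at 0)" and "r > 0"
    and "\<And>t. t \<noteq> 0 \<Longrightarrow> cmod t < r \<Longrightarrow> cmod (\<phi> t - \<phi> 0) \<le> K * cmod t"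
  shows "cmod d \<le> K"
proof -
  have lim: "((\<lambda>t. cmod ((\<phi> t - \<phi> 0) / t)) \<longlongrightarrow> cmod d) (at 0)"
    using assms(1) by (intro tendsto_norm) (simp add: has_field_derivative_iff)
  have "\<forall>\<^sub>F t in at 0. cmod ((\<phi> t - \<phi> 0) / t) \<le> K"
    unfolding eventually_at using assms(2,3)
    by (intro exI[of _ r]) (auto simp: norm_divide divide_le_eq)
  then show ?thesis using tendsto_upperbound[OF lim] by simp
qed

lemma inverse_has_derivative_inj:
  assumes "open \<Omega>" "z \<in> \<Omega>" "(f has_derivative D) (at z)" "(h has_derivative E) (at (f z))"
    and "\<And>x. x \<in> \<Omega> \<Longrightarrow> h (f x) = x"
  shows "E (D v) = v"
proof -
  have "((\<lambda>x. x) has_derivative (E \<circ> D)) (at z)"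
    by (rule has_derivative_transform_within_open[OF diff_chain_at[OF assms(3,4)] assms(1,2)])
       (simp add: assms(5))
  then have "(E \<circ> D) = (\<lambda>x. x)" using has_derivative_ident has_derivative_unique by blast
  then show ?thesis by (metis comp_apply)
qed

text \<open>Suppose \<open>f\<close> maps \<open>\<Omega>\<close> biholomorphically onto the ball. Harnack's inequality for the positive function
  \<open>Im z\<^sub>a + 1\<close>, transported to the ball, shows that points \<open>w e\<^sub>a\<close> with \<open>Im w + 1 = s\<close> are mapped to within
  \<open>O(s)\<close> of the sphere. At such points \<open>\<Omega>\<close> contains discs in direction \<open>b\<close> of radius of order
  \<open>s powr (2/5)\<close>, whereas discs in the ball centred at that depth have size at most \<open>O(sqrt s)\<close>. Hence the
  difference quotients of \<open>f\<close> in direction \<open>b\<close> are \<open>O(s powr (1/10))\<close> there. This bound is uniform along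
  the horizontal line \<open>Im w + 1 = s\<close>, so by the maximum principle it holds at a fixed point above all these lines;
  letting \<open>s\<close> tend to \<open>0\<close> shows that the derivative of \<open>f\<close> in direction \<open>b\<close> vanishes at that point.
  The hypothesis on \<open>\<Omega>\<close> is the radius bound with \<open>s = u ^ 5\<close>.\<close>

lemma not_biholomorphic_ball:
  fixes \<Omega> :: "(complex ^ 'd) set"
  assumes op: "open \<Omega>"
    and lower: "\<And>z. z \<in> \<Omega> \<Longrightarrow> Im (z $ a) > -1"
    and region: "\<And>u t w. 0 < u \<Longrightarrow> u \<le> 1 \<Longrightarrow> cmod t < u\<^sup>2 / 2 \<Longrightarrow> Im w + 1 > u ^ 5 \<Longrightarrow>
      axis a w + axis b t \<in> \<Omega>"
  shows "\<not> biholomorphic \<Omega> (ball (0 :: complex ^ 'd) 1)"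
proof
  assume "biholomorphic \<Omega> (ball (0 :: complex ^ 'd) 1)"
  then obtain f where bij: "bij_betw f \<Omega> (ball (0 :: complex ^ 'd) 1)" and hf: "holomorphic_map_on f \<Omega>"
    and hh: "holomorphic_map_on (inv_into \<Omega> f) (ball (0 :: complex ^ 'd) 1)"
    unfolding biholomorphic_def by blast
  define h where "h = inv_into \<Omega> f"
  have hfz: "h (f z) = z" if "z \<in> \<Omega>" for z
    unfolding h_def using bij that by (intro inv_into_f_f) (auto simp: bij_betw_def)
  have hB: "h y \<in> \<Omega>" if "norm y < 1" for y
    unfolding h_def using bij that by (intro inv_into_into) (auto simp: bij_betw_def)
  have fB: "norm (f z) < 1" if "z \<in> \<Omega>" for z
    using bij that unfolding bij_betw_def by force
  define \<kappa> where "\<kappa> = Im (h 0 $ a) + 1"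
  have \<kappa>: "\<kappa> > 0" using lower[OF hB[of 0]] by (simp add: \<kappa>_def)
  \<comment> \<open>Harnack's inequality on the complex line through \<open>0\<close> and \<open>f z\<close>.\<close>
  have depth: "1 - (norm (f z))\<^sup>2 \<le> 4 * (Im (z $ a) + 1) / \<kappa>" if z: "z \<in> \<Omega>" for z
  proof -
    define r where "r = norm (f z)"
    have r: "0 \<le> r" "r < 1" using fB[OF z] by (auto simp: r_def)
    have "(1 - r) * \<kappa> \<le> (1 + r) * (Im (z $ a) + 1)"
    proof (cases "r = 0")
      case True
      then have "z = h 0" using hfz[OF z] by (simp add: r_def)
      then show ?thesis using True by (simp add: \<kappa>_def)
    next
      case False
      define v where "v = of_real (1 / r) *s f z"
      have nv: "norm v = 1" using False r by (simp add: v_def norm_scalar_mult_vec norm_divide r_def[symmetric])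
      have rv: "of_real r *s v = f z" using False by (simp add: v_def vec_eq_iff)
      define q where "q t = 1 - \<i> * h (0 + t *s v) $ a" for t
      have "q holomorphic_on ball 0 1"
        unfolding q_def h_def
        by (intro holomorphic_intros holomorphic_on_line[OF hh]) (simp add: norm_scalar_mult_vec nv)
      moreover have "Re (q t) > 0" if "cmod t < 1" for t
        using lower[OF hB[of "t *s v"]] that by (simp add: q_def norm_scalar_mult_vec nv)
      moreover have nr: "cmod (complex_of_real r) = r" using r by simp
      ultimately have "(1 - cmod (complex_of_real r)) * Re (q 0) \<le> (1 + cmod (complex_of_real r)) * Re (q (complex_of_real r))"
        using r by (intro harnack_disc(2)) (simp_all only: nr)
      then show ?thesis using rv hfz[OF z] unfolding nr by (simp add: q_def \<kappa>_def add.commute)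
    qed
    also have "\<dots> \<le> 2 * (Im (z $ a) + 1)" using r lower[OF z] by (intro mult_right_mono) auto
    finally have le: "(1 - r) * \<kappa> \<le> 2 * (Im (z $ a) + 1)" .
    have "(1 + r) * ((1 - r) * \<kappa>) \<le> 2 * (2 * (Im (z $ a) + 1))"
      by (rule mult_mono[OF _ le]) (use r \<kappa> in auto)
    then have "(1 - r\<^sup>2) * \<kappa> \<le> 4 * (Im (z $ a) + 1)" by (simp add: power2_eq_square algebra_simps)
    then show ?thesis using \<kappa> by (simp add: r_def le_divide_eq)
  qed
  \<comment> \<open>\<open>224 = 28 * 8\<close> combines the disc estimate with the depth bound at height \<open>2 u ^ 5\<close>.\<close>
  define C where "C = 2 * sqrt (224 / \<kappa>)"
  have C: "C > 0" using \<kappa> by (simp add: C_def)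
  define z\<^sub>0 :: "complex ^ 'd" where "z\<^sub>0 = axis a \<i>"
  have "axis a \<i> + axis b 0 \<in> \<Omega>" by (rule region[of 1]) auto
  then have z0: "z\<^sub>0 \<in> \<Omega>" by (simp add: z\<^sub>0_def axis_zero)
  have key: "cmod (f (z\<^sub>0 + t *s axis b 1) $ c - f z\<^sub>0 $ c) \<le> C * sqrt u * cmod t"
    if u: "0 < u" "u \<le> 1" and t: "t \<noteq> 0" "cmod t < u\<^sup>2 / 4" for u t c
  proof -
    define G where "G w = f (axis b t + w *s axis a 1) $ c - f (0 + w *s axis a 1) $ c" for w
    have inO: "axis b s + w *s axis a 1 \<in> \<Omega>" if "cmod s < u\<^sup>2 / 2" "Im w > u ^ 5 - 1" for s w
      using region[OF u that(1), of w] that(2) by (simp add: axis_eq_scalar_mult[symmetric] add.commute)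
    have inO0: "0 + w *s axis a 1 \<in> \<Omega>" if "Im w > u ^ 5 - 1" for w
      using inO[of 0, OF _ that] u by (simp add: axis_zero)
    have t2: "cmod t < u\<^sup>2 / 2" using t(2) zero_less_power[OF u(1), of 2] by linarith
    have u5: "u ^ 5 > 0" "u ^ 5 \<le> 1" using u by (auto simp: power_le_one)
    \<comment> \<open>The boundary line lies at height \<open>2 u ^ 5\<close>, strictly inside the region of the hypothesis.\<close>
    have "cmod (G \<i>) \<le> C * sqrt u * cmod t"
    proof (rule halfplane_maximum_principle[of G "u ^ 5 - 1" "2 * u ^ 5 - 1" 2])
      show "G holomorphic_on {w. u ^ 5 - 1 < Im w}"
        unfolding G_def
        by (intro holomorphic_intros holomorphic_on_line[OF hf]) (use inO t2 inO0 in auto)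
      show "cmod (G w) \<le> 2" if "2 * u ^ 5 - 1 \<le> Im w" for w
      proof -
        have w: "Im w > u ^ 5 - 1" using that u5 by linarith
        have "cmod (G w) \<le> cmod (f (axis b t + w *s axis a 1) $ c) + cmod (f (0 + w *s axis a 1) $ c)"
          unfolding G_def by (rule norm_triangle_ineq4)
        also have "\<dots> \<le> 1 + 1"
          using fB[OF inO[OF t2 w]] fB[OF inO0[OF w]]
            Finite_Cartesian_Product.norm_nth_le[of "f (axis b t + w *s axis a 1)" c]
            Finite_Cartesian_Product.norm_nth_le[of "f (0 + w *s axis a 1)" c] by linarith
        finally show ?thesis by simp
      qed
      show "cmod (G w) \<le> C * sqrt u * cmod t" if Imw: "Im w = 2 * u ^ 5 - 1" for w
      proof -
        have w: "Im w > u ^ 5 - 1" using Imw u5 by linarith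
        define g where "g s = f (0 + w *s axis a 1 + s *s axis b 1)" for s
        have gO: "0 + w *s axis a 1 + s *s axis b 1 \<in> \<Omega>" if "cmod s < u\<^sup>2 / 2" for s
          using inO[OF that w] by (simp add: axis_eq_scalar_mult[of b s] add.commute)
        have "cmod (g t $ c - g 0 $ c) \<le> sqrt (28 * (1 - (norm (g 0))\<^sup>2)) * cmod t / (u\<^sup>2 / 2)"
        proof (rule ball_disc_estimate)
          show "(\<lambda>t. g t $ c) holomorphic_on ball 0 (u\<^sup>2 / 2)" for c
            unfolding g_def by (rule holomorphic_on_line[OF hf]) (use gO in auto)
        qed (use t u fB gO in \<open>auto simp: g_def\<close>)
        also have "\<dots> \<le> sqrt (28 * (8 * u ^ 5 / \<kappa>)) * cmod t / (u\<^sup>2 / 2)"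
        proof -
          have "g 0 = f (0 + w *s axis a 1)" by (simp add: g_def)
          then have "1 - (norm (g 0))\<^sup>2 \<le> 4 * (2 * u ^ 5) / \<kappa>"
            using depth[OF inO0[OF w]] Imw by (simp add: axis_def)
          then show ?thesis
            using u by (intro divide_right_mono mult_right_mono real_sqrt_le_mono) auto
        qed
        also have "\<dots> = C * sqrt u * cmod t"
        proof -
          have "28 * (8 * u ^ 5 / \<kappa>) = (224 / \<kappa>) * u * (u\<^sup>2)\<^sup>2" by (simp add: eval_nat_numeral)
          then have "sqrt (28 * (8 * u ^ 5 / \<kappa>)) = sqrt (224 / \<kappa>) * sqrt u * u\<^sup>2"
            using u by (simp only: real_sqrt_mult real_sqrt_abs) simp
          then show ?thesis using u by (simp add: C_def)
        qed
        finally show ?thesis by (simp add: G_def g_def axis_eq_scalar_mult[of b t] add.commute)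
      qed
      show "0 < C * sqrt u * cmod t" using C u t by simp
    qed (use u5 in auto)
    then show ?thesis
      by (simp add: G_def z\<^sub>0_def axis_eq_scalar_mult[of b t] axis_eq_scalar_mult[of a \<i>] add.commute)
  qed
  obtain D where D: "(f has_derivative D) (at z\<^sub>0)" "\<And>c v. D (c *s v) = c *s D v"
    using hf z0 unfolding holomorphic_map_on_def by blast
  obtain E where E: "(h has_derivative E) (at (f z\<^sub>0))"
    using hh[unfolded holomorphic_map_on_def h_def[symmetric], rule_format, of "f z\<^sub>0"] fB[OF z0] by auto
  have "D (axis b 1) $ c = 0" for c
  proof -
    have le: "cmod (D (axis b 1) $ c) \<le> C * sqrt u" if u: "0 < u" "u \<le> 1" for u
    proof (rule norm_deriv_le_of_lipschitz_at)
      have "(f has_derivative D) (at (z\<^sub>0 + 0 *s axis b 1))" using D(1) by simp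
      then show "((\<lambda>s. f (z\<^sub>0 + s *s axis b 1) $ c) has_field_derivative D (axis b 1) $ c) (at 0)"
        by (rule has_field_derivative_along_line) (rule D(2))
      show "u\<^sup>2 / 4 > 0" using u by simp
    qed (use key u in simp)
    have "(\<lambda>n. C * sqrt (1 / real (Suc n))) \<longlonglongrightarrow> C * sqrt 0"
      by (intro tendsto_intros LIMSEQ_Suc[OF lim_const_over_n])
    moreover have "cmod (D (axis b 1) $ c) \<le> C * sqrt (1 / real (Suc n))" for n
      by (rule le) auto
    ultimately have "cmod (D (axis b 1) $ c) \<le> C * sqrt 0"
      by (intro LIMSEQ_le_const[of "\<lambda>n. C * sqrt (1 / real (Suc n))"]) auto
    then show ?thesis by simp
  qed
  then have "D (axis b 1) = 0" by (simp add: vec_eq_iff)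
  then have "E 0 = axis b 1" using inverse_has_derivative_inj[OF op z0 D(1) E hfz, of "axis b 1"] by simp
  moreover have "E 0 = 0" using E has_derivative_bounded_linear linear_simps(3) by blast
  ultimately show False by (simp add: axis_eq_0_iff)
qed

section \<open>Degenerate convex bodies\<close>

text \<open>The normalisation that a convex set satisfies after rescaling at a degenerate boundary point: the origin is at
  height 1 above the hyperplane \<open>Im z\<^sub>a = -1\<close>, and \<open>e\<^sub>b\<close> is the endpoint of a largest disc in direction \<open>b\<close>.
  The clause with \<open>u\<close> gives discs of radius \<open>h powr (2/5) / 2\<close> in direction \<open>b\<close> at height \<open>h = u ^ 5\<close>; the
  exponent \<open>2/5\<close> could be any number strictly between \<open>1/3\<close> and \<open>1/2\<close>. The last clause bounds the other
  directions and excludes complex lines in the limit.\<close>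

definition tangential_frame :: "'d \<Rightarrow> 'd \<Rightarrow> (complex ^ 'd) set \<Rightarrow> bool" where
  "tangential_frame a b K \<longleftrightarrow> closed K \<and> convex K \<and> 0 \<in> K \<and>
     (\<forall>z\<in>K. Im (z $ a) \<ge> -1) \<and> axis b 1 \<notin> interior K \<and>
     (\<forall>j \<zeta>. j \<noteq> a \<longrightarrow> cmod \<zeta> \<le> 1 \<longrightarrow> axis j \<zeta> \<in> K) \<and>
     (\<forall>u t. 0 < u \<longrightarrow> u \<le> 1 \<longrightarrow> cmod t < u\<^sup>2 / 2 \<longrightarrow> axis a (\<i> * of_real (u ^ 5 - 1)) + axis b t \<in> K) \<and>
     (\<forall>w. w $ a = 0 \<longrightarrow> (\<forall>\<zeta>. cmod \<zeta> \<le> 1 \<longrightarrow> \<zeta> *s w \<in> K) \<longrightarrow> (\<forall>j. j \<noteq> a \<longrightarrow> j \<noteq> b \<longrightarrow> cmod (w $ j) \<le> 1))"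

text \<open>The additional half plane appears in the limit, because a smooth boundary becomes flat in the
  complex line of the normal when it is magnified.\<close>

definition degenerate_body :: "'d \<Rightarrow> 'd \<Rightarrow> (complex ^ 'd) set \<Rightarrow> bool" where
  "degenerate_body a b K \<longleftrightarrow> tangential_frame a b K \<and> (\<forall>w. Im w > -1 \<longrightarrow> axis a w \<in> K)"

lemma tangential_frameD:
  assumes "tangential_frame a b K"
  shows "closed K" "convex K" "0 \<in> K" "\<And>z. z \<in> K \<Longrightarrow> Im (z $ a) \<ge> -1" "axis b 1 \<notin> interior K"
    "\<And>j \<zeta>. j \<noteq> a \<Longrightarrow> cmod \<zeta> \<le> 1 \<Longrightarrow> axis j \<zeta> \<in> K"
    "\<And>u t. 0 < u \<Longrightarrow> u \<le> 1 \<Longrightarrow> cmod t < u\<^sup>2 / 2 \<Longrightarrow> axis a (\<i> * of_real (u ^ 5 - 1)) + axis b t \<in> K"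
    "\<And>w j. w $ a = 0 \<Longrightarrow> (\<And>\<zeta>. cmod \<zeta> \<le> 1 \<Longrightarrow> \<zeta> *s w \<in> K) \<Longrightarrow> j \<noteq> a \<Longrightarrow> j \<noteq> b \<Longrightarrow> cmod (w $ j) \<le> 1"
  using assms unfolding tangential_frame_def by blast+

lemma degenerate_bodyD:
  assumes "degenerate_body a b K"
  shows "tangential_frame a b K" "\<And>w. Im w > -1 \<Longrightarrow> axis a w \<in> K"
  using assms unfolding degenerate_body_def by blast+

lemma scaleR_axis: "r *\<^sub>R axis j (z :: complex) = axis j (of_real r * z)"
  by (simp add: vec_eq_iff axis_def scaleR_conv_of_real[where 'a = complex])

lemma norm_axis_complex: "norm (axis j (z :: complex)) = cmod z"
  by (simp add: norm_eq_sqrt_inner inner_axis_axis)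

text \<open>Every small vector is the mean of its coordinate vectors multiplied by the dimension.\<close>

lemma zero_in_interior_if_axis_discs:
  fixes K :: "(complex ^ 'd) set"
  assumes "convex K" and "\<And>j \<zeta>. cmod \<zeta> < 1 \<Longrightarrow> axis j \<zeta> \<in> K"
  shows "0 \<in> interior K"
proof -
  define d where "d = real CARD('d)"
  have d: "d > 0" unfolding d_def using zero_less_card_finite by (metis of_nat_0_less_iff)
  have "ball 0 (1/d) \<subseteq> K"
  proof
    fix z :: "complex ^ 'd" assume "z \<in> ball 0 (1/d)"
    then have z: "norm z * d < 1" using d by (simp add: pos_less_divide_eq)
    have "(\<Sum>j\<in>UNIV. (1/d) *\<^sub>R axis j (of_real d * z $ j)) \<in> K"
    proof (rule convex_sum)
      fix j
      have "cmod (z $ j) * d \<le> norm z * d"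
        using Finite_Cartesian_Product.norm_nth_le[of z j] d by (intro mult_right_mono) auto
      then have "cmod (z $ j) * d < 1" using z by linarith
      then show "axis j (of_real d * z $ j) \<in> K" using d by (intro assms(2)) (simp add: norm_mult mult.commute)
    qed (use assms(1) d in \<open>auto simp: d_def\<close>)
    also have "(\<Sum>j\<in>UNIV. (1/d) *\<^sub>R axis j (of_real d * z $ j)) = (\<Sum>j\<in>UNIV. axis j (z $ j))"
      using d by (simp add: scaleR_axis)
    also have "\<dots> = z"
      by (simp add: vec_eq_iff axis_def if_distrib cong: if_cong)
    finally show "z \<in> K" .
  qed
  then show ?thesis using d by (intro interiorI[of "ball 0 (1/d)"]) auto
qed

lemma zero_in_interior_if_half_plane:
  fixes K :: "(complex ^ 'd) set"
  assumes "convex K" and H: "\<And>w. Im w > -1 \<Longrightarrow> axis a w \<in> K"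
    and discs: "\<And>j \<zeta>. j \<noteq> a \<Longrightarrow> cmod \<zeta> \<le> 1 \<Longrightarrow> axis j \<zeta> \<in> K"
  shows "0 \<in> interior K"
proof (rule zero_in_interior_if_axis_discs[OF assms(1)])
  fix j and \<zeta> :: complex assume "cmod \<zeta> < 1"
  then show "axis j \<zeta> \<in> K"
    using H[of \<zeta>] abs_Im_le_cmod[of \<zeta>] discs[of j \<zeta>] by (cases "j = a") auto
qed

lemma degenerate_body_zero_interior:
  assumes "degenerate_body a b K"
  shows "0 \<in> interior K"
  using zero_in_interior_if_half_plane[of K a] degenerate_bodyD[OF assms] tangential_frameD(2,6) by blast

lemma in_interior_if_multiple:
  fixes K :: "'a::euclidean_space set"
  assumes "convex K" "0 \<in> interior K" "s > 1" "s *\<^sub>R y \<in> K"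
  shows "y \<in> interior K"
proof (cases "y = 0")
  case False
  then have "y \<in> open_segment 0 (s *\<^sub>R y)"
    using assms(3) unfolding in_segment by (auto intro!: exI[of _ "1/s"])
  then show ?thesis using in_interior_closure_convex_segment[OF assms(1,2)] assms(4) closure_subset by blast
qed (use assms in simp)

text \<open>A degenerate body is invariant under \<open>z \<mapsto> z + w e\<^sub>a\<close> for \<open>Im w > 0\<close>, since it contains the half plane
  in the direction of \<open>e\<^sub>a\<close>.\<close>

lemma degenerate_body_recession:
  assumes K: "degenerate_body a b K" and k: "k \<in> K" and w: "Im w > 0"
  shows "k + axis a w \<in> K"
proof -
  note tf = tangential_frameD[OF degenerate_bodyD(1)[OF K]]
  have "(1 - 1 / m) *\<^sub>R k + axis a w \<in> K" if m: "m \<ge> 1" for m :: real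
  proof -
    have "0 < m * Im w" using w m by simp
    then have "axis a (of_real m * w) \<in> K" by (intro degenerate_bodyD(2)[OF K]) simp
    then have "(1 - 1 / m) *\<^sub>R k + (1 / m) *\<^sub>R axis a (of_real m * w) \<in> K"
      using m by (intro convexD_alt[OF tf(2) k]) auto
    then show ?thesis using m by (simp add: scaleR_axis)
  qed
  then have mem: "(1 - 1 / real (Suc n)) *\<^sub>R k + axis a w \<in> K" for n by simp
  have "(\<lambda>n. (1 - 1 / real (Suc n)) *\<^sub>R k + axis a w) \<longlonglongrightarrow> (1 - 0) *\<^sub>R k + axis a w"
    by (intro tendsto_intros LIMSEQ_Suc[OF lim_const_over_n])
  from closed_sequentially[OF tf(1) mem this] show ?thesis by simp
qed

text \<open>The discs at the heights \<open>u ^ 5\<close> are moved upwards and sideways by the half plane of directions.\<close>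

lemma degenerate_body_region:
  assumes K: "degenerate_body a b K" and u: "0 < u" "u \<le> 1" and t: "cmod t < u\<^sup>2 / 2" and w: "Im w + 1 > u ^ 5"
  shows "axis a w + axis b t \<in> interior K"
proof -
  note tf = tangential_frameD[OF degenerate_bodyD(1)[OF K]]
  have reg: "axis a w' + axis b t' \<in> K" if "cmod t' < u\<^sup>2 / 2" "Im w' + 1 > u ^ 5" for w' t'
  proof -
    have "axis a (\<i> * of_real (u ^ 5 - 1)) + axis b t' + axis a (w' - \<i> * of_real (u ^ 5 - 1)) \<in> K"
      by (rule degenerate_body_recession[OF K tf(7)[OF u that(1)]]) (use that(2) in simp)
    also have "axis a (\<i> * of_real (u ^ 5 - 1)) + axis b t' + axis a (w' - \<i> * of_real (u ^ 5 - 1)) = axis a w' + axis b t'"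
      by (simp add: vec_eq_iff axis_def)
    finally show ?thesis .
  qed
  have "((\<lambda>s. s * cmod t) \<longlongrightarrow> 1 * cmod t) (at_right 1)" by (intro tendsto_intros)
  then have "\<forall>\<^sub>F s in at_right 1. s * cmod t < u\<^sup>2 / 2" by (rule order_tendstoD(2)) (use t in simp)
  moreover have "((\<lambda>s. s * Im w + 1) \<longlongrightarrow> 1 * Im w + 1) (at_right 1)" by (intro tendsto_intros)
  then have "\<forall>\<^sub>F s in at_right 1. s * Im w + 1 > u ^ 5" by (rule order_tendstoD(1)) (use w in simp)
  moreover have "\<forall>\<^sub>F s in at_right (1::real). s > 1" by (simp add: eventually_at_right_less)
  ultimately have "\<forall>\<^sub>F s in at_right 1. s * cmod t < u\<^sup>2 / 2 \<and> s * Im w + 1 > u ^ 5 \<and> s > 1"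
    by (simp add: eventually_conj)
  then obtain s where s: "s * cmod t < u\<^sup>2 / 2" "s * Im w + 1 > u ^ 5" "s > 1"
    using eventually_happens'[OF trivial_limit_at_right_real] by blast
  have "axis a (of_real s * w) + axis b (of_real s * t) \<in> K"
    using s by (intro reg) (auto simp: norm_mult)
  then have "s *\<^sub>R (axis a w + axis b t) \<in> K" by (simp add: scaleR_axis scaleR_add_right)
  then show ?thesis using in_interior_if_multiple[OF tf(2) degenerate_body_zero_interior[OF K] s(3)] by blast
qed

lemma degenerate_body_height:
  assumes K: "degenerate_body a b K" and z: "z \<in> interior K"
  shows "Im (z $ a) > -1"
proof -
  obtain e where e: "e > 0" "cball z e \<subseteq> K" using z mem_interior_cball by blast
  have "norm (axis a (\<i> * of_real e)) = e" using e(1) by (simp add: norm_axis_complex norm_mult)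
  then have "z - axis a (\<i> * of_real e) \<in> K" using e by (auto simp: dist_norm)
  from tangential_frameD(4)[OF degenerate_bodyD(1)[OF K] this] show ?thesis using e(1) by (simp add: axis_def)
qed

lemma degenerate_body_not_ball:
  fixes K :: "(complex ^ 'd) set"
  assumes "degenerate_body a b K"
  shows "\<not> biholomorphic (interior K) (ball (0 :: complex ^ 'd) 1)"
  by (rule not_biholomorphic_ball[of _ a b])
     (use degenerate_body_height[OF assms] degenerate_body_region[OF assms] in auto)

text \<open>A complex line in the interior gives a complex line through the origin. Its direction \<open>v\<close> has
  \<open>v $ a = 0\<close> because of the half space, \<open>v $ j = 0\<close> for \<open>j \<noteq> a, b\<close> because of the last condition on a
  frame, and \<open>v $ b = 0\<close> because \<open>e\<^sub>b\<close> is not in the interior.\<close>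

lemma degenerate_body_X_dom:
  assumes K: "degenerate_body a b K"
  shows "interior K \<in> X_dom"
proof -
  note tf = tangential_frameD[OF degenerate_bodyD(1)[OF K]]
  note z = degenerate_body_zero_interior[OF K]
  have "\<not> contains_complex_line (interior K)"
  proof
    assume "contains_complex_line (interior K)"
    then obtain p v where v: "v \<noteq> 0" "\<And>t. p + t *s v \<in> interior K"
      unfolding contains_complex_line_def by blast
    have line: "t *s v \<in> K" for t
    proof -
      have "(1 / m) *\<^sub>R p + t *s v \<in> K" if m: "m \<ge> 1" for m :: real
      proof -
        have "p + (of_real m * t) *s v \<in> K" using v(2) interior_subset by blast
        then have "(1 - 1 / m) *\<^sub>R 0 + (1 / m) *\<^sub>R (p + (of_real m * t) *s v) \<in> K"
          using m by (intro convexD_alt[OF tf(2,3)]) auto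
        moreover have "(1 / m) *\<^sub>R ((of_real m * t) *s v) = t *s v"
          using m by (simp add: vec_eq_iff scaleR_conv_of_real[where 'a = complex])
        ultimately show ?thesis by (simp add: scaleR_add_right)
      qed
      then have mem: "(1 / real (Suc n)) *\<^sub>R p + t *s v \<in> K" for n by simp
      have "(\<lambda>n. (1 / real (Suc n)) *\<^sub>R p + t *s v) \<longlonglongrightarrow> 0 *\<^sub>R p + t *s v"
        by (intro tendsto_intros LIMSEQ_Suc[OF lim_const_over_n])
      from closed_sequentially[OF tf(1) mem this] show ?thesis by simp
    qed
    have va: "v $ a = 0"
    proof (rule ccontr)
      assume "v $ a \<noteq> 0"
      then show False using tf(4)[OF line[of "- 2 * \<i> / v $ a"]] by simp
    qed
    have vj: "v $ j = 0" if "j \<noteq> b" for j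
    proof (rule ccontr)
      assume nz: "v $ j \<noteq> 0"
      have "cmod (((2 / v $ j) *s v) $ j) \<le> 1"
      proof (rule tf(8))
        show "((2 / v $ j) *s v) $ a = 0" using va by simp
        show "\<zeta> *s ((2 / v $ j) *s v) \<in> K" for \<zeta> using line[of "\<zeta> * (2 / v $ j)"] by simp
      qed (use nz va that in auto)
      then show False using nz by simp
    qed
    have vb: "v $ b \<noteq> 0"
    proof
      assume "v $ b = 0"
      then have "v $ j = 0" for j using vj[of j] by (cases "j = b") auto
      then show False using v(1) by (simp add: vec_eq_iff)
    qed
    have "((2 / v $ b) *s v) $ j = (2 *\<^sub>R axis b 1) $ j" for j
      using vb vj[of j] by (cases "j = b") (simp_all add: axis_def scaleR_conv_of_real[where 'a = complex])
    then have eq: "(2 / v $ b) *s v = 2 *\<^sub>R axis b 1" unfolding vec_eq_iff by blast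
    have "2 *\<^sub>R axis b (1 :: complex) \<in> K" using line[of "2 / v $ b"] unfolding eq .
    then have "axis b 1 \<in> interior K"
      by (intro in_interior_if_multiple[OF tf(2) z, of 2]) auto
    then show False using tf(5) by blast
  qed
  then show ?thesis
    using z tf(2) by (auto simp: X_dom_def convex_domain_def convex_interior)
qed

lemma wijsman_limit_member:
  assumes "wijsman_conv S K" "closed K" "K \<noteq> {}" "\<forall>\<^sub>F n in sequentially. y \<in> S n"
  shows "y \<in> K"
proof -
  have "(\<lambda>n. infdist y (S n)) \<longlonglongrightarrow> infdist y K" using assms(1) by (simp add: wijsman_conv_def)
  moreover have "(\<lambda>n. infdist y (S n)) \<longlonglongrightarrow> 0"
    by (rule tendsto_eventually) (use assms(4) in \<open>auto elim: eventually_mono\<close>)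
  ultimately have "infdist y K = 0" by (metis LIMSEQ_unique)
  then show ?thesis using in_closed_iff_infdist_zero assms(2,3) by blast
qed

text \<open>The clauses asserting membership and the half space pass to the limit because \<open>K\<close> consists of the
  limits of points of \<open>S n\<close>. The other two, that
  \<open>e\<^sub>b\<close> is not interior and that the discs around \<open>0\<close> are bounded, pass to the limit because a compact set with
  a neighbourhood in \<open>K\<close> is eventually contained in the approximating sets. For the discs this
  neighbourhood is created by shrinking them by a factor \<open>r < 1\<close>.\<close>

lemma wijsman_limit_tangential_frame:
  assumes w: "wijsman_conv S K" and S: "\<And>n. tangential_frame a b (S n)"
    and K: "closed K" "convex K" "0 \<in> interior K"
  shows "tangential_frame a b K"
proof -
  note tf = tangential_frameD[OF S]
  have z: "0 \<in> K" using K(3) interior_subset by blast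
  have mem: "y \<in> K" if "\<And>n. y \<in> S n" for y
    by (rule wijsman_limit_member[OF w K(1)]) (use z that in auto)
  obtain \<rho> where \<rho>: "\<rho> > 0" "cball 0 \<rho> \<subseteq> K" using K(3) mem_interior_cball by blast
  have ne: "S n \<noteq> {}" for n using tf(3) by blast
  have c1: "Im (z $ a) \<ge> -1" if zK: "z \<in> K" for z
  proof (rule field_le_epsilon)
    fix e :: real assume e: "e > 0"
    have "(\<lambda>n. infdist z (S n)) \<longlonglongrightarrow> 0" using w zK by (metis infdist_zero wijsman_conv_def)
    then have "\<forall>\<^sub>F n in sequentially. infdist z (S n) < e" using order_tendstoD(2) e by blast
    then obtain n where n: "infdist z (S n) < e" using eventually_happens'[OF sequentially_bot] by blast
    obtain y where y: "y \<in> S n" "infdist z (S n) = dist z y" using infdist_attains_inf[OF tf(1) ne] by blast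
    have "\<bar>Im ((z - y) $ a)\<bar> \<le> norm (z - y)"
      using abs_Im_le_cmod Finite_Cartesian_Product.norm_nth_le order_trans by blast
    then show "-1 \<le> Im (z $ a) + e" using n y tf(4)[OF y(1)] by (simp add: dist_norm)
  qed
  have c2: "axis b 1 \<notin> interior K"
  proof
    assume "axis b 1 \<in> interior K"
    then obtain r where r: "r > 0" "cball (axis b 1) r \<subseteq> K" using mem_interior_cball by blast
    have "\<forall>\<^sub>F n in sequentially. cball (axis b 1) (r/2) \<subseteq> S n"
    proof (rule wijsman_conv_eventually_subset[OF w tf(1,2) ne])
      fix x assume x: "x \<in> cball (axis b (1::complex)) (r/2)"
      have "cball x (r/2) \<subseteq> cball (axis b 1) r"
      proof
        fix y assume "y \<in> cball x (r/2)"
        then show "y \<in> cball (axis b 1) r" using x dist_triangle[of "axis b 1" y x] by simp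
      qed
      then show "cball x (r/2) \<subseteq> K" using r(2) by blast
    qed (use r in auto)
    then obtain n where "cball (axis b 1) (r/2) \<subseteq> S n" using eventually_happens'[OF sequentially_bot] by blast
    then have "axis b 1 \<in> interior (S n)" using r(1) by (auto simp: mem_interior_cball intro!: exI[of _ "r/2"])
    then show False using tf(5) by blast
  qed
  have c3: "cmod (v $ j) \<le> 1"
    if v: "v $ a = 0" "\<And>\<zeta>. cmod \<zeta> \<le> 1 \<Longrightarrow> \<zeta> *s v \<in> K" and j: "j \<noteq> a" "j \<noteq> b" for v j
  proof -
    have shrunk: "r * cmod (v $ j) \<le> 1" if r: "0 < r" "r < 1" for r
    proof -
      define C where "C = (\<lambda>\<zeta>. \<zeta> *s (of_real r *s v)) ` cball 0 1"
      have "compact C" unfolding C_def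
        by (intro compact_continuous_image linear_continuous_on bounded_linear_scalar_mult_vec compact_cball)
      have "\<forall>\<^sub>F n in sequentially. C \<subseteq> S n"
      proof (rule wijsman_conv_eventually_subset[OF w tf(1,2) ne \<open>compact C\<close>])
        show "(1 - r) * \<rho> > 0" using r \<rho> by simp
        fix x assume "x \<in> C"
        then obtain \<zeta> where \<zeta>: "cmod \<zeta> \<le> 1" "x = \<zeta> *s (of_real r *s v)" by (auto simp: C_def)
        show "cball x ((1 - r) * \<rho>) \<subseteq> K"
        proof
          fix y assume "y \<in> cball x ((1 - r) * \<rho>)"
          then have "norm ((1 / (1 - r)) *\<^sub>R (y - x)) \<le> \<rho>"
            using r by (simp add: dist_norm norm_minus_commute divide_le_eq mult.commute)
          then have "(1 / (1 - r)) *\<^sub>R (y - x) \<in> K" using \<rho> by auto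
          then have "(1 - r) *\<^sub>R ((1 / (1 - r)) *\<^sub>R (y - x)) + r *\<^sub>R (\<zeta> *s v) \<in> K"
            using r by (intro convexD_alt[OF K(2) _ v(2)[OF \<zeta>(1)]]) auto
          moreover have "r *\<^sub>R (\<zeta> *s v) = x" by (simp add: \<zeta> vec_eq_iff scaleR_conv_of_real[where 'a = complex])
          ultimately show "y \<in> K" using r by simp
        qed
      qed
      then obtain n where n: "C \<subseteq> S n" using eventually_happens'[OF sequentially_bot] by blast
      have "\<zeta> *s (of_real r *s v) \<in> S n" if "cmod \<zeta> \<le> 1" for \<zeta>
        using n that unfolding C_def by (metis image_subset_iff mem_cball_0)
      then have "cmod ((of_real r *s v) $ j) \<le> 1"
        using v(1) j by (intro tf(8)[of _ n]) auto
      then show ?thesis using r by (simp add: norm_mult)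
    qed
    have "(\<lambda>n. (1 - 1 / real (Suc (Suc n))) * cmod (v $ j)) \<longlonglongrightarrow> (1 - 0) * cmod (v $ j)"
      by (intro tendsto_intros LIMSEQ_Suc[OF LIMSEQ_Suc[OF lim_const_over_n]])
    then have "(1 - 0) * cmod (v $ j) \<le> 1"
      by (rule LIMSEQ_le_const2) (use shrunk in \<open>auto simp: divide_less_eq\<close>)
    then show ?thesis by simp
  qed
  show ?thesis
    unfolding tangential_frame_def using K z c1 c2 c3 mem tf(6,7) by blast
qed

lemma wijsman_limit_degenerate_body:
  assumes w: "wijsman_conv S K" and S: "\<And>n. tangential_frame a b (S n)"
    and K: "closed K" "convex K" "0 \<in> K" and H: "\<And>w. Im w > -1 \<Longrightarrow> axis a w \<in> K"
  shows "degenerate_body a b K"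
proof -
  have "axis j \<zeta> \<in> K" if "j \<noteq> a" "cmod \<zeta> \<le> 1" for j \<zeta>
    by (rule wijsman_limit_member[OF w K(1)]) (use K(3) tangential_frameD(6)[OF S that] in auto)
  then have "0 \<in> interior K" using H by (intro zero_in_interior_if_half_plane[of K a, OF K(2)])
  from wijsman_limit_tangential_frame[OF w S K(1,2) this] H show ?thesis
    by (simp add: degenerate_body_def)
qed

lemma compactin_degenerate_bodies:
  "compactin local_hausdorff_topology (interior ` {K :: (complex ^ 'd) set. degenerate_body a b K})"
proof (rule compactin_interior_image)
  fix S and K :: "(complex ^ 'd) set"
  assume S: "\<And>n. S n \<in> {K. degenerate_body a b K}" and K: "closed K" "convex K" "0 \<in> K" and w: "wijsman_conv S K"
  have S': "degenerate_body a b (S n)" for n using S by simp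
  have "axis a v \<in> K" if "Im v > -1" for v
    by (rule wijsman_limit_member[OF w K(1)]) (use K(3) degenerate_bodyD(2)[OF S' that] in auto)
  then show "K \<in> {K. degenerate_body a b K}"
    using wijsman_limit_degenerate_body[OF w degenerate_bodyD(1)[OF S'] K] by simp
qed (use degenerate_body_zero_interior degenerate_body_X_dom tangential_frameD(1,2) degenerate_bodyD(1) in blast)+

section \<open>Rescaling\<close>

lemma transpose_mult_vec: "transpose M *v z = (\<Sum>j\<in>UNIV. z $ j *s M $ j)" for M :: "complex ^ 'd ^ 'd"
  by (simp add: vec_eq_iff matrix_vector_mult_def transpose_def mult.commute)

lemma bounded_linear_scalar_mult_vec_right: "bounded_linear (\<lambda>v :: complex ^ 'd. t *s v)"
  by (intro linear_conv_bounded_linear[THEN iffD1] linearI) (simp_all add: vec_eq_iff algebra_simps)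

lemma scaleR_eq_scalar_mult: "c *\<^sub>R z = of_real c *s z" for z :: "complex ^ 'd"
  by (simp add: vec_eq_iff scaleR_conv_of_real[where 'a = complex])

lemma scalar_mult_axis: "t *s axis j z = axis j (t * z :: complex)"
  by (simp add: vec_eq_iff axis_def)

lemma axis_add: "axis j z + axis j w = axis j (z + w :: complex)"
  by (simp add: vec_eq_iff axis_def)

lemma continuous_on_det: "continuous_on S (det :: complex ^ 'd ^ 'd \<Rightarrow> complex)"
  unfolding det_def by (intro continuous_intros)

lemma compact_matrices_with_rows:
  fixes V :: "'d \<Rightarrow> (complex ^ 'd) set"
  assumes "\<And>j. compact (V j)"
  shows "compact {M :: complex ^ 'd ^ 'd. \<forall>j. M $ j \<in> V j}"
  unfolding compact_eq_bounded_closed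
proof
  have "\<exists>B. \<forall>w\<in>V j. norm w \<le> B" for j using compact_imp_bounded[OF assms] bounded_iff by blast
  then obtain B where B: "\<And>j w. w \<in> V j \<Longrightarrow> norm w \<le> B j" by metis
  have "norm M \<le> (\<Sum>j\<in>UNIV. B j)" if "\<forall>j. M $ j \<in> V j" for M :: "complex ^ 'd ^ 'd"
  proof -
    have "norm M \<le> (\<Sum>j\<in>UNIV. norm (M $ j))" unfolding norm_vec_def[of M] by (rule L2_set_le_sum) simp
    also have "\<dots> \<le> (\<Sum>j\<in>UNIV. B j)" using that B by (intro sum_mono) blast
    finally show ?thesis .
  qed
  then show "bounded {M :: complex ^ 'd ^ 'd. \<forall>j. M $ j \<in> V j}" unfolding bounded_iff by blast
  have "closed ((\<lambda>M :: complex ^ 'd ^ 'd. M $ j) -` V j)" for j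
    by (intro continuous_closed_vimage compact_imp_closed assms) (intro continuous_intros)
  then show "closed {M :: complex ^ 'd ^ 'd. \<forall>j. M $ j \<in> V j}"
    unfolding vimage_def by (intro closed_Collect_all) simp
qed

text \<open>The columns of the inverse of \<open>A\<close> in the directions \<open>a\<close> and \<open>b\<close> are prescribed. The remaining ones
  are chosen among the vectors \<open>w\<close> of the hyperplane \<open>w $ a = 0\<close> for which the closed disc \<open>x + \<zeta> w\<close>
  stays in the closure of \<open>\<Omega>\<close>, so that the modulus of the determinant is maximal. By Cramer's rule every
  such vector then has coefficients of modulus at most 1 in these remaining directions.\<close>

lemma tangential_frame_exists:
  fixes \<Omega> :: "(complex ^ 'd) set"
  assumes \<Omega>: "open \<Omega>" "convex \<Omega>" "bounded \<Omega>" and ab: "a \<noteq> b"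
    and pos: "\<And>z. z \<in> \<Omega> \<Longrightarrow> Im (z $ a) > 0"
    and \<delta>: "\<delta> > 0" and x: "x = axis a (\<i> * of_real \<delta>)" "x \<in> \<Omega>"
    and \<zeta>: "\<zeta> \<noteq> 0" "x + axis b \<zeta> \<notin> \<Omega>"
    and disc: "\<And>t. cmod t < cmod \<zeta> \<Longrightarrow> x + axis b t \<in> \<Omega>"
    and discs: "\<And>v t. 0 < v \<Longrightarrow> v \<le> 1 \<Longrightarrow> cmod t < cmod \<zeta> * v\<^sup>2 / 2 \<Longrightarrow>
      axis a (\<i> * of_real (\<delta> * v ^ 5)) + axis b t \<in> \<Omega>"
  shows "\<exists>A\<in>Aff. A x = 0 \<and> (\<forall>w. A (axis a (of_real \<delta> * (w + \<i>))) = axis a w) \<and> convex (A ` \<Omega>) \<and>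
    tangential_frame a b (closure (A ` \<Omega>))"
proof -
  define W where "W = {w :: complex ^ 'd. w $ a = 0 \<and> (\<forall>\<eta>. cmod \<eta> \<le> 1 \<longrightarrow> x + \<eta> *s w \<in> closure \<Omega>)}"
  have "compact W"
    unfolding compact_eq_bounded_closed
  proof
    obtain B where B: "\<And>z. z \<in> closure \<Omega> \<Longrightarrow> norm z \<le> B"
      using bounded_closure[OF \<Omega>(3)] unfolding bounded_iff by blast
    have "norm w \<le> B + norm x" if "w \<in> W" for w
    proof -
      have "x + 1 *s w \<in> closure \<Omega>" using that unfolding W_def mem_Collect_eq by (metis norm_one order_refl)
      then show ?thesis using B[of "x + w"] norm_triangle_ineq4[of "x + w" x] by simp
    qed
    then show "bounded W" unfolding bounded_iff by blast
    have "closed {w :: complex ^ 'd. w $ a = 0}"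
      by (intro closed_Collect_eq continuous_intros)
    moreover have "closed ((\<lambda>w. x + \<eta> *s w) -` closure \<Omega>)" for \<eta>
      by (intro continuous_closed_vimage closed_closure continuous_intros linear_continuous_at
          bounded_linear_scalar_mult_vec_right)
    then have "closed {w. \<forall>\<eta>. cmod \<eta> \<le> 1 \<longrightarrow> x + \<eta> *s w \<in> closure \<Omega>}"
      unfolding vimage_def by (intro closed_Collect_all closed_Collect_imp) auto
    ultimately show "closed W" unfolding W_def by (rule closed_Collect_conj)
  qed
  define V where "V j = (if j = a then {axis a (of_real \<delta>)} else if j = b then {axis b \<zeta>} else W)" for j
  define \<M> where "\<M> = {M :: complex ^ 'd ^ 'd. \<forall>j. M $ j \<in> V j}"
  have "compact \<M>" unfolding \<M>_def
    by (rule compact_matrices_with_rows) (use \<open>compact W\<close> in \<open>simp add: V_def\<close>)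
  obtain e where e: "e > 0" "cball x e \<subseteq> \<Omega>" using \<Omega>(1) x(2) open_contains_cball by blast
  \<comment> \<open>A diagonal competitor shows that the maximal determinant is not \<open>0\<close>.\<close>
  define M\<^sub>0 :: "complex ^ 'd ^ 'd" where
    "M\<^sub>0 = (\<chi> j. if j = a then axis a (of_real \<delta>) else if j = b then axis b \<zeta> else axis j (of_real e))"
  have "M\<^sub>0 \<in> \<M>"
  proof -
    have "axis j (of_real e) \<in> W" if "j \<noteq> a" for j
    proof -
      have "x + \<eta> *s axis j (of_real e) \<in> \<Omega>" if "cmod \<eta> \<le> 1" for \<eta>
      proof -
        have "norm (\<eta> *s axis j (complex_of_real e)) \<le> e"
          using that e(1) mult_right_mono[of "cmod \<eta>" 1 e] by (simp add: norm_scalar_mult_vec norm_axis_complex)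
        then show ?thesis using e(2) by (auto simp: dist_norm)
      qed
      then show ?thesis using that closure_subset by (fastforce simp: W_def axis_def)
    qed
    then show ?thesis by (simp add: \<M>_def M\<^sub>0_def V_def)
  qed
  have "det M\<^sub>0 = (\<Prod>j\<in>UNIV. M\<^sub>0 $ j $ j)"
    by (rule det_diagonal) (auto simp: M\<^sub>0_def axis_def)
  also have "\<dots> \<noteq> 0" using \<delta> \<zeta>(1) e(1) by (auto simp: M\<^sub>0_def axis_def)
  finally have "det M\<^sub>0 \<noteq> 0" .
  have "continuous_on \<M> (\<lambda>M. cmod (det M))" by (intro continuous_on_norm continuous_on_det)
  then obtain M where M: "M \<in> \<M>" "\<And>M'. M' \<in> \<M> \<Longrightarrow> cmod (det M') \<le> cmod (det M)"
    using continuous_attains_sup[OF \<open>compact \<M>\<close>] \<open>M\<^sub>0 \<in> \<M>\<close> by blast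
  have detM: "det M \<noteq> 0" using M(2)[OF \<open>M\<^sub>0 \<in> \<M>\<close>] \<open>det M\<^sub>0 \<noteq> 0\<close> by auto
  have "invertible (transpose M)" using detM by (simp add: invertible_det_nz)
  then obtain N where NM: "N ** transpose M = mat 1" "transpose M ** N = mat 1"
    unfolding invertible_def by blast
  have iN: "invertible N" using NM unfolding invertible_def by blast
  have "M $ j \<in> V j" for j using M(1) by (simp add: \<M>_def)
  from this[of a] this[of b] this have row: "M $ a = axis a (of_real \<delta>)" "M $ b = axis b \<zeta>"
      "\<And>j. j \<noteq> a \<Longrightarrow> j \<noteq> b \<Longrightarrow> M $ j \<in> W"
    using ab unfolding V_def by (simp, simp, metis)
  define T where "T z = transpose M *v z" for z
  have Tadd: "T (y + z) = T y + T z" for y z by (simp add: T_def matrix_vector_right_distrib)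
  have Ts: "T (c *s z) = c *s T z" for c z by (simp add: T_def vector_scalar_commute)
  have TsR: "T (c *\<^sub>R z) = c *\<^sub>R T z" for c z
    by (simp only: scaleR_eq_scalar_mult Ts)
  have Tax: "T (axis j t) = t *s M $ j" for j t
  proof -
    have "axis j t $ i *s M $ i = (if i = j then t *s M $ j else 0)" for i by (simp add: axis_def)
    then show ?thesis unfolding T_def transpose_mult_vec by simp
  qed
  have Ta: "T (axis a t) = axis a (of_real \<delta> * t)" for t
    by (simp add: Tax row scalar_mult_axis mult.commute)
  have Tb: "T (axis b t) = axis b (\<zeta> * t)" for t
    by (simp add: Tax row scalar_mult_axis mult.commute)
  have Tcomp: "T z $ a = of_real \<delta> * z $ a" for z
  proof -
    have "z $ j * M $ j $ a = (if j = a then of_real \<delta> * z $ a else 0)" for j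
      using row(1,2) row(3)[of j] ab by (cases "j = a"; cases "j = b") (auto simp: axis_def W_def)
    then have "(\<Sum>j\<in>UNIV. z $ j * M $ j $ a) = of_real \<delta> * z $ a" by simp
    then show ?thesis unfolding T_def transpose_mult_vec by simp
  qed
  define A where "A z = N *v (z - x)" for z
  have AT: "A (x + T y) = y" for y 
    unfolding A_def T_def add_diff_cancel_left' matrix_vector_mul_assoc NM by simp
  have TA: "x + T (A z) = z" for z
    unfolding A_def T_def matrix_vector_mul_assoc NM by simp
  have mem: "y \<in> A ` \<Omega> \<longleftrightarrow> x + T y \<in> \<Omega>" for y
  proof
    assume "x + T y \<in> \<Omega>"
    from imageI[OF this, of A] show "y \<in> A ` \<Omega>" by (simp only: AT)
  qed (auto simp: TA)
  have contA: "continuous_on U A" for U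
    unfolding A_def by (rule continuous_on_compose2[OF matrix_vector_mult_linear_continuous_on[of UNIV]])
      (auto intro: continuous_intros)
  have contT: "continuous_on U (\<lambda>y. x + T y)" for U
    unfolding T_def by (intro continuous_intros matrix_vector_mult_linear_continuous_on)
  have clA: "A z \<in> closure (A ` \<Omega>)" if "z \<in> closure \<Omega>" for z
    using image_closure_subset[OF contA closed_closure closure_subset] that by blast
  have clT: "x + T y \<in> closure \<Omega>" if "y \<in> closure (A ` \<Omega>)" for y
    using image_closure_subset[OF contT closed_closure, of "A ` \<Omega>" \<Omega>] closure_subset that by (auto simp: TA image_subset_iff)
  have "A = (\<lambda>z. N *v z + - (N *v x))" by (simp add: A_def fun_eq_iff matrix_vector_mult_diff_distrib)
  then have "A \<in> Aff" using iN unfolding Aff_def by blast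
  moreover have "A x = 0" by (simp add: A_def)
  moreover have "A (axis a (of_real \<delta> * (w + \<i>))) = axis a w" for w
  proof -
    have "axis a (of_real \<delta> * (w + \<i>)) = x + T (axis a w)"
      unfolding Ta x(1) by (simp add: vec_eq_iff axis_def algebra_simps)
    then show ?thesis using AT by simp
  qed
  moreover have cv: "convex (A ` \<Omega>)"
    unfolding convex_alt
  proof (intro ballI allI impI)
    fix y z and u :: real assume yz: "y \<in> A ` \<Omega>" "z \<in> A ` \<Omega>" "0 \<le> u \<and> u \<le> 1"
    have "(1 - u) *\<^sub>R (x + T y) + u *\<^sub>R (x + T z) \<in> \<Omega>"
      using \<Omega>(2) yz mem unfolding convex_alt by blast
    also have "(1 - u) *\<^sub>R (x + T y) + u *\<^sub>R (x + T z) = x + T ((1 - u) *\<^sub>R y + u *\<^sub>R z)"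
      unfolding Tadd TsR by (simp add: algebra_simps)
    finally show "(1 - u) *\<^sub>R y + u *\<^sub>R z \<in> A ` \<Omega>" using mem by blast
  qed
  moreover have "tangential_frame a b (closure (A ` \<Omega>))"
    unfolding tangential_frame_def
  proof (intro conjI allI impI ballI)
    show "convex (closure (A ` \<Omega>))" using cv by (rule convex_closure)
    show "0 \<in> closure (A ` \<Omega>)" using clA[of x] x(2) closure_subset \<open>A x = 0\<close> by auto
  next
    fix z assume z: "z \<in> closure (A ` \<Omega>)"
    have "y \<in> {z. Im (z $ a) \<ge> -1}" if "y \<in> A ` \<Omega>" for y
    proof -
      have "Im ((x + T y) $ a) > 0" using pos that mem by blast
      then have "0 < \<delta> * (1 + Im (y $ a))" by (simp add: x(1) Tcomp axis_def distrib_left)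
      then show ?thesis using \<delta> by (simp add: zero_less_mult_iff)
    qed
    moreover have "closed {z :: complex ^ 'd. Im (z $ a) \<ge> -1}"
      by (intro closed_Collect_le continuous_intros)
    ultimately have "closure (A ` \<Omega>) \<subseteq> {z. Im (z $ a) \<ge> -1}" by (intro closure_minimal) auto
    then show "-1 \<le> Im (z $ a)" using z by blast
  next
    show "axis b 1 \<notin> interior (closure (A ` \<Omega>))"
    proof
      assume "axis b 1 \<in> interior (closure (A ` \<Omega>))"
      then have "axis b 1 \<in> A ` \<Omega>"
        unfolding convex_interior_closure[OF cv] using interior_subset by blast
      then show False using \<zeta>(2) by (simp add: mem Tb)
    qed
  next
    fix j and t :: complex assume j: "j \<noteq> a" and t: "cmod t \<le> 1"
    show "axis j t \<in> closure (A ` \<Omega>)"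
    proof (cases "j = b")
      case True
      have "axis b t \<in> A ` \<Omega>" if "t \<in> ball 0 1" for t
      proof -
        have "cmod (\<zeta> * t) < cmod \<zeta>" using that \<zeta>(1) by (simp add: norm_mult)
        then show ?thesis using disc mem by (simp add: Tb)
      qed
      moreover have "continuous_on (closure (ball 0 1)) (\<lambda>t :: complex. axis b t)"
        by (subst axis_eq_scalar_mult) (intro linear_continuous_on bounded_linear_scalar_mult_vec)
      ultimately have "(\<lambda>t :: complex. axis b t) ` closure (ball 0 1) \<subseteq> closure (A ` \<Omega>)"
        by (intro image_closure_subset) (use closure_subset[of "A ` \<Omega>"] in auto)
      then show ?thesis using t True by (auto simp: image_subset_iff)
    next
      case False
      then have "x + T (axis j t) \<in> closure \<Omega>" using row(3)[OF j False] t by (simp add: Tax W_def)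
      then show ?thesis using clA AT by metis
    qed
  next
    fix v :: real and t assume v: "0 < v" "v \<le> 1" "cmod t < v\<^sup>2 / 2"
    have "cmod (\<zeta> * t) < cmod \<zeta> * v\<^sup>2 / 2" using v(3) \<zeta>(1) by (simp add: norm_mult)
    then have "axis a (\<i> * of_real (\<delta> * v ^ 5)) + axis b (\<zeta> * t) \<in> \<Omega>" by (rule discs[OF v(1,2)])
    also have "axis a (\<i> * of_real (\<delta> * v ^ 5)) + axis b (\<zeta> * t)
        = x + T (axis a (\<i> * of_real (v ^ 5 - 1)) + axis b t)"
    proof -
      have "\<i> * of_real \<delta> + of_real \<delta> * (\<i> * of_real (v ^ 5 - 1)) = \<i> * of_real (\<delta> * v ^ 5)"
        by (simp add: algebra_simps)
      then show ?thesis unfolding Tadd Ta Tb x(1) add.assoc[symmetric] axis_add by simp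
    qed
    finally show "axis a (\<i> * of_real (v ^ 5 - 1)) + axis b t \<in> closure (A ` \<Omega>)"
      using mem closure_subset by blast
  next
    fix w :: "complex ^ 'd" and j
    assume w: "w $ a = 0" "\<forall>\<eta>. cmod \<eta> \<le> 1 \<longrightarrow> \<eta> *s w \<in> closure (A ` \<Omega>)" and j: "j \<noteq> a" "j \<noteq> b"
    have "T w \<in> W" using w clT by (auto simp: W_def Tcomp Ts[symmetric])
    define M' :: "complex ^ 'd ^ 'd" where
      "M' = (\<chi> i. if i = j then (\<Sum>i\<in>UNIV. w $ i *s row i M) else row i M)"
    have rM: "row i M = M $ i" for i by (simp add: row_def vec_eq_iff)
    have "M' $ i \<in> V i" for i
    proof (cases "i = j")
      case True
      then have "M' $ i = T w" unfolding M'_def rM T_def transpose_mult_vec by simp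
      then show ?thesis using True \<open>T w \<in> W\<close> j by (simp add: V_def)
    next
      case False
      then have "M' $ i = M $ i" unfolding M'_def rM by simp
      then show ?thesis using M(1) by (simp add: \<M>_def)
    qed
    then have "M' \<in> \<M>" unfolding \<M>_def by blast
    then have "cmod (det M') \<le> cmod (det M)" by (rule M(2))
    moreover have "det M' = w $ j * det M" unfolding M'_def by (rule cramer_lemma_transpose)
    ultimately have "cmod (w $ j) * cmod (det M) \<le> 1 * cmod (det M)" by (simp add: norm_mult)
    then show "cmod (w $ j) \<le> 1" using detM by (simp only: mult_le_cancel_right) auto
  qed auto
  ultimately show ?thesis by blast
qed

text \<open>The scale \<open>u\<close> is chosen as an almost minimiser, over small scales, of the ratio of the radius \<open>\<rho>\<close> of
  the disc in direction \<open>b\<close> at height \<open>u ^ 5\<close> to \<open>u\<^sup>2\<close>; the assumed lower bound keeps this ratio away from \<open>0\<close>.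
  At all smaller scales the radius is then at least half of what the power law predicts.\<close>

lemma almost_minimal_scale:
  fixes \<rho> :: "real \<Rightarrow> real"
  assumes c: "c > 0" and lower: "\<And>u. 0 < u \<Longrightarrow> u \<le> e \<Longrightarrow> c * u\<^sup>2 \<le> \<rho> u" and e: "e > 0"
  shows "\<exists>u. 0 < u \<and> u \<le> e \<and> (\<forall>v. 0 < v \<longrightarrow> v \<le> 1 \<longrightarrow> \<rho> u * v\<^sup>2 / 2 \<le> \<rho> (u * v))"
proof -
  define q where "q u = \<rho> u / u\<^sup>2" for u
  define m where "m = (INF u\<in>{0<..e}. q u)"
  have qc: "c \<le> q u" if "u \<in> {0<..e}" for u
    using lower[of u] that by (simp add: q_def pos_le_divide_eq)
  have "m \<ge> c" unfolding m_def by (rule cINF_greatest) (use e qc in auto)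
  then have "m < 2 * m" using c by simp
  have bdd: "bdd_below (q ` {0<..e})" using qc by (intro bdd_belowI2) blast
  have "Inf (q ` {0<..e}) < 2 * m" using \<open>m < 2 * m\<close> by (simp add: m_def)
  then obtain u where u: "u \<in> {0<..e}" "q u < 2 * m"
    using cInf_lessD[of "q ` {0<..e}" "2 * m"] e by auto
  have "\<rho> u * v\<^sup>2 / 2 \<le> \<rho> (u * v)" if v: "0 < v" "v \<le> 1" for v
  proof -
    have "u * v \<le> u" using u(1) v by (intro mult_left_le) auto
    moreover have "u \<le> e" "0 < u * v" using u(1) v by auto
    ultimately have "u * v \<in> {0<..e}" by simp
    then have "m \<le> q (u * v)" unfolding m_def by (rule cINF_lower[OF bdd])
    then have "q u / 2 \<le> q (u * v)" using u(2) by linarith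
    then have "q u / 2 * (u * v)\<^sup>2 \<le> q (u * v) * (u * v)\<^sup>2" by (rule mult_right_mono) simp
    then show ?thesis using u(1) v by (simp add: q_def power_mult_distrib)
  qed
  then show ?thesis using u(1) by (intro exI[of _ u]) auto
qed

text \<open>At height \<open>u ^ 5\<close> the domain is rescaled so that the height becomes 1 and the largest disc in direction
  \<open>b\<close> becomes the unit disc. For almost minimal scales \<open>u\<close> the discs below that height are as large as a
  tangential frame requires, so a subsequence of the rescaled domains has a limit with such a frame.\<close>

lemma rescaling_limit:
  fixes \<Omega> :: "(complex ^ 'd) set"
  assumes \<Omega>: "open \<Omega>" "convex \<Omega>" "bounded \<Omega>" and ab: "a \<noteq> b"
    and pos: "\<And>z. z \<in> \<Omega> \<Longrightarrow> Im (z $ a) > 0"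
    and normal: "\<And>w. Im w > 0 \<Longrightarrow> \<forall>\<^sub>F \<delta> in at_right 0. axis a (of_real \<delta> * w) \<in> \<Omega>"
    and tangential: "c > 0" "e > 0"
      "\<And>u t. 0 < u \<Longrightarrow> u \<le> e \<Longrightarrow> cmod t < c * u\<^sup>2 \<Longrightarrow> axis a (\<i> * of_real (u ^ 5)) + axis b t \<in> \<Omega>"
  shows "\<exists>x A K. (\<forall>n. x n \<in> \<Omega>) \<and> x \<longlonglongrightarrow> 0 \<and> (\<forall>n. A n \<in> Aff) \<and> degenerate_body a b K \<and>
    pointed_conv (\<lambda>n. aff_act (A n) (\<Omega>, x n)) (interior K, 0)"
proof -
  define p where "p u = axis a (\<i> * of_real (u ^ 5))" for u :: real
  \<comment> \<open>\<open>R u\<close> collects the parameters that leave \<open>\<Omega>\<close> on the complex line in direction \<open>b\<close> at height \<open>u ^ 5\<close>.\<close>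
  define R where "R u = {t. p u + axis b t \<notin> \<Omega>}" for u
  define \<rho> where "\<rho> u = infdist 0 (R u)" for u
  have contb: "continuous_on UNIV (\<lambda>t. p u + axis b t)" for u
    by (subst axis_eq_scalar_mult[of b])
      (intro continuous_intros linear_continuous_on bounded_linear_scalar_mult_vec)
  have clR: "closed (R u)" for u
  proof -
    have "open ((\<lambda>t. p u + axis b t) -` \<Omega>)" by (rule open_vimage[OF \<Omega>(1) contb])
    then show ?thesis unfolding R_def closed_def by (simp add: vimage_def Compl_eq)
  qed
  obtain B where B: "\<And>z. z \<in> \<Omega> \<Longrightarrow> norm z \<le> B" using \<Omega>(3) unfolding bounded_iff by blast
  have neR: "R u \<noteq> {}" for u
  proof -
    define t :: complex where "t = of_real (\<bar>B\<bar> + norm (p u) + 1)"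
    have "cmod t = \<bar>B\<bar> + norm (p u) + 1" by (simp only: t_def norm_of_real) simp
    then have "norm (p u + axis b t) > B"
      using norm_diff_ineq[of "axis b t" "p u"] by (simp add: norm_axis_complex add.commute)
    then have "t \<in> R u" using B unfolding R_def by force
    then show ?thesis by blast
  qed
  have inO: "p u + axis b t \<in> \<Omega>" if "cmod t < \<rho> u" for u t
  proof (rule ccontr)
    assume "p u + axis b t \<notin> \<Omega>"
    then have "\<rho> u \<le> dist 0 t" unfolding \<rho>_def by (intro infdist_le) (simp add: R_def)
    then show False using that by simp
  qed
  have lower: "c * u\<^sup>2 \<le> \<rho> u" if "0 < u" "u \<le> e" for u
  proof -
    obtain t where t: "t \<in> R u" "\<rho> u = dist 0 t" unfolding \<rho>_def using infdist_attains_inf[OF clR neR] by blast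
    then show ?thesis using tangential(3)[OF that, of t] by (force simp: R_def p_def)
  qed
  have "\<exists>u. 0 < u \<and> u \<le> e \<and> u \<le> 1 / real (Suc n) \<and>
      (\<forall>v. 0 < v \<longrightarrow> v \<le> 1 \<longrightarrow> \<rho> u * v\<^sup>2 / 2 \<le> \<rho> (u * v))" for n
  proof -
    define e' where "e' = min e (1 / real (Suc n))"
    have e': "e' > 0" using tangential(2) by (simp add: e'_def)
    have lower': "c * u\<^sup>2 \<le> \<rho> u" if "0 < u" "u \<le> e'" for u using lower that by (simp add: e'_def)
    have "\<exists>u. 0 < u \<and> u \<le> e' \<and> (\<forall>v. 0 < v \<longrightarrow> v \<le> 1 \<longrightarrow> \<rho> u * v\<^sup>2 / 2 \<le> \<rho> (u * v))"
      by (rule almost_minimal_scale[OF tangential(1) lower' e'])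
    then show ?thesis unfolding e'_def min.bounded_iff by (simp only: conj_assoc)
  qed
  then have "\<forall>n. \<exists>u. 0 < u \<and> u \<le> e \<and> u \<le> 1 / real (Suc n) \<and>
      (\<forall>v. 0 < v \<longrightarrow> v \<le> 1 \<longrightarrow> \<rho> u * v\<^sup>2 / 2 \<le> \<rho> (u * v))" by (rule allI)
  from choice[OF this] obtain u where u': "\<forall>n. 0 < u n \<and> u n \<le> e \<and> u n \<le> 1 / real (Suc n) \<and>
      (\<forall>v. 0 < v \<longrightarrow> v \<le> 1 \<longrightarrow> \<rho> (u n) * v\<^sup>2 / 2 \<le> \<rho> (u n * v))" ..
  have u: "0 < u n" "u n \<le> e" "u n \<le> 1 / real (Suc n)"
      "0 < v \<Longrightarrow> v \<le> 1 \<Longrightarrow> \<rho> (u n) * v\<^sup>2 / 2 \<le> \<rho> (u n * v)" for n v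
    using u'[rule_format, of n] by auto
  define x where "x n = p (u n)" for n
  have \<rho>pos: "\<rho> (u n) > 0" for n
    using lower[OF u(1,2), of n] mult_pos_pos[OF tangential(1) zero_less_power[OF u(1)[of n], of 2]] by linarith
  have xO: "x n \<in> \<Omega>" for n using inO[of 0 "u n"] \<rho>pos[of n] by (simp add: x_def axis_zero)
  have "\<exists>A\<in>Aff. A (x n) = 0 \<and> (\<forall>w. A (axis a (of_real (u n ^ 5) * (w + \<i>))) = axis a w) \<and>
    convex (A ` \<Omega>) \<and> tangential_frame a b (closure (A ` \<Omega>))" for n
  proof -
    obtain \<zeta> where \<zeta>: "\<zeta> \<in> R (u n)" "\<rho> (u n) = dist 0 \<zeta>"
      unfolding \<rho>_def using infdist_attains_inf[OF clR neR] by blast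
    show ?thesis
    proof (rule tangential_frame_exists[OF \<Omega> ab pos])
      show "0 < u n ^ 5" using u(1) by simp
      show "x n = axis a (\<i> * of_real (u n ^ 5))" by (simp add: x_def p_def)
      show "\<zeta> \<noteq> 0" using \<zeta> \<rho>pos[of n] by auto
      show "x n + axis b \<zeta> \<notin> \<Omega>" using \<zeta>(1) by (simp add: R_def x_def)
      show "x n + axis b t \<in> \<Omega>" if "cmod t < cmod \<zeta>" for t using inO that \<zeta>(2) by (simp add: x_def)
      fix v t assume v: "0 < v" "v \<le> 1" "cmod t < cmod \<zeta> * v\<^sup>2 / 2"
      then have "cmod t < \<rho> (u n * v)" using u(4)[OF v(1,2), of n] \<zeta>(2) by simp
      then show "axis a (\<i> * of_real (u n ^ 5 * v ^ 5)) + axis b t \<in> \<Omega>"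
        using inO[of t "u n * v"] by (simp add: p_def power_mult_distrib)
    qed (use xO in auto)
  qed
  then have "\<forall>n. \<exists>A. A \<in> Aff \<and> A (x n) = 0 \<and> (\<forall>w. A (axis a (of_real (u n ^ 5) * (w + \<i>))) = axis a w) \<and>
    convex (A ` \<Omega>) \<and> tangential_frame a b (closure (A ` \<Omega>))" unfolding Bex_def by (rule allI)
  from choice[OF this] obtain A where A': "\<forall>n. A n \<in> Aff \<and> A n (x n) = 0 \<and>
    (\<forall>w. A n (axis a (of_real (u n ^ 5) * (w + \<i>))) = axis a w) \<and>
    convex (A n ` \<Omega>) \<and> tangential_frame a b (closure (A n ` \<Omega>))" ..
  have A: "A n \<in> Aff" "A n (x n) = 0" "A n (axis a (of_real (u n ^ 5) * (w + \<i>))) = axis a w"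
      "convex (A n ` \<Omega>)" "tangential_frame a b (closure (A n ` \<Omega>))" for n w
    using A'[rule_format, of n] by simp_all
  note tf = tangential_frameD[OF A(5)]
  obtain k K where k: "strict_mono (k :: nat \<Rightarrow> nat)" and K: "closed K" "convex K" "0 \<in> K"
      and w: "wijsman_conv (\<lambda>n. closure (A (k n) ` \<Omega>)) K"
    by (rule wijsman_convergent_subsequence[of "\<lambda>n. closure (A n ` \<Omega>)"]) (use tf(1-3) in auto)
  have u0: "u \<longlonglongrightarrow> 0"
    by (rule tendsto_sandwich[of "\<lambda>_. 0" _ _ "\<lambda>n. 1 / real (Suc n)"])
       (use u(1,3) LIMSEQ_Suc[OF lim_const_over_n[of 1]] in \<open>auto intro: less_imp_le always_eventually\<close>)
  have body: "degenerate_body a b K"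
  proof (rule wijsman_limit_degenerate_body[OF w A(5) K])
    fix v assume "Im v > -1"
    then have "\<forall>\<^sub>F \<delta> in at_right 0. axis a (of_real \<delta> * (v + \<i>)) \<in> \<Omega>" by (intro normal) simp
    moreover have "filterlim (\<lambda>n. u (k n) ^ 5) (at_right 0) sequentially"
    proof (rule tendsto_imp_filterlim_at_right)
      have "(\<lambda>n. u (k n) ^ 5) \<longlonglongrightarrow> 0 ^ 5"
        using LIMSEQ_subseq_LIMSEQ[OF u0 k] by (intro tendsto_power) (simp add: o_def)
      then show "(\<lambda>n. u (k n) ^ 5) \<longlonglongrightarrow> 0" by simp
    qed (use u(1) in simp)
    ultimately have "\<forall>\<^sub>F n in sequentially. axis a (of_real (u (k n) ^ 5) * (v + \<i>)) \<in> \<Omega>"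
      by (rule eventually_compose_filterlim)
    then have "\<forall>\<^sub>F n in sequentially. axis a v \<in> closure (A (k n) ` \<Omega>)"
    proof eventually_elim
      case (elim n)
      from imageI[OF this, of "A (k n)"] have "axis a v \<in> A (k n) ` \<Omega>" by (simp only: A(3))
      then show ?case by (rule subsetD[OF closure_subset])
    qed
    then show "axis a v \<in> K" by (rule wijsman_limit_member[OF w K(1), rotated]) (use K(3) in blast)
  qed
  have "closure (interior K) = K"
    using convex_closure_interior[OF K(2)] degenerate_body_zero_interior[OF body] closure_closed[OF K(1)] by auto
  moreover have "0 \<in> A n ` \<Omega>" for n using imageI[OF xO[of n], of "A n"] A(2)[of n] by simp
  ultimately have "local_hausdorff_conv (\<lambda>n. A (k n) ` \<Omega>) (interior K)"
    using w A(4) K(2) degenerate_body_zero_interior[OF body]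
    by (intro wijsman_conv_imp_local_hausdorff_conv) (auto simp: convex_interior)
  then have "pointed_conv (\<lambda>n. aff_act (A (k n)) (\<Omega>, x (k n))) (interior K, 0)"
    by (simp add: pointed_conv_def aff_act_def A(2))
  moreover have "(\<lambda>n. x (k n)) \<longlonglongrightarrow> 0"
  proof -
    have "(\<lambda>n. of_real (u (k n) ^ 5) *s axis a \<i>) \<longlonglongrightarrow> of_real (0 ^ 5) *s axis a \<i>"
      using LIMSEQ_subseq_LIMSEQ[OF u0 k]
      by (intro bounded_linear.tendsto[OF bounded_linear_scalar_mult_vec] tendsto_of_real tendsto_power) (simp add: o_def)
    then show ?thesis by (simp add: x_def p_def scalar_mult_axis axis_zero mult.commute)
  qed
  ultimately show ?thesis
    using xO A(1) body by (intro exI[of _ "\<lambda>n. x (k n)"] exI[of _ "\<lambda>n. A (k n)"] exI[of _ K]) auto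
qed

section \<open>Boundary points with degenerate Levi form\<close>

lemma has_real_derivative_along_line:
  assumes "(f has_derivative D) (at (x + s *\<^sub>R u))"
  shows "((\<lambda>s. f (x + s *\<^sub>R u)) has_real_derivative D u) (at s)"
proof -
  have "((\<lambda>s. x + s *\<^sub>R u) has_derivative (\<lambda>h. h *\<^sub>R u)) (at s)"
    by (auto intro!: derivative_eq_intros)
  from diff_chain_at[OF this assms]
  have "((\<lambda>s. f (x + s *\<^sub>R u)) has_derivative (\<lambda>h. D (h *\<^sub>R u))) (at s)" by (simp add: o_def)
  moreover have "D (h *\<^sub>R u) = D u * h" for h
    using linear_scale[OF has_derivative_linear[OF assms]] by simp
  ultimately show ?thesis by (simp add: has_field_derivative_def)
qed

lemma Ck_on_SucD:
  assumes "Ck_on (Suc k) f U" "x \<in> U"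
  shows "(f has_derivative frechet_derivative f (at x)) (at x)"
  using assms by (simp add: frechet_derivative_works[symmetric])

text \<open>Taylor's formula for the restriction of \<open>r\<close> to a half line; the third derivative in the direction \<open>u\<close>
  is continuous and hence bounded near \<open>p\<close>.\<close>

lemma taylor_remainder_along_ray:
  fixes r :: "'a::euclidean_space \<Rightarrow> real"
  assumes r: "Ck_on 3 r U" and U: "open U" "p \<in> U"
  shows "\<exists>C>0. \<exists>e>0. \<forall>s. 0 < s \<longrightarrow> s < e \<longrightarrow>
    \<bar>r (p + s *\<^sub>R u) - r p - s * frechet_derivative r (at p) u
      - s\<^sup>2 / 2 * frechet_derivative (\<lambda>x. frechet_derivative r (at x) u) (at p) u\<bar> \<le> C * s ^ 3"
proof -
  define r1 where "r1 x = frechet_derivative r (at x) u" for x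
  define r2 where "r2 x = frechet_derivative r1 (at x) u" for x
  define r3 where "r3 x = frechet_derivative r2 (at x) u" for x
  have k: "Ck_on (Suc (Suc (Suc 0))) r U" using r by (simp add: numeral_3_eq_3)
  then have k1: "Ck_on (Suc (Suc 0)) r1 U" unfolding r1_def[abs_def] by simp
  then have k2: "Ck_on (Suc 0) r2 U" unfolding r2_def[abs_def] by simp
  then have c3: "continuous_on U r3" unfolding r3_def[abs_def] by simp
  have "isCont r3 p" using c3 U by (simp add: continuous_on_eq_continuous_at)
  then obtain d where d: "d > 0" "\<And>x. dist x p < d \<Longrightarrow> \<bar>r3 x - r3 p\<bar> < 1"
    unfolding continuous_at_eps_delta dist_real_def by (metis zero_less_one)
  obtain d' where d': "d' > 0" "ball p d' \<subseteq> U" using U open_contains_ball by blast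
  define e where "e = min d d' / (norm u + 1)"
  have e: "e > 0" using d d' by (simp add: e_def add_nonneg_pos)
  define C where "C = (\<bar>r3 p\<bar> + 1) / 6"
  have near: "dist (p + s *\<^sub>R u) p < min d d'" if "0 \<le> s" "s < e" for s
  proof -
    have nu: "norm u + 1 > 0" by (simp add: add_nonneg_pos)
    have "norm (s *\<^sub>R u) \<le> s * (norm u + 1)" using that by (simp add: distrib_left)
    also have "\<dots> < e * (norm u + 1)" using that nu by (intro mult_strict_right_mono)
    also have "\<dots> = min d d'" using nu by (simp add: e_def)
    finally show ?thesis by (simp add: dist_norm)
  qed
  have inU: "p + s *\<^sub>R u \<in> U" if "0 \<le> s" "s < e" for s
    using near[OF that] d'(2) by (auto simp: dist_commute)
  have main: "\<bar>r (p + s *\<^sub>R u) - r p - s * r1 p - s\<^sup>2 / 2 * r2 p\<bar> \<le> C * s ^ 3" if s: "0 < s" "s < e" for s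
  proof -
    define diff where "diff m t = (if m = 0 then r else if m = 1 then r1 else if m = 2 then r2 else r3) (p + t *\<^sub>R u)"
      for m :: nat and t
    have "\<exists>t. 0 < t \<and> t < s \<and> r (p + s *\<^sub>R u) = (\<Sum>m<3. diff m 0 / fact m * s ^ m) + diff 3 t / fact 3 * s ^ 3"
    proof (rule Maclaurin[of s 3 diff "\<lambda>t. r (p + t *\<^sub>R u)"])
      show "\<forall>m t. m < 3 \<and> 0 \<le> t \<and> t \<le> s \<longrightarrow> DERIV (diff m) t :> diff (Suc m) t"
      proof (intro allI impI, elim conjE)
        fix m :: nat and t assume m: "m < 3" and t: "0 \<le> t" "t \<le> s"
        have x: "p + t *\<^sub>R u \<in> U" using inU t s by simp
        have 0: "((\<lambda>t. r (p + t *\<^sub>R u)) has_real_derivative r1 (p + t *\<^sub>R u)) (at t)"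
          unfolding r1_def by (rule has_real_derivative_along_line[OF Ck_on_SucD[OF k x]])
        have 1: "((\<lambda>t. r1 (p + t *\<^sub>R u)) has_real_derivative r2 (p + t *\<^sub>R u)) (at t)"
          unfolding r2_def by (rule has_real_derivative_along_line[OF Ck_on_SucD[OF k1 x]])
        have 2: "((\<lambda>t. r2 (p + t *\<^sub>R u)) has_real_derivative r3 (p + t *\<^sub>R u)) (at t)"
          unfolding r3_def by (rule has_real_derivative_along_line[OF Ck_on_SucD[OF k2 x]])
        consider "m = 0" | "m = 1" | "m = 2" using m by linarith
        then show "DERIV (diff m) t :> diff (Suc m) t"
          by cases (use 0 1 2 in \<open>simp_all add: diff_def[abs_def]\<close>)
      qed
    qed (use s in \<open>auto simp: diff_def\<close>)
    then obtain t where t: "0 < t" "t < s"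
      and eq: "r (p + s *\<^sub>R u) = (\<Sum>m<3. diff m 0 / fact m * s ^ m) + diff 3 t / fact 3 * s ^ 3" by blast
    have "(\<Sum>m<3. diff m 0 / fact m * s ^ m) = r p + s * r1 p + s\<^sup>2 / 2 * r2 p"
      by (simp add: eval_nat_numeral diff_def)
    then have "r (p + s *\<^sub>R u) - r p - s * r1 p - s\<^sup>2 / 2 * r2 p = r3 (p + t *\<^sub>R u) / 6 * s ^ 3"
      using eq by (simp add: diff_def fact_numeral)
    moreover have "\<bar>r3 (p + t *\<^sub>R u)\<bar> \<le> \<bar>r3 p\<bar> + 1"
      using d(2)[of "p + t *\<^sub>R u"] near[of t] t s by simp
    then have "\<bar>r3 (p + t *\<^sub>R u) / 6 * s ^ 3\<bar> \<le> C * s ^ 3"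
      using s by (simp add: abs_mult C_def)
    ultimately show ?thesis by (simp only:)
  qed
  show ?thesis
    using main e unfolding r1_def r2_def by (intro exI[of _ C] exI[of _ e] conjI) (auto simp: C_def)
qed

lemma local_defining_functionD:
  assumes "local_defining_function \<Omega> p U r"
  shows "open U" "p \<in> U" "\<And>k. Ck_on k r U" "\<And>x. x \<in> U \<Longrightarrow> x \<in> \<Omega> \<longleftrightarrow> r x < 0"
    "frechet_derivative r (at p) \<noteq> (\<lambda>v. 0)"
  using assms unfolding local_defining_function_def smooth_fun_on_def by auto

lemma local_defining_function_zero:
  assumes ldf: "local_defining_function \<Omega> p U r" and \<Omega>: "open \<Omega>" and p: "p \<in> frontier \<Omega>"
  shows "r p = 0"
proof (rule ccontr)
  note r = local_defining_functionD[OF ldf]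
  assume "r p \<noteq> 0"
  have pc: "p \<in> closure \<Omega>" "p \<notin> \<Omega>" using p \<Omega> by (auto simp: frontier_def interior_open)
  then have "r p > 0" using r(4)[OF r(2)] \<open>r p \<noteq> 0\<close> by simp
  have "isCont r p" using Ck_on_SucD[OF r(3) r(2)] has_derivative_continuous by blast
  then obtain d where d: "d > 0" "\<And>x. dist x p < d \<Longrightarrow> \<bar>r x - r p\<bar> < r p"
    unfolding continuous_at_eps_delta dist_real_def using \<open>r p > 0\<close> by blast
  obtain d' where d': "d' > 0" "ball p d' \<subseteq> U" using r(1,2) open_contains_ball by blast
  have "min d d' > 0" using d(1) d'(1) by simp
  then obtain y where y: "y \<in> \<Omega>" "dist y p < min d d'" using pc(1) unfolding closure_approachable by blast
  then have "r y > 0" "y \<in> U" using d(2)[of y] d'(2) by (auto simp: dist_commute)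
  then show False using r(4)[of y] y(1) by simp
qed

lemma defining_function_negative_direction:
  assumes ldf: "local_defining_function \<Omega> p U r" and r0: "r p = 0"
    and y: "frechet_derivative r (at p) y < 0"
  shows "\<forall>\<^sub>F \<delta> in at_right 0. p + \<delta> *\<^sub>R y \<in> \<Omega>"
proof -
  note r = local_defining_functionD[OF ldf]
  have "(r has_derivative frechet_derivative r (at p)) (at (p + 0 *\<^sub>R y))"
    using Ck_on_SucD[OF r(3) r(2)] by simp
  from has_real_derivative_along_line[OF this]
  have "DERIV (\<lambda>s. r (p + s *\<^sub>R y)) 0 :> frechet_derivative r (at p) y" .
  from DERIV_neg_dec_right[OF this y] obtain d where d: "d > 0" "\<And>h. 0 < h \<Longrightarrow> h < d \<Longrightarrow> r (p + h *\<^sub>R y) < 0"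
    using r0 by auto
  have "((\<lambda>s. p + s *\<^sub>R y) \<longlongrightarrow> p + 0 *\<^sub>R y) (at_right 0)" by (intro tendsto_intros)
  then have "\<forall>\<^sub>F s in at_right 0. p + s *\<^sub>R y \<in> U" using topological_tendstoD[OF _ r(1)] r(2) by simp
  moreover have "\<forall>\<^sub>F s in at_right 0. 0 < s \<and> s < d"
    using eventually_at_right_real[OF d(1)] by simp
  ultimately show ?thesis by eventually_elim (use r(4) d(2) in blast)
qed

text \<open>The differential is non-positive on \<open>\<Omega> - p\<close> because the segment from \<open>p\<close> to a point of \<open>\<Omega>\<close> stays in
  \<open>\<Omega>\<close>; it cannot vanish there because a nonzero linear form is open.\<close>

lemma defining_function_supports:
  assumes ldf: "local_defining_function \<Omega> p U r" and \<Omega>: "open \<Omega>" "convex \<Omega>" and p: "p \<in> frontier \<Omega>"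
    and z: "z \<in> \<Omega>"
  shows "frechet_derivative r (at p) (z - p) < 0"
proof -
  note r = local_defining_functionD[OF ldf]
  note r0 = local_defining_function_zero[OF ldf \<Omega>(1) p]
  define g where "g = frechet_derivative r (at p)"
  have dg: "(r has_derivative g) (at p)" unfolding g_def using Ck_on_SucD[OF r(3) r(2)] .
  note lin = has_derivative_linear[OF dg]
  have pc: "p \<in> closure \<Omega>" using p by (simp add: frontier_def)
  have le: "g (y - p) \<le> 0" if y: "y \<in> \<Omega>" for y
  proof (rule ccontr)
    assume "\<not> g (y - p) \<le> 0"
    then have gp: "g (y - p) > 0" by simp
    have "DERIV (\<lambda>s. r (p + s *\<^sub>R (y - p))) 0 :> g (y - p)"
      by (rule has_real_derivative_along_line) (use dg in simp)
    from DERIV_pos_inc_right[OF this gp] obtain d where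
      d: "d > 0" "\<And>h. 0 < h \<Longrightarrow> h < d \<Longrightarrow> r (p + h *\<^sub>R (y - p)) > 0" using r0 by auto
    have "((\<lambda>s. p + s *\<^sub>R (y - p)) \<longlongrightarrow> p + 0 *\<^sub>R (y - p)) (at_right 0)" by (intro tendsto_intros)
    then have "\<forall>\<^sub>F s in at_right 0. p + s *\<^sub>R (y - p) \<in> U" using topological_tendstoD[OF _ r(1)] r(2) by simp
    moreover have "\<forall>\<^sub>F s in at_right 0. 0 < s \<and> s < min d 1"
      using eventually_at_right_real[of 0 "min d 1"] d(1) by simp
    ultimately have "\<forall>\<^sub>F s in at_right 0. p + s *\<^sub>R (y - p) \<in> U \<and> 0 < s \<and> s < min d 1" by eventually_elim simp
    then obtain s where "p + s *\<^sub>R (y - p) \<in> U \<and> 0 < s \<and> s < min d 1"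
      using eventually_happens'[OF trivial_limit_at_right_real] by blast
    then have s: "p + s *\<^sub>R (y - p) \<in> U" "0 < s" "s < d" "s < 1" by simp_all
    have "p - s *\<^sub>R (p - y) \<in> interior \<Omega>"
      by (rule mem_interior_closure_convex_shrink[OF \<Omega>(2) _ pc]) (use y \<Omega>(1) s in \<open>auto simp: interior_open\<close>)
    then have "p + s *\<^sub>R (y - p) \<in> \<Omega>" using \<Omega>(1) by (simp add: interior_open algebra_simps)
    then show False using r(4)[OF s(1)] d(2)[OF s(2,3)] by simp
  qed
  have "g (z - p) \<noteq> 0"
  proof
    assume g0: "g (z - p) = 0"
    obtain w where "g w \<noteq> 0" using r(5) unfolding g_def by fastforce
    define w' where "w' = (if g w > 0 then w else - w)"
    have w': "g w' > 0" using \<open>g w \<noteq> 0\<close> linear_neg[OF lin] by (auto simp: w'_def)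
    have "((\<lambda>s. z + s *\<^sub>R w') \<longlongrightarrow> z + 0 *\<^sub>R w') (at_right 0)" by (intro tendsto_intros)
    then have "\<forall>\<^sub>F s in at_right 0. z + s *\<^sub>R w' \<in> \<Omega>" using topological_tendstoD[OF _ \<Omega>(1)] z by simp
    moreover have "\<forall>\<^sub>F s in at_right (0::real). 0 < s" by (simp add: eventually_at_right_less)
    ultimately have "\<forall>\<^sub>F s in at_right 0. z + s *\<^sub>R w' \<in> \<Omega> \<and> 0 < s" by eventually_elim simp
    then obtain s where s: "z + s *\<^sub>R w' \<in> \<Omega>" "0 < s"
      using eventually_happens'[OF trivial_limit_at_right_real] by blast
    have eq: "z + s *\<^sub>R w' - p = (z - p) + s *\<^sub>R w'" by simp
    have "g (z + s *\<^sub>R w' - p) = s * g w'"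
      unfolding eq using linear_add[OF lin, of "z - p" "s *\<^sub>R w'"] linear_scale[OF lin, of s w'] g0 by simp
    then show False using le[OF s(1)] w' s(2) by (simp add: mult_le_0_iff)
  qed
  then show ?thesis using le[OF z] by (simp add: g_def)
qed

text \<open>Linearity in \<open>w\<close> holds for the inner derivative on all of \<open>U\<close> and is inherited by its derivative at \<open>p\<close>.\<close>

lemma bilinear_second_derivative:
  fixes r :: "'a::euclidean_space \<Rightarrow> real"
  assumes r: "Ck_on (Suc (Suc 0)) r U" and U: "open U" "p \<in> U"
  shows "bilinear (\<lambda>u w. frechet_derivative (\<lambda>x. frechet_derivative r (at x) w) (at p) u)"
proof -
  define D where "D w x = frechet_derivative r (at x) w" for w x
  have D2: "(D w has_derivative frechet_derivative (D w) (at p)) (at p)" for w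
    by (rule Ck_on_SucD[OF _ U(2), of 0]) (use r in \<open>simp add: D_def[abs_def]\<close>)
  have lin: "linear (frechet_derivative r (at x))" if "x \<in> U" for x
    using has_derivative_linear[OF Ck_on_SucD[OF r that]] .
  have add: "frechet_derivative (D (w + w')) (at p) u = frechet_derivative (D w) (at p) u + frechet_derivative (D w') (at p) u"
    for w w' u
  proof -
    have "(D (w + w') has_derivative (\<lambda>u. frechet_derivative (D w) (at p) u + frechet_derivative (D w') (at p) u)) (at p)"
      by (rule has_derivative_transform_within_open[OF has_derivative_add[OF D2[of w] D2[of w']] U])
         (simp add: D_def linear_add[OF lin])
    from frechet_derivative_at[OF this] show ?thesis by metis
  qed
  have scale: "frechet_derivative (D (c *\<^sub>R w)) (at p) u = c *\<^sub>R frechet_derivative (D w) (at p) u" for c w u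
  proof -
    have "(D (c *\<^sub>R w) has_derivative (\<lambda>u. c *\<^sub>R frechet_derivative (D w) (at p) u)) (at p)"
      by (rule has_derivative_transform_within_open[OF has_derivative_scaleR_right[OF D2[of w]] U])
         (simp add: D_def linear_scale[OF lin])
    from frechet_derivative_at[OF this] show ?thesis by metis
  qed
  have "linear (\<lambda>w. frechet_derivative (D w) (at p) u)" for u
    by (intro linearI add scale)
  moreover have "linear (\<lambda>u. frechet_derivative (D w) (at p) u)" for w
    using has_derivative_linear[OF D2] .
  ultimately show ?thesis unfolding bilinear_def D_def by blast
qed

lemma vec_eq_sum_axis: "v = (\<Sum>j\<in>UNIV. axis j (v $ j))" for v :: "complex ^ 'd"
  by (simp add: vec_eq_iff axis_def if_distrib cong: if_cong)

lemma axis_eq_real_combination: "axis j z = Re z *\<^sub>R axis j 1 + Im z *\<^sub>R axis j \<i>"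
  by (simp add: vec_eq_iff axis_def complex_eq_iff)

lemma wirtinger_pairing:
  fixes r :: "complex ^ 'd \<Rightarrow> real"
  assumes r: "(r has_derivative g) (at p)"
  shows "Re (\<Sum>j\<in>UNIV. wirt j (\<lambda>z. of_real (r z)) p * z $ j) = g z / 2"
proof -
  have "((\<lambda>z. complex_of_real (r z)) has_derivative (\<lambda>u. of_real (g u))) (at p)"
    by (rule has_derivative_of_real[OF r])
  from frechet_derivative_at[OF this]
  have fd: "frechet_derivative (\<lambda>z. complex_of_real (r z)) (at p) = (\<lambda>u. of_real (g u))" by simp
  note lin = has_derivative_linear[OF r]
  have "Re (wirt j (\<lambda>z. of_real (r z)) p * z $ j) = g (axis j (z $ j)) / 2" for j
    unfolding wirt_def fd axis_eq_real_combination[of j "z $ j"] linear_add[OF lin] linear_scale[OF lin]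
    by (simp add: field_simps)
  then have "Re (\<Sum>j\<in>UNIV. wirt j (\<lambda>z. of_real (r z)) p * z $ j) = (\<Sum>j\<in>UNIV. g (axis j (z $ j))) / 2"
    by (simp only: Re_sum sum_divide_distrib)
  moreover have "g z = g (\<Sum>j\<in>UNIV. axis j (z $ j))" by (rule arg_cong[OF vec_eq_sum_axis])
  ultimately show ?thesis by (simp only: linear_sum[OF lin])
qed

text \<open>The Levi form is a quarter of the trace of the real Hessian on the complex line spanned by \<open>v\<close>.\<close>

lemma levi_form_eq_second_derivatives:
  fixes r :: "complex ^ 'd \<Rightarrow> real"
  assumes r: "Ck_on (Suc (Suc 0)) r U" and U: "open U" "p \<in> U"
  defines "B \<equiv> \<lambda>u w. frechet_derivative (\<lambda>x. frechet_derivative r (at x) w) (at p) u"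
  shows "levi_form r p v = (B v v + B (\<i> *s v) (\<i> *s v)) / 4"
proof -
  have bil: "bilinear B" unfolding B_def by (rule bilinear_second_derivative[OF r U])
  define D where "D w x = frechet_derivative r (at x) w" for w x
  have D2: "(D w has_derivative (\<lambda>u. B u w)) (at p)" for w
    unfolding B_def D_def
    by (rule Ck_on_SucD[OF _ U(2), of 0]) (use r in simp)
  have wterm: "wirt j (wirt_bar k (\<lambda>z. of_real (r z))) p
      = ((of_real (B (axis j 1) (axis k 1)) + \<i> * of_real (B (axis j 1) (axis k \<i>)))
         - \<i> * (of_real (B (axis j \<i>) (axis k 1)) + \<i> * of_real (B (axis j \<i>) (axis k \<i>)))) / 4" for j k
  proof -
    have wb: "wirt_bar k (\<lambda>z. of_real (r z)) x = (of_real (D (axis k 1) x) + \<i> * of_real (D (axis k \<i>) x)) / 2"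
      if "x \<in> U" for x
    proof -
      have "((\<lambda>z. complex_of_real (r z)) has_derivative (\<lambda>u. of_real (frechet_derivative r (at x) u))) (at x)"
        by (rule has_derivative_of_real[OF Ck_on_SucD[OF r that]])
      from frechet_derivative_at[OF this]
      have "frechet_derivative (\<lambda>z. complex_of_real (r z)) (at x) = (\<lambda>u. of_real (frechet_derivative r (at x) u))" by simp
      then show ?thesis by (simp add: wirt_bar_def D_def)
    qed
    have "((\<lambda>x. (complex_of_real (D (axis k 1) x) + \<i> * of_real (D (axis k \<i>) x)) / 2)
        has_derivative (\<lambda>u. (of_real (B u (axis k 1)) + \<i> * of_real (B u (axis k \<i>))) / 2)) (at p)"
      by (rule bounded_linear.has_derivative[OF bounded_linear_divide has_derivative_add[OF
            has_derivative_of_real[OF D2] has_derivative_mult_right[OF has_derivative_of_real[OF D2]]]])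
    from has_derivative_transform_within_open[OF this U wb[symmetric]]
    have "(wirt_bar k (\<lambda>z. of_real (r z)) has_derivative
        (\<lambda>u. (of_real (B u (axis k 1)) + \<i> * of_real (B u (axis k \<i>))) / 2)) (at p)" .
    from frechet_derivative_at[OF this, symmetric]
    show ?thesis unfolding wirt_def by (simp only:) (simp add: field_simps)
  qed
  have Bax: "B (axis j y) (axis k z) = Re y * Re z * B (axis j 1) (axis k 1) + Re y * Im z * B (axis j 1) (axis k \<i>)
      + Im y * Re z * B (axis j \<i>) (axis k 1) + Im y * Im z * B (axis j \<i>) (axis k \<i>)" for j k y z
    unfolding axis_eq_real_combination[of j y] axis_eq_real_combination[of k z]
      bilinear_ladd[OF bil] bilinear_radd[OF bil] bilinear_lmul[OF bil] bilinear_rmul[OF bil]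
    by (simp add: algebra_simps)
  have Bsum: "B w w = (\<Sum>j\<in>UNIV. \<Sum>k\<in>UNIV. B (axis j (w $ j)) (axis k (w $ k)))" for w
  proof -
    have "B w w = B (\<Sum>j\<in>UNIV. axis j (w $ j)) (\<Sum>k\<in>UNIV. axis k (w $ k))"
      by (rule arg_cong2[OF vec_eq_sum_axis vec_eq_sum_axis])
    then show ?thesis by (simp add: bilinear_sum[OF bil] sum.cartesian_product)
  qed
  have "Re (wirt j (wirt_bar k (\<lambda>z. of_real (r z))) p * v $ j * cnj (v $ k))
      = (B (axis j (v $ j)) (axis k (v $ k)) + B (axis j ((\<i> *s v) $ j)) (axis k ((\<i> *s v) $ k))) / 4" for j k
    unfolding wterm Bax[of j "v $ j"] Bax[of j "(\<i> *s v) $ j"] by (simp add: field_simps)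
  then have "levi_form r p v = (\<Sum>j\<in>UNIV. \<Sum>k\<in>UNIV.
      (B (axis j (v $ j)) (axis k (v $ k)) + B (axis j ((\<i> *s v) $ j)) (axis k ((\<i> *s v) $ k))) / 4)"
    unfolding levi_form_def by (simp only: Re_sum)
  also have "\<dots> = (B v v + B (\<i> *s v) (\<i> *s v)) / 4"
    unfolding Bsum[of v] Bsum[of "\<i> *s v"] by (simp only: sum_divide_distrib sum.distrib add_divide_distrib)
  finally show ?thesis .
qed

text \<open>In a tangential direction \<open>d\<close> with non-positive second derivative the Taylor formula gives
  \<open>r (p + s d) \<le> C s ^ 3\<close>. With \<open>s = u\<^sup>2\<close> this is \<open>C u ^ 6\<close>, which is beaten by the decrease of \<open>r\<close>
  after moving inwards by \<open>u ^ 5\<close>.\<close>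

lemma inward_shift_of_tangent_ray:
  assumes ldf: "local_defining_function \<Omega> p U r" and r0: "r p = 0"
    and d: "frechet_derivative r (at p) d = 0"
      "frechet_derivative (\<lambda>x. frechet_derivative r (at x) d) (at p) d \<le> 0"
    and M: "frechet_derivative r (at p) M = -1"
  shows "\<exists>e>0. \<forall>u. 0 < u \<longrightarrow> u \<le> e \<longrightarrow> p + u\<^sup>2 *\<^sub>R d + u ^ 5 *\<^sub>R M \<in> \<Omega>"
proof -
  note r = local_defining_functionD[OF ldf]
  obtain C e\<^sub>1 where C: "C > 0" "e\<^sub>1 > 0" and taylor: "\<And>s. 0 < s \<Longrightarrow> s < e\<^sub>1 \<Longrightarrow>
    \<bar>r (p + s *\<^sub>R d) - r p - s * frechet_derivative r (at p) d
      - s\<^sup>2 / 2 * frechet_derivative (\<lambda>x. frechet_derivative r (at x) d) (at p) d\<bar> \<le> C * s ^ 3"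
    using taylor_remainder_along_ray[OF r(3,1,2), of d] by blast
  have ray: "r (p + s *\<^sub>R d) \<le> C * s ^ 3" if "0 < s" "s < e\<^sub>1" for s
  proof -
    have "s\<^sup>2 / 2 * frechet_derivative (\<lambda>x. frechet_derivative r (at x) d) (at p) d \<le> 0"
      using d(2) by (intro mult_nonneg_nonpos) auto
    then show ?thesis using taylor[OF that] r0 d(1) by simp
  qed
  define D where "D x = frechet_derivative r (at x) M" for x
  have "continuous_on U D" using r(3)[of "Suc 0"] by (simp add: D_def[abs_def])
  then have "isCont D p" using r(1,2) by (simp add: continuous_on_eq_continuous_at)
  then obtain m\<^sub>1 where m1: "m\<^sub>1 > 0" "\<And>x. dist x p < m\<^sub>1 \<Longrightarrow> \<bar>D x - D p\<bar> < 1/2"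
    unfolding continuous_at_eps_delta dist_real_def by (metis half_gt_zero zero_less_one)
  obtain m\<^sub>2 where m2: "m\<^sub>2 > 0" "ball p m\<^sub>2 \<subseteq> U" using r(1,2) open_contains_ball by blast
  define m where "m = min m\<^sub>1 m\<^sub>2"
  define K where "K = norm d + norm M + 1"
  \<comment> \<open>The four bounds ensure in turn \<open>u ^ 5 \<le> u\<^sup>2 \<le> u\<close>, that all points stay where \<open>D\<close> is below \<open>-1/2\<close>,
    that the Taylor estimate applies, and that \<open>C u ^ 6 \<le> u ^ 5 / 4\<close>.\<close>
  define e where "e = min 1 (min (m / (2 * K)) (min (e\<^sub>1 / 2) (1 / (4 * C))))"
  have K: "K > 0" by (simp add: K_def add_nonneg_pos)
  have m: "m > 0" using m1 m2 by (simp add: m_def)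
  have "e > 0" using K m C by (simp add: e_def)
  have "p + u\<^sup>2 *\<^sub>R d + u ^ 5 *\<^sub>R M \<in> \<Omega>" if u: "0 < u" "u \<le> e" for u
  proof -
    have ue: "u \<le> 1" "u \<le> m / (2 * K)" "u \<le> e\<^sub>1 / 2" "u \<le> 1 / (4 * C)" using u(2) by (simp_all add: e_def)
    have u2: "u\<^sup>2 \<le> u" "u ^ 5 \<le> u\<^sup>2"
      using power_decreasing[of 1 2 u] power_decreasing[of 2 5 u] u(1) ue(1) by simp_all
    have near: "dist (p + u\<^sup>2 *\<^sub>R d + s *\<^sub>R M) p < m" if s: "0 \<le> s" "s \<le> u ^ 5" for s
    proof -
      have "dist (p + u\<^sup>2 *\<^sub>R d + s *\<^sub>R M) p = norm (u\<^sup>2 *\<^sub>R d + s *\<^sub>R M)" by (simp add: dist_norm)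
      also have "\<dots> \<le> u\<^sup>2 * norm d + s * norm M" using s norm_triangle_ineq[of "u\<^sup>2 *\<^sub>R d" "s *\<^sub>R M"] by simp
      also have "\<dots> \<le> u * norm d + u * norm M"
        using s u2 by (intro add_mono mult_right_mono) auto
      also have "\<dots> < u * K" using u(1) by (simp add: K_def distrib_left)
      also have "\<dots> \<le> m / (2 * K) * K" using ue(2) K by (intro mult_right_mono) auto
      also have "\<dots> < m" using K m by simp
      finally show ?thesis .
    qed
    have inU: "p + u\<^sup>2 *\<^sub>R d + s *\<^sub>R M \<in> U" if "0 \<le> s" "s \<le> u ^ 5" for s
      using near[OF that] m2(2) by (auto simp: m_def dist_commute)
    have der: "DERIV (\<lambda>s. r (p + u\<^sup>2 *\<^sub>R d + s *\<^sub>R M)) s :> D (p + u\<^sup>2 *\<^sub>R d + s *\<^sub>R M)"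
      if "0 \<le> s" "s \<le> u ^ 5" for s
      unfolding D_def by (rule has_real_derivative_along_line[OF Ck_on_SucD[OF r(3) inU[OF that]]])
    have "u ^ 5 > 0" using u(1) by simp
    from MVT2[OF this der] obtain s where s: "0 < s" "s < u ^ 5"
      and eq: "r (p + u\<^sup>2 *\<^sub>R d + u ^ 5 *\<^sub>R M) - r (p + u\<^sup>2 *\<^sub>R d + 0 *\<^sub>R M)
        = (u ^ 5 - 0) * D (p + u\<^sup>2 *\<^sub>R d + s *\<^sub>R M)"
      by blast
    have "\<bar>D (p + u\<^sup>2 *\<^sub>R d + s *\<^sub>R M) - D p\<bar> < 1/2" by (rule m1(2)) (use near[of s] s in \<open>simp add: m_def\<close>)
    moreover have "D p = -1" using M by (simp add: D_def)
    ultimately have "D (p + u\<^sup>2 *\<^sub>R d + s *\<^sub>R M) \<le> -1/2" by linarith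
    then have "u ^ 5 * D (p + u\<^sup>2 *\<^sub>R d + s *\<^sub>R M) \<le> u ^ 5 * (-1/2)"
      using \<open>u ^ 5 > 0\<close> by (intro mult_left_mono) auto
    moreover have "r (p + u\<^sup>2 *\<^sub>R d) \<le> C * (u\<^sup>2) ^ 3" by (rule ray) (use u u2 ue C in auto)
    moreover have "C * (u\<^sup>2) ^ 3 = u ^ 5 * (C * u)" by (simp add: eval_nat_numeral)
    moreover have "C * u \<le> C * (1 / (4 * C))" using ue(4) C(1) by (intro mult_left_mono) auto
    then have "u ^ 5 * (C * u) \<le> u ^ 5 * (1/4)"
      using C(1) \<open>u ^ 5 > 0\<close> by (intro mult_left_mono) auto
    moreover have "r (p + u\<^sup>2 *\<^sub>R d + u ^ 5 *\<^sub>R M) - r (p + u\<^sup>2 *\<^sub>R d) = u ^ 5 * D (p + u\<^sup>2 *\<^sub>R d + s *\<^sub>R M)"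
      using eq by simp
    ultimately have "r (p + u\<^sup>2 *\<^sub>R d + u ^ 5 *\<^sub>R M) < 0" using \<open>u ^ 5 > 0\<close> by linarith
    then show ?thesis using r(4)[OF inU[of "u ^ 5"]] \<open>u ^ 5 > 0\<close> by simp
  qed
  then show ?thesis using \<open>e > 0\<close> by blast
qed

text \<open>The point \<open>q + t v\<close> is the midpoint of a point on the segment along \<open>v\<close> and one on the segment along
  \<open>\<i> v\<close>.\<close>

lemma convex_contains_cross_disc:
  fixes v :: "complex ^ 'd"
  assumes "convex \<Omega>" and \<Omega>: "q + c *\<^sub>R v \<in> \<Omega>" "q - c *\<^sub>R v \<in> \<Omega>" "q + c *\<^sub>R (\<i> *s v) \<in> \<Omega>" "q - c *\<^sub>R (\<i> *s v) \<in> \<Omega>"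
    and t: "cmod t < c / 2"
  shows "q + t *s v \<in> \<Omega>"
proof -
  have c: "c > 0" using t norm_ge_zero[of t] by linarith
  have seg: "q + s *\<^sub>R w \<in> \<Omega>" if "q + c *\<^sub>R w \<in> \<Omega>" "q - c *\<^sub>R w \<in> \<Omega>" "\<bar>s\<bar> \<le> c" for s w
  proof -
    define k where "k = (s + c) / (2 * c)"
    have l: "0 \<le> k" "k \<le> 1" using that(3) c by (auto simp: k_def)
    have "(1 - k) *\<^sub>R (q - c *\<^sub>R w) + k *\<^sub>R (q + c *\<^sub>R w) \<in> \<Omega>"
      by (rule convexD_alt[OF assms(1) that(2,1) l])
    also have "(1 - k) *\<^sub>R (q - c *\<^sub>R w) + k *\<^sub>R (q + c *\<^sub>R w) = q + (2 * c * k - c) *\<^sub>R w"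
      by (simp add: vec_eq_iff complex_eq_iff algebra_simps)
    also have "2 * c * k - c = s" using c by (simp add: k_def)
    finally show ?thesis .
  qed
  have "\<bar>2 * Re t\<bar> \<le> c" "\<bar>2 * Im t\<bar> \<le> c" using t abs_Re_le_cmod[of t] abs_Im_le_cmod[of t] by linarith+
  then have "q + (2 * Re t) *\<^sub>R v \<in> \<Omega>" "q + (2 * Im t) *\<^sub>R (\<i> *s v) \<in> \<Omega>" using seg \<Omega> by blast+
  from convexD_alt[OF assms(1) this, of "1/2"]
  have "(1 - 1/2) *\<^sub>R (q + (2 * Re t) *\<^sub>R v) + (1/2) *\<^sub>R (q + (2 * Im t) *\<^sub>R (\<i> *s v)) \<in> \<Omega>" by simp
  also have "(1 - 1/2) *\<^sub>R (q + (2 * Re t) *\<^sub>R v) + (1/2) *\<^sub>R (q + (2 * Im t) *\<^sub>R (\<i> *s v)) = q + t *s v"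
    by (simp add: vec_eq_iff complex_eq_iff algebra_simps)
  finally show ?thesis .
qed

text \<open>At a boundary point where the Levi form is not positive on a tangent vector \<open>v\<close>, the second derivatives of a
  defining function along \<open>v\<close> and \<open>\<i> v\<close> have a non-positive sum; both are non-negative by convexity, so both vanish.
  Here \<open>\<Sum>j. l j * z $ j\<close> is the complex linear form whose imaginary part is minus the differential
  of the defining function.\<close>

lemma degenerate_boundary_point:
  fixes \<Omega> :: "(complex ^ 'd) set"
  assumes "convex_domain \<Omega>" "smooth_boundary \<Omega>" "\<not> strongly_pseudoconvex \<Omega>"
  obtains p v and l :: "'d \<Rightarrow> complex" where "p \<in> frontier \<Omega>" "v \<noteq> 0" "(\<Sum>j\<in>UNIV. l j * v $ j) = 0" "l \<noteq> (\<lambda>j. 0)"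
    "\<And>z. z \<in> \<Omega> \<Longrightarrow> Im (\<Sum>j\<in>UNIV. l j * (z - p) $ j) > 0"
    "\<And>y. Im (\<Sum>j\<in>UNIV. l j * y $ j) > 0 \<Longrightarrow> \<forall>\<^sub>F \<delta> in at_right 0. p + \<delta> *\<^sub>R y \<in> \<Omega>"
    "\<And>N. (\<Sum>j\<in>UNIV. l j * N $ j) = 1 \<Longrightarrow> \<exists>e>0. \<forall>u t. 0 < u \<longrightarrow> u \<le> e \<longrightarrow> cmod t < u\<^sup>2 / 2 \<longrightarrow>
      p + (\<i> * of_real (u ^ 5)) *s N + t *s v \<in> \<Omega>"
proof -
  have \<Omega>: "open \<Omega>" "convex \<Omega>" "\<Omega> \<noteq> {}" using assms(1) by (auto simp: convex_domain_def)
  obtain p where p: "p \<in> frontier \<Omega>"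
    and np: "\<not> (\<exists>U r. local_defining_function \<Omega> p U r \<and> (\<forall>v\<in>complex_tangent r p. v \<noteq> 0 \<longrightarrow> levi_form r p v > 0))"
    using assms(3) unfolding strongly_pseudoconvex_def by blast
  obtain U r where ldf: "local_defining_function \<Omega> p U r"
    using assms(2) p unfolding smooth_boundary_def by blast
  then obtain v where v: "v \<in> complex_tangent r p" "v \<noteq> 0" "\<not> levi_form r p v > 0" using np by blast
  note r = local_defining_functionD[OF ldf]
  note r0 = local_defining_function_zero[OF ldf \<Omega>(1) p]
  note supp = defining_function_supports[OF ldf \<Omega>(1,2) p]
  define g where "g = frechet_derivative r (at p)"
  have dg: "(r has_derivative g) (at p)" unfolding g_def by (rule Ck_on_SucD[OF r(3) r(2)])
  note lin = has_derivative_linear[OF dg]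
  define W where "W z = (\<Sum>j\<in>UNIV. wirt j (\<lambda>z. of_real (r z)) p * z $ j)" for z
  define l where "l j = - 2 * \<i> * wirt j (\<lambda>z. of_real (r z)) p" for j
  have lW: "(\<Sum>j\<in>UNIV. l j * z $ j) = - 2 * \<i> * W z" for z
    by (simp add: l_def W_def sum_distrib_left mult.assoc)
  have ReW: "Re (W z) = g z / 2" for z unfolding W_def by (rule wirtinger_pairing[OF dg])
  have Iml: "Im (\<Sum>j\<in>UNIV. l j * z $ j) = - g z" for z unfolding lW by (simp add: ReW)
  have Wv: "W v = 0" using v(1) by (simp add: complex_tangent_def W_def)
  have Wscale: "W (c *s z) = c * W z" for c z by (simp add: W_def sum_distrib_left algebra_simps)
  have gv: "g v = 0" "g (\<i> *s v) = 0" using ReW[of v] ReW[of "\<i> *s v"] Wv by (simp_all add: Wscale)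
  define B where "B = (\<lambda>u w. frechet_derivative (\<lambda>x. frechet_derivative r (at x) w) (at p) u)"
  have bil: "bilinear B" unfolding B_def by (rule bilinear_second_derivative[OF r(3,1,2)])
  have "levi_form r p v = (B v v + B (\<i> *s v) (\<i> *s v)) / 4"
    unfolding B_def by (rule levi_form_eq_second_derivatives[OF r(3,1,2)])
  then have trace: "B v v + B (\<i> *s v) (\<i> *s v) \<le> 0" using v(3) by simp
  have nonneg: "B d d \<ge> 0" if d: "g d = 0" for d
  proof (rule ccontr)
    assume "\<not> B d d \<ge> 0"
    obtain C e where C: "C > 0" "e > 0" and taylor: "\<And>s. 0 < s \<Longrightarrow> s < e \<Longrightarrow>
      \<bar>r (p + s *\<^sub>R d) - r p - s * g d - s\<^sup>2 / 2 * B d d\<bar> \<le> C * s ^ 3"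
      using taylor_remainder_along_ray[OF r(3,1,2), of d] unfolding g_def B_def by blast
    have "((\<lambda>s. p + s *\<^sub>R d) \<longlongrightarrow> p + 0 *\<^sub>R d) (at_right 0)" by (intro tendsto_intros)
    then have "\<forall>\<^sub>F s in at_right 0. p + s *\<^sub>R d \<in> U" using topological_tendstoD[OF _ r(1)] r(2) by simp
    moreover have "\<forall>\<^sub>F s in at_right 0. 0 < s \<and> s < min e (- B d d / (2 * C))"
      using eventually_at_right_real[of 0 "min e (- B d d / (2 * C))"] C \<open>\<not> B d d \<ge> 0\<close> by (simp add: divide_neg_pos)
    ultimately have "\<forall>\<^sub>F s in at_right 0. p + s *\<^sub>R d \<in> U \<and> 0 < s \<and> s < min e (- B d d / (2 * C))" by eventually_elim simp
    then obtain s where "p + s *\<^sub>R d \<in> U \<and> 0 < s \<and> s < min e (- B d d / (2 * C))"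
      using eventually_happens'[OF trivial_limit_at_right_real] by blast
    then have s: "p + s *\<^sub>R d \<in> U" "0 < s" "s < e" "s < - B d d / (2 * C)" by simp_all
    have "p + s *\<^sub>R d \<notin> \<Omega>"
      using supp[of "p + s *\<^sub>R d"] linear_scale[OF lin, of s d] d by (auto simp: g_def)
    then have "r (p + s *\<^sub>R d) \<ge> 0" using r(4)[OF s(1)] by simp
    then have "0 \<le> s\<^sup>2 / 2 * B d d + C * s ^ 3" using taylor[OF s(2,3)] r0 d by simp
    also have "\<dots> = s\<^sup>2 * (B d d / 2 + C * s)" by (simp add: eval_nat_numeral algebra_simps)
    finally have "B d d / 2 + C * s \<ge> 0" using s(2) by (simp add: zero_le_mult_iff)
    moreover have "C * s < C * (- B d d / (2 * C))" using s(4) C(1) by (rule mult_strict_left_mono)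
    then have "C * s < - B d d / 2" using C(1) by simp
    ultimately show False by simp
  qed
  have B0: "B v v \<le> 0" "B (\<i> *s v) (\<i> *s v) \<le> 0" using trace nonneg[OF gv(1)] nonneg[OF gv(2)] by linarith+
  have Bneg: "B (- d) (- d) = B d d" for d by (simp add: bilinear_lneg[OF bil] bilinear_rneg[OF bil])
  have gneg: "g (- d) = - g d" for d by (rule linear_neg[OF lin])
  show ?thesis
  proof (rule that[of p v l])
    show "p \<in> frontier \<Omega>" by (rule p)
    show "v \<noteq> 0" by (rule v(2))
    show "(\<Sum>j\<in>UNIV. l j * v $ j) = 0" by (simp add: lW Wv)
    show "l \<noteq> (\<lambda>j. 0)"
    proof
      assume "l = (\<lambda>j. 0)"
      then have "g z = 0" for z using Iml[of z] by simp
      then show False using r(5) by (auto simp: g_def)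
    qed
    show "Im (\<Sum>j\<in>UNIV. l j * (z - p) $ j) > 0" if "z \<in> \<Omega>" for z
      using supp[OF that] by (simp only: Iml g_def)
    show "\<forall>\<^sub>F \<delta> in at_right 0. p + \<delta> *\<^sub>R y \<in> \<Omega>" if "Im (\<Sum>j\<in>UNIV. l j * y $ j) > 0" for y
      by (rule defining_function_negative_direction[OF ldf r0]) (use that in \<open>simp only: Iml g_def\<close>)
    fix N assume N: "(\<Sum>j\<in>UNIV. l j * N $ j) = 1"
    define M where "M = \<i> *s N"
    have "(\<Sum>j\<in>UNIV. l j * M $ j) = \<i> * (\<Sum>j\<in>UNIV. l j * N $ j)"
      by (simp add: M_def sum_distrib_left algebra_simps)
    then have gM: "g M = -1" using Iml[of M] N by simp
    have shift: "\<exists>e>0. \<forall>u. 0 < u \<longrightarrow> u \<le> e \<longrightarrow> p + u\<^sup>2 *\<^sub>R d + u ^ 5 *\<^sub>R M \<in> \<Omega>"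
      if "g d = 0" "B d d \<le> 0" for d
      by (rule inward_shift_of_tangent_ray[OF ldf r0]) (use that gM in \<open>simp_all add: g_def B_def\<close>)
    obtain e\<^sub>1 where e1: "e\<^sub>1 > 0" "\<forall>u. 0 < u \<longrightarrow> u \<le> e\<^sub>1 \<longrightarrow> p + u\<^sup>2 *\<^sub>R v + u ^ 5 *\<^sub>R M \<in> \<Omega>"
      using shift[OF gv(1) B0(1)] by (elim exE conjE) (rule that)
    have "g (- v) = 0" "B (- v) (- v) \<le> 0" using gv(1) B0(1) by (simp_all only: gneg Bneg minus_zero)
    from shift[OF this] obtain e\<^sub>2 where e2: "e\<^sub>2 > 0"
      "\<forall>u. 0 < u \<longrightarrow> u \<le> e\<^sub>2 \<longrightarrow> p + u\<^sup>2 *\<^sub>R (- v) + u ^ 5 *\<^sub>R M \<in> \<Omega>"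
      by (elim exE conjE) (rule that)
    obtain e\<^sub>3 where e3: "e\<^sub>3 > 0" "\<forall>u. 0 < u \<longrightarrow> u \<le> e\<^sub>3 \<longrightarrow> p + u\<^sup>2 *\<^sub>R (\<i> *s v) + u ^ 5 *\<^sub>R M \<in> \<Omega>"
      using shift[OF gv(2) B0(2)] by (elim exE conjE) (rule that)
    have "g (- (\<i> *s v)) = 0" "B (- (\<i> *s v)) (- (\<i> *s v)) \<le> 0" using gv(2) B0(2) by (simp_all only: gneg Bneg minus_zero)
    from shift[OF this] obtain e\<^sub>4 where e4: "e\<^sub>4 > 0"
      "\<forall>u. 0 < u \<longrightarrow> u \<le> e\<^sub>4 \<longrightarrow> p + u\<^sup>2 *\<^sub>R (- (\<i> *s v)) + u ^ 5 *\<^sub>R M \<in> \<Omega>"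
      by (elim exE conjE) (rule that)
    define e where "e = min (min e\<^sub>1 e\<^sub>2) (min e\<^sub>3 e\<^sub>4)"
    have "p + (\<i> * of_real (u ^ 5)) *s N + t *s v \<in> \<Omega>" if u: "0 < u" "u \<le> e" and t: "cmod t < u\<^sup>2 / 2" for u t
    proof -
      have ue: "u \<le> e\<^sub>1" "u \<le> e\<^sub>2" "u \<le> e\<^sub>3" "u \<le> e\<^sub>4" using u(2) by (simp_all add: e_def)
      have "(p + u ^ 5 *\<^sub>R M) + t *s v \<in> \<Omega>"
      proof (rule convex_contains_cross_disc[OF \<Omega>(2) _ _ _ _ t])
        show "p + u ^ 5 *\<^sub>R M + u\<^sup>2 *\<^sub>R v \<in> \<Omega>" using e1(2)[rule_format, OF u(1) ue(1)] by (simp only: add.assoc add.commute[of "u ^ 5 *\<^sub>R M"])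
        show "p + u ^ 5 *\<^sub>R M - u\<^sup>2 *\<^sub>R v \<in> \<Omega>" using e2(2)[rule_format, OF u(1) ue(2)] by (simp add: algebra_simps)
        show "p + u ^ 5 *\<^sub>R M + u\<^sup>2 *\<^sub>R (\<i> *s v) \<in> \<Omega>" using e3(2)[rule_format, OF u(1) ue(3)] by (simp only: add.assoc add.commute[of "u ^ 5 *\<^sub>R M"])
        show "p + u ^ 5 *\<^sub>R M - u\<^sup>2 *\<^sub>R (\<i> *s v) \<in> \<Omega>" using e4(2)[rule_format, OF u(1) ue(4)] by (simp add: algebra_simps)
      qed
      moreover have "u ^ 5 *\<^sub>R M = (\<i> * of_real (u ^ 5)) *s N"
        by (simp add: M_def vec_eq_iff scaleR_conv_of_real[where 'a = complex])
      ultimately show ?thesis by simp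
    qed
    moreover have "e > 0" using e1(1) e2(1) e3(1) e4(1) by (simp add: e_def)
    ultimately show "\<exists>e>0. \<forall>u t. 0 < u \<longrightarrow> u \<le> e \<longrightarrow> cmod t < u\<^sup>2 / 2 \<longrightarrow> p + (\<i> * of_real (u ^ 5)) *s N + t *s v \<in> \<Omega>"
      by blast
  qed
qed

section \<open>Limits of domains that are not strongly pseudoconvex\<close>

lemma linear_matrix_vector_mult_complex: "linear ((*v) M)" for M :: "complex ^ 'd ^ 'd"
  by (intro linearI) (simp_all add: scaleR_eq_scalar_mult matrix_vector_right_distrib vector_scalar_commute)

lemma Aff_comp:
  assumes "A \<in> Aff" "B \<in> Aff"
  shows "A \<circ> B \<in> Aff"
proof -
  obtain M b where M: "invertible M" "A = (\<lambda>z. M *v z + b)" using assms(1) unfolding Aff_def by blast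
  obtain N c where N: "invertible N" "B = (\<lambda>z. N *v z + c)" using assms(2) unfolding Aff_def by blast
  have "A \<circ> B = (\<lambda>z. (M ** N) *v z + (M *v c + b))"
    by (simp add: M N fun_eq_iff matrix_vector_right_distrib matrix_vector_mul_assoc)
  moreover have "invertible (M ** N)" using M(1) N(1) by (rule invertible_mult)
  ultimately show ?thesis unfolding Aff_def by blast
qed

text \<open>A complex linear form and a nonzero vector in its kernel become a coordinate function and a basis
  vector of another index. The two indices depend on the data, which is why all pairs of them are
  allowed for the limit domains.\<close>

lemma adapted_coordinates:
  fixes v :: "complex ^ 'd"
  assumes l: "l \<noteq> (\<lambda>j. 0)" and v: "v \<noteq> 0" "(\<Sum>j\<in>UNIV. l j * v $ j) = 0"
  obtains i k and Q :: "complex ^ 'd ^ 'd" where "i \<noteq> k" "invertible Q" "Q *v v = axis k 1"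
    "\<And>z. (Q *v z) $ i = (\<Sum>j\<in>UNIV. l j * z $ j)"
proof -
  obtain i where i: "l i \<noteq> 0" using l by fastforce
  have single: "(\<Sum>j\<in>UNIV. l j * z $ j) = l i * z $ i" if "\<And>j. j \<noteq> i \<Longrightarrow> z $ j = 0" for z :: "complex ^ 'd"
  proof -
    have "(\<Sum>j\<in>UNIV. l j * z $ j) = (\<Sum>j\<in>UNIV. if j = i then l i * z $ i else 0)"
      by (rule sum.cong) (use that in auto)
    then show ?thesis by simp
  qed
  have "\<exists>k. k \<noteq> i \<and> v $ k \<noteq> 0"
  proof (rule ccontr)
    assume "\<nexists>k. k \<noteq> i \<and> v $ k \<noteq> 0"
    then have *: "v $ j = 0" if "j \<noteq> i" for j using that by blast
    then have "v $ i = 0" using single[of v] v(2) i by simp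
    then have "v $ j = 0" for j using *[of j] by (cases "j = i") auto
    then show False using v(1) by (simp add: vec_eq_iff)
  qed
  then obtain k where k: "k \<noteq> i" "v $ k \<noteq> 0" by blast
  define Q :: "complex ^ 'd ^ 'd" where
    "Q = (\<chi> j. if j = i then (\<chi> m. l m) else if j = k then axis k (1 / v $ k)
      else axis j 1 - axis k (v $ j / v $ k))"
  have ax: "(\<Sum>m\<in>UNIV. axis j c $ m * z $ m) = c * z $ j" for j c and z :: "complex ^ 'd"
  proof -
    have "(\<Sum>m\<in>UNIV. axis j c $ m * z $ m) = (\<Sum>m\<in>UNIV. if m = j then c * z $ j else 0)"
      by (rule sum.cong) (auto simp: axis_def)
    then show ?thesis by simp
  qed
  have Qi: "(Q *v z) $ i = (\<Sum>j\<in>UNIV. l j * z $ j)" for z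
    by (simp add: Q_def matrix_vector_mult_def)
  have Qk: "(Q *v z) $ k = z $ k / v $ k" for z
    using k(1) ax[of k "1 / v $ k" z] by (simp add: Q_def matrix_vector_mult_def)
  have Qj: "(Q *v z) $ j = z $ j - v $ j / v $ k * z $ k" if "j \<noteq> i" "j \<noteq> k" for z j
    using that ax[of j 1 z] ax[of k "v $ j / v $ k" z]
    by (simp add: Q_def matrix_vector_mult_def left_diff_distrib sum_subtractf)
  have "inj ((*v) Q)"
    unfolding linear_injective_0[OF linear_matrix_vector_mult_complex]
  proof (intro allI impI)
    fix z assume z: "Q *v z = 0"
    have zk: "z $ k = 0" using Qk[of z] z k(2) by simp
    have zj: "z $ j = 0" if "j \<noteq> i" for j
      using Qj[OF that, of z] z zk by (cases "j = k") auto
    then have "z $ i = 0" using single[of z] Qi[of z] z i by simp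
    then have "z $ j = 0" for j using zj[of j] by (cases "j = i") auto
    then show "z = 0" by (simp add: vec_eq_iff)
  qed
  then have "invertible Q"
    using matrix_left_invertible_injective[of Q] invertible_left_inverse[of Q] by blast
  moreover have "Q *v v = axis k 1"
  proof -
    have "(Q *v v) $ j = axis k 1 $ j" for j
      using Qi[of v] Qk[of v] Qj[of j v] v(2) k by (cases "j = i"; cases "j = k") (auto simp: axis_def)
    then show ?thesis by (simp add: vec_eq_iff)
  qed
  ultimately show ?thesis using that[of i k Q] k(1) Qi by blast
qed

lemma degenerate_domain_limit:
  fixes \<Omega> :: "(complex ^ 'd) set"
  assumes "bounded \<Omega>" "convex_domain \<Omega>" "smooth_boundary \<Omega>" "\<not> strongly_pseudoconvex \<Omega>"
  shows "\<exists>x A K a b. (\<forall>n. x n \<in> \<Omega>) \<and> approaches_boundary x \<Omega> \<and> (\<forall>n. A n \<in> Aff) \<and>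
    a \<noteq> b \<and> degenerate_body a b K \<and> pointed_conv (\<lambda>n. aff_act (A n) (\<Omega>, x n)) (interior K, 0)"
proof -
  have \<Omega>: "open \<Omega>" "convex \<Omega>" using assms(2) by (auto simp: convex_domain_def)
  obtain p v and l :: "'d \<Rightarrow> complex" where p: "p \<in> frontier \<Omega>"
    and v: "v \<noteq> 0" "(\<Sum>j\<in>UNIV. l j * v $ j) = 0" and l: "l \<noteq> (\<lambda>j. 0)"
    and pos: "\<And>z. z \<in> \<Omega> \<Longrightarrow> Im (\<Sum>j\<in>UNIV. l j * (z - p) $ j) > 0"
    and nrm: "\<And>y. Im (\<Sum>j\<in>UNIV. l j * y $ j) > 0 \<Longrightarrow> \<forall>\<^sub>F \<delta> in at_right 0. p + \<delta> *\<^sub>R y \<in> \<Omega>"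
    and tng: "\<And>N. (\<Sum>j\<in>UNIV. l j * N $ j) = 1 \<Longrightarrow> \<exists>e>0. \<forall>u t. 0 < u \<longrightarrow> u \<le> e \<longrightarrow> cmod t < u\<^sup>2 / 2 \<longrightarrow>
      p + (\<i> * of_real (u ^ 5)) *s N + t *s v \<in> \<Omega>"
    by (rule degenerate_boundary_point[OF assms(2-4)]) (rule that)
  obtain i k and Q :: "complex ^ 'd ^ 'd" where ik: "i \<noteq> k" and Q: "invertible Q" "Q *v v = axis k 1"
    and Qi: "\<And>z. (Q *v z) $ i = (\<Sum>j\<in>UNIV. l j * z $ j)"
    by (rule adapted_coordinates[OF l v]) (rule that)
  obtain P where P: "P ** Q = mat 1" "Q ** P = mat 1" using Q(1) unfolding invertible_def by blast
  have PQ: "P *v (Q *v z) = z" for z unfolding matrix_vector_mul_assoc P by simp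
  have QP: "Q *v (P *v z) = z" for z unfolding matrix_vector_mul_assoc P by simp
  define T where "T z = Q *v (z - p)" for z
  define \<Omega>' where "\<Omega>' = T ` \<Omega>"
  have Tinv: "T (p + P *v y) = y" for y by (simp add: T_def QP)
  have invT: "p + P *v T z = z" for z by (simp add: T_def PQ)
  have mem: "y \<in> \<Omega>' \<longleftrightarrow> p + P *v y \<in> \<Omega>" for y
  proof
    assume "p + P *v y \<in> \<Omega>"
    from imageI[OF this, of T] show "y \<in> \<Omega>'" by (simp only: Tinv \<Omega>'_def)
  qed (auto simp: \<Omega>'_def invT)
  have lP: "(\<Sum>j\<in>UNIV. l j * (P *v y) $ j) = y $ i" for y by (simp add: Qi[symmetric] QP)
  have Padd: "P *v (y + z) = P *v y + P *v z" for y z by (rule matrix_vector_right_distrib)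
  have Ps: "P *v (c *s y) = c *s (P *v y)" for c y by (simp add: vector_scalar_commute)
  have img: "\<Omega>' = (*v) Q ` ((+) (- p) ` \<Omega>)" by (simp add: \<Omega>'_def T_def image_image)
  have Pk: "P *v axis k 1 = v" using PQ[of v] Q(2) by simp
  define N where "N = P *v axis i 1"
  have "(\<Sum>j\<in>UNIV. l j * N $ j) = 1" by (simp add: N_def lP axis_def)
  from tng[OF this] obtain e where e: "e > 0" "\<forall>u t. 0 < u \<longrightarrow> u \<le> e \<longrightarrow> cmod t < u\<^sup>2 / 2 \<longrightarrow>
      p + (\<i> * of_real (u ^ 5)) *s N + t *s v \<in> \<Omega>"
    by (elim exE conjE) (rule that)
  have "\<exists>x A K. (\<forall>n. x n \<in> \<Omega>') \<and> x \<longlonglongrightarrow> 0 \<and> (\<forall>n. A n \<in> Aff) \<and> degenerate_body i k K \<and>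
    pointed_conv (\<lambda>n. aff_act (A n) (\<Omega>', x n)) (interior K, 0)"
  proof (rule rescaling_limit[OF _ _ _ ik])
    have "continuous_on UNIV (\<lambda>y. p + P *v y)"
      by (intro continuous_intros matrix_vector_mult_linear_continuous_on)
    from open_vimage[OF \<Omega>(1) this] have "open ((\<lambda>y. p + P *v y) -` \<Omega>)" .
    moreover have "\<Omega>' = (\<lambda>y. p + P *v y) -` \<Omega>" using mem by blast
    ultimately show "open \<Omega>'" by simp
    show "convex \<Omega>'"
      unfolding img by (intro convex_linear_image linear_matrix_vector_mult_complex convex_translation \<Omega>(2))
    show "bounded \<Omega>'"
      unfolding img using linear_matrix_vector_mult_complex[of Q]
      by (intro bounded_linear_image bounded_translation assms(1)) (simp add: linear_conv_bounded_linear)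
    show "Im (y $ i) > 0" if "y \<in> \<Omega>'" for y
      using pos[of "p + P *v y"] that by (simp add: mem lP)
    show "\<forall>\<^sub>F \<delta> in at_right 0. axis i (of_real \<delta> * w) \<in> \<Omega>'" if "Im w > 0" for w
    proof -
      have "\<forall>\<^sub>F \<delta> in at_right 0. p + \<delta> *\<^sub>R (P *v axis i w) \<in> \<Omega>"
        by (rule nrm) (use that in \<open>simp add: lP axis_def\<close>)
      then show ?thesis
        by (simp only: mem scaleR_eq_scalar_mult Ps[symmetric] scalar_mult_axis)
    qed
    show "axis i (\<i> * of_real (u ^ 5)) + axis k t \<in> \<Omega>'" if "0 < u" "u \<le> e" "cmod t < 1/2 * u\<^sup>2" for u t
    proof -
      have "p + (\<i> * of_real (u ^ 5)) *s N + t *s v \<in> \<Omega>" using e(2)[rule_format, of u t] that by simp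
      moreover have "P *v (axis i (\<i> * of_real (u ^ 5)) + axis k t) = (\<i> * of_real (u ^ 5)) *s N + t *s v"
        unfolding Padd N_def Pk[symmetric] Ps[symmetric] scalar_mult_axis by simp
      ultimately show ?thesis by (simp only: mem add.assoc)
    qed
  qed (use e(1) in auto)
  then obtain x A K where x: "\<forall>n. x n \<in> \<Omega>'" "x \<longlonglongrightarrow> 0" and A: "\<forall>n. A n \<in> Aff" and K: "degenerate_body i k K"
    and conv: "pointed_conv (\<lambda>n. aff_act (A n) (\<Omega>', x n)) (interior K, 0)"
    by (elim exE conjE) (rule that)
  define x' where "x' n = p + P *v x n" for n
  have "T = (\<lambda>z. Q *v z + - (Q *v p))" by (simp add: T_def fun_eq_iff matrix_vector_mult_diff_distrib)
  then have "T \<in> Aff" using Q(1) unfolding Aff_def by blast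
  then have A': "A n \<circ> T \<in> Aff" for n using A by (intro Aff_comp) auto
  have x'O: "x' n \<in> \<Omega>" for n using x(1) mem by (simp add: x'_def)
  have lim: "(\<lambda>n. dist (x' n) p) \<longlonglongrightarrow> 0"
  proof -
    have "bounded_linear ((*v) P)"
      using linear_matrix_vector_mult_complex[of P] by (simp add: linear_conv_bounded_linear)
    from bounded_linear.tendsto[OF this x(2)] have "(\<lambda>n. P *v x n) \<longlonglongrightarrow> 0" by simp
    then have "(\<lambda>n. norm (P *v x n)) \<longlonglongrightarrow> 0" by (rule tendsto_norm_zero)
    then show ?thesis by (simp add: x'_def dist_norm)
  qed
  have "approaches_boundary x' \<Omega>"
    unfolding approaches_boundary_def
    by (rule tendsto_sandwich[OF _ _ tendsto_const lim]) (use infdist_le[OF p] in \<open>simp_all add: infdist_nonneg\<close>)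
  moreover have "aff_act (A n \<circ> T) (\<Omega>, x' n) = aff_act (A n) (\<Omega>', x n)" for n
    by (simp add: aff_act_def \<Omega>'_def image_comp x'_def Tinv)
  then have "pointed_conv (\<lambda>n. aff_act (A n \<circ> T) (\<Omega>, x' n)) (interior K, 0)" using conv by simp
  ultimately show ?thesis using x'O A' ik K
    by (intro exI[of _ x'] exI[of _ "\<lambda>n. A n \<circ> T"] exI[of _ K] exI[of _ i] exI[of _ k]) auto
qed

theorem proposition1p16:
  shows "\<exists>L :: (complex ^ 'd) set set.
    L \<subseteq> X_dom \<and> compactin local_hausdorff_topology L \<and>
    (\<forall>\<Omega>\<in>L. \<not> biholomorphic \<Omega> (ball (0 :: complex ^ 'd) 1)) \<and>
    (\<forall>\<Omega> :: (complex ^ 'd) set.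
       bounded \<Omega> \<longrightarrow> convex_domain \<Omega> \<longrightarrow> smooth_boundary \<Omega> \<longrightarrow> \<not> strongly_pseudoconvex \<Omega> \<longrightarrow>
       (\<exists>(x :: nat \<Rightarrow> complex ^ 'd) (A :: nat \<Rightarrow> complex ^ 'd \<Rightarrow> complex ^ 'd) \<Omega>'.
          (\<forall>n. x n \<in> \<Omega>) \<and> approaches_boundary x \<Omega> \<and> (\<forall>n. A n \<in> Aff) \<and>
          \<Omega>' \<in> L \<and> (\<Omega>', 0) \<in> X_dom_pt \<and>
          pointed_conv (\<lambda>n. aff_act (A n) (\<Omega>, x n)) (\<Omega>', 0)))"
proof (rule exI, intro conjI ballI allI impI)
  let ?bodies = "\<lambda>(a, b). interior ` {K :: (complex ^ 'd) set. degenerate_body a b K}"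
  let ?L = "\<Union> (?bodies ` {(a, b). a \<noteq> b})"
  show "?L \<subseteq> X_dom" using degenerate_body_X_dom by auto
  show "compactin local_hausdorff_topology ?L"
    by (rule compactin_Union) (auto intro: compactin_degenerate_bodies)
  show "\<not> biholomorphic \<Omega> (ball (0 :: complex ^ 'd) 1)" if "\<Omega> \<in> ?L" for \<Omega>
    using that degenerate_body_not_ball by auto
  fix \<Omega> :: "(complex ^ 'd) set"
  assume \<Omega>: "bounded \<Omega>" "convex_domain \<Omega>" "smooth_boundary \<Omega>" "\<not> strongly_pseudoconvex \<Omega>"
  obtain x A K and a b :: 'd where x: "\<forall>n. x n \<in> \<Omega>" "approaches_boundary x \<Omega>" and A: "\<forall>n. A n \<in> Aff"
    and K: "a \<noteq> b" "degenerate_body a b K"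
    and conv: "pointed_conv (\<lambda>n. aff_act (A n) (\<Omega>, x n)) (interior K, 0)"
    using degenerate_domain_limit[OF \<Omega>] by (elim exE conjE) (rule that)
  have "interior K \<in> ?L" using K by auto
  moreover have "(interior K, 0) \<in> X_dom_pt"
    using degenerate_body_X_dom[OF K(2)] degenerate_body_zero_interior[OF K(2)] by (simp add: X_dom_pt_def)
  ultimately show "\<exists>(x :: nat \<Rightarrow> complex ^ 'd) (A :: nat \<Rightarrow> complex ^ 'd \<Rightarrow> complex ^ 'd) \<Omega>'.
          (\<forall>n. x n \<in> \<Omega>) \<and> approaches_boundary x \<Omega> \<and> (\<forall>n. A n \<in> Aff) \<and>
          \<Omega>' \<in> ?L \<and> (\<Omega>', 0) \<in> X_dom_pt \<and>
          pointed_conv (\<lambda>n. aff_act (A n) (\<Omega>, x n)) (\<Omega>', 0)"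
    using x A conv by (intro exI[of _ x] exI[of _ A] exI[of _ "interior K"] conjI)
qed

end
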